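(* Let $n\geq 3$ and let $\mathcal{O}$ be the ring of integers of a number field. If $\mathcal{O}$ has an infinite group of units, then $\mathrm{GL}_n(\mathcal{O})$ is not bi-interpretable with $\mathbb{Z}$ (for any finite tuple of parameters from $\mathrm{GL}_n(\mathcal{O})$).
   Context: The ring $\mathbb{Z}$ is viewed in the first-order language of unitary rings and $\mathrm{GL}_n(\mathcal{O})$ in the first-order language of groups. Interpretations are allowed to use finitely many parameters. Bi-interpretability: let $\mathfrak{A},\mathfrak{B}$ be structures in possibly different signatures. Assume $\mathfrak{A}$ is interpretable in $\mathfrak{B}$ via an interpretation $\Delta$ and $\mathfrak{B}$ is interpretable in $\mathfrak{A}$ via an interpretation $\Gamma$. Composing the two interpretations gives an isomorphic copy $\tilde{\mathfrak{A}}$ of $\mathfrak{A}$ defined in $\mathfrak{A}$ and an isomorphic copy $\tilde{\mathfrak{B}}$ of $\mathfrak{B}$ defined in $\mathfrak{B}$. Then $\mathfrak{A}$ is bi-interpretable with $\mathfrak{B}$ if (for some such $\Delta,\Gamma$) there is an isomorphism $\mathfrak{A}\cong\tilde{\mathfrak{A}}$ first-order definable in $\mathfrak{A}$ and an isomorphism $\mathfrak{B}\cong\tilde{\mathfrak{B}}$ first-order definable in $\mathfrak{B}$. *)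

theory Defs
  imports
    "HOL-Algebra.IntRing"
    "HOL-Computational_Algebra.Polynomial"
    "Jordan_Normal_Form.Matrix"
begin

section \<open>First-order logic\<close>

text \<open>A symbol with arity \<^term>\<open>None\<close> does not belong to the signature; constants are nullary
  function symbols.\<close>

record ('f, 'r) signature =
  fun_arity :: "'f \<Rightarrow> nat option"
  rel_arity :: "'r \<Rightarrow> nat option"

datatype 'f fo_term = Var nat | Fn 'f "'f fo_term list"

datatype ('f, 'r) formula =
    Eq "'f fo_term" "'f fo_term"
  | Rel 'r "'f fo_term list"
  | Neg "('f, 'r) formula"
  | Conj "('f, 'r) formula" "('f, 'r) formula"
  | Ex nat "('f, 'r) formula"

primrec term_vars :: "'f fo_term \<Rightarrow> nat set" where
  "term_vars (Var i) = {i}"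
| "term_vars (Fn f ts) = \<Union> (set (map term_vars ts))"

primrec free_vars :: "('f, 'r) formula \<Rightarrow> nat set" where
  "free_vars (Eq s t) = term_vars s \<union> term_vars t"
| "free_vars (Rel r ts) = \<Union> (set (map term_vars ts))"
| "free_vars (Neg \<phi>) = free_vars \<phi>"
| "free_vars (Conj \<phi> \<psi>) = free_vars \<phi> \<union> free_vars \<psi>"
| "free_vars (Ex i \<phi>) = free_vars \<phi> - {i}"

primrec term_of_sig :: "('f, 'r) signature \<Rightarrow> 'f fo_term \<Rightarrow> bool" where
  "term_of_sig L (Var i) \<longleftrightarrow> True"
| "term_of_sig L (Fn f ts) \<longleftrightarrow>
     fun_arity L f = Some (length ts) \<and> list_all id (map (term_of_sig L) ts)"

primrec formula_of_sig :: "('f, 'r) signature \<Rightarrow> ('f, 'r) formula \<Rightarrow> bool" where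
  "formula_of_sig L (Eq s t) \<longleftrightarrow> term_of_sig L s \<and> term_of_sig L t"
| "formula_of_sig L (Rel r ts) \<longleftrightarrow> rel_arity L r = Some (length ts) \<and> list_all (term_of_sig L) ts"
| "formula_of_sig L (Neg \<phi>) \<longleftrightarrow> formula_of_sig L \<phi>"
| "formula_of_sig L (Conj \<phi> \<psi>) \<longleftrightarrow> formula_of_sig L \<phi> \<and> formula_of_sig L \<psi>"
| "formula_of_sig L (Ex i \<phi>) \<longleftrightarrow> formula_of_sig L \<phi>"

record ('f, 'r, 'a) fo_structure =
  universe :: "'a set"
  fun_interp :: "'f \<Rightarrow> 'a list \<Rightarrow> 'a"
  rel_interp :: "'r \<Rightarrow> 'a list \<Rightarrow> bool"

definition tuples :: "nat \<Rightarrow> 'a set \<Rightarrow> 'a list set" where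
  "tuples k A = {xs. length xs = k \<and> set xs \<subseteq> A}"

definition is_structure :: "('f, 'r) signature \<Rightarrow> ('f, 'r, 'a) fo_structure \<Rightarrow> bool" where
  "is_structure L M \<longleftrightarrow> universe M \<noteq> {} \<and>
     (\<forall>f k. fun_arity L f = Some k \<longrightarrow>
        (\<forall>xs \<in> tuples k (universe M). fun_interp M f xs \<in> universe M))"

primrec term_val :: "('f, 'r, 'a) fo_structure \<Rightarrow> (nat \<Rightarrow> 'a) \<Rightarrow> 'f fo_term \<Rightarrow> 'a" where
  "term_val M e (Var i) = e i"
| "term_val M e (Fn f ts) = fun_interp M f (map (term_val M e) ts)"

primrec sat :: "('f, 'r, 'a) fo_structure \<Rightarrow> (nat \<Rightarrow> 'a) \<Rightarrow> ('f, 'r) formula \<Rightarrow> bool" where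
  "sat M e (Eq s t) \<longleftrightarrow> term_val M e s = term_val M e t"
| "sat M e (Rel r ts) \<longleftrightarrow> rel_interp M r (map (term_val M e) ts)"
| "sat M e (Neg \<phi>) \<longleftrightarrow> \<not> sat M e \<phi>"
| "sat M e (Conj \<phi> \<psi>) \<longleftrightarrow> sat M e \<phi> \<and> sat M e \<psi>"
| "sat M e (Ex i \<phi>) \<longleftrightarrow> (\<exists>a \<in> universe M. sat M (e(i := a)) \<phi>)"

text \<open>The entry \<open>xs ! i\<close> is the value of the variable \<open>i\<close>. Only used for formulas whose free
  variables are below \<open>length xs\<close>.\<close>

definition holds :: "('f, 'r, 'a) fo_structure \<Rightarrow> ('f, 'r) formula \<Rightarrow> 'a list \<Rightarrow> bool" where
  "holds M \<phi> xs \<longleftrightarrow> sat M (\<lambda>i. xs ! i) \<phi>"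

definition is_formula :: "('f, 'r) signature \<Rightarrow> nat \<Rightarrow> ('f, 'r) formula \<Rightarrow> bool" where
  "is_formula L k \<phi> \<longleftrightarrow> formula_of_sig L \<phi> \<and> free_vars \<phi> \<subseteq> {..<k}"

text \<open>Definability of a \<open>k\<close>-ary relation, with a finite tuple \<open>ps\<close> of parameters.\<close>

definition definable :: "('f, 'r) signature \<Rightarrow> ('f, 'r, 'a) fo_structure \<Rightarrow> nat \<Rightarrow> 'a list set \<Rightarrow> bool" where
  "definable L M k R \<longleftrightarrow>
     (\<exists>\<phi> ps. set ps \<subseteq> universe M \<and> is_formula L (length ps + k) \<phi> \<and>
        R = {xs \<in> tuples k (universe M). holds M \<phi> (ps @ xs)})"

definition structure_iso ::
  "('f, 'r) signature \<Rightarrow> ('f, 'r, 'a) fo_structure \<Rightarrow> ('f, 'r, 'b) fo_structure \<Rightarrow> ('a \<Rightarrow> 'b) \<Rightarrow> bool" where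
  "structure_iso L M N h \<longleftrightarrow>
     bij_betw h (universe M) (universe N) \<and>
     (\<forall>f k. fun_arity L f = Some k \<longrightarrow>
        (\<forall>xs \<in> tuples k (universe M). h (fun_interp M f xs) = fun_interp N f (map h xs))) \<and>
     (\<forall>r k. rel_arity L r = Some k \<longrightarrow>
        (\<forall>xs \<in> tuples k (universe M). rel_interp M r xs \<longleftrightarrow> rel_interp N r (map h xs)))"


section \<open>Interpretations\<close>

text \<open>The formulas of an interpretation of an \<open>('f, 'r)\<close>-structure in a \<open>('g, 's)\<close>-structure.
  Elements are represented by \<open>code_dim\<close>-tuples. The first free variables of every formula stand
  for the parameters; they are followed by one tuple in \<open>dom_fm\<close>, two in \<open>eq_fm\<close>, by the tuples of
  the arguments and of the value in \<open>fun_fm\<close> (the graph of the function), and by those of the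
  arguments in \<open>rel_fm\<close>.\<close>

record ('f, 'r, 'g, 's) code =
  code_dim :: nat
  dom_fm :: "('g, 's) formula"
  eq_fm :: "('g, 's) formula"
  fun_fm :: "'f \<Rightarrow> ('g, 's) formula"
  rel_fm :: "'r \<Rightarrow> ('g, 's) formula"

definition is_code ::
  "('f, 'r) signature \<Rightarrow> ('g, 's) signature \<Rightarrow> nat \<Rightarrow> ('f, 'r, 'g, 's) code \<Rightarrow> bool" where
  "is_code L L' m \<Delta> \<longleftrightarrow>
     is_formula L' (m + code_dim \<Delta>) (dom_fm \<Delta>) \<and>
     is_formula L' (m + 2 * code_dim \<Delta>) (eq_fm \<Delta>) \<and>
     (\<forall>f k. fun_arity L f = Some k \<longrightarrow> is_formula L' (m + Suc k * code_dim \<Delta>) (fun_fm \<Delta> f)) \<and>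
     (\<forall>r k. rel_arity L r = Some k \<longrightarrow> is_formula L' (m + k * code_dim \<Delta>) (rel_fm \<Delta> r))"

definition code_dom :: "('f, 'r, 'g, 's) code \<Rightarrow> ('g, 's, 'b) fo_structure \<Rightarrow> 'b list \<Rightarrow> 'b list set" where
  "code_dom \<Delta> M ps = {xs \<in> tuples (code_dim \<Delta>) (universe M). holds M (dom_fm \<Delta>) (ps @ xs)}"

definition code_rel :: "('f, 'r, 'g, 's) code \<Rightarrow> ('g, 's, 'b) fo_structure \<Rightarrow> 'b list \<Rightarrow> ('b list \<times> 'b list) set" where
  "code_rel \<Delta> M ps =
     {(xs, ys). xs \<in> code_dom \<Delta> M ps \<and> ys \<in> code_dom \<Delta> M ps \<and> holds M (eq_fm \<Delta>) (ps @ xs @ ys)}"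

text \<open>The interpreted structure lives on the set of equivalence classes. The value of a function
  is the set of all tuples that represent it, which under \<open>admissible\<close> below is an equivalence
  class.\<close>

definition interpreted ::
  "('f, 'r, 'g, 's) code \<Rightarrow> ('g, 's, 'b) fo_structure \<Rightarrow> 'b list \<Rightarrow> ('f, 'r, 'b list set) fo_structure" where
  "interpreted \<Delta> M ps =
     \<lparr> universe = code_dom \<Delta> M ps // code_rel \<Delta> M ps,
       fun_interp = (\<lambda>f Xs. {ys \<in> code_dom \<Delta> M ps.
          \<exists>xss. list_all2 (\<in>) xss Xs \<and> holds M (fun_fm \<Delta> f) (ps @ concat xss @ ys)}),
       rel_interp = (\<lambda>r Xs. \<exists>xss. list_all2 (\<in>) xss Xs \<and> holds M (rel_fm \<Delta> r) (ps @ concat xss)) \<rparr>"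

definition respects_code ::
  "('f, 'r, 'g, 's) code \<Rightarrow> ('g, 's, 'b) fo_structure \<Rightarrow> 'b list \<Rightarrow> nat \<Rightarrow> ('g, 's) formula \<Rightarrow> bool" where
  "respects_code \<Delta> M ps k \<phi> \<longleftrightarrow>
     (\<forall>xss yss. length xss = k \<and> list_all2 (\<lambda>xs ys. (xs, ys) \<in> code_rel \<Delta> M ps) xss yss \<longrightarrow>
        (holds M \<phi> (ps @ concat xss) \<longleftrightarrow> holds M \<phi> (ps @ concat yss)))"

text \<open>The formulas of \<open>\<Delta>\<close> define, in \<open>M\<close> with the parameters \<open>ps\<close>, an equivalence relation
  together with well-defined operations and relations on its classes.\<close>

definition admissible ::
  "('f, 'r) signature \<Rightarrow> ('f, 'r, 'g, 's) code \<Rightarrow> ('g, 's, 'b) fo_structure \<Rightarrow> 'b list \<Rightarrow> bool" where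
  "admissible L \<Delta> M ps \<longleftrightarrow>
     equiv (code_dom \<Delta> M ps) (code_rel \<Delta> M ps) \<and>
     (\<forall>f k. fun_arity L f = Some k \<longrightarrow> respects_code \<Delta> M ps (Suc k) (fun_fm \<Delta> f)) \<and>
     (\<forall>r k. rel_arity L r = Some k \<longrightarrow> respects_code \<Delta> M ps k (rel_fm \<Delta> r)) \<and>
     is_structure L (interpreted \<Delta> M ps)"

text \<open>\<open>A\<close> is interpreted in \<open>B\<close> by \<open>\<Delta>\<close> with the parameters \<open>ps\<close> from \<open>B\<close>;
  \<open>h\<close> identifies \<open>A\<close> with the interpreted structure.\<close>

definition interpretation_via ::
  "('f, 'r) signature \<Rightarrow> ('f, 'r, 'a) fo_structure \<Rightarrow> ('g, 's) signature \<Rightarrow> ('g, 's, 'b) fo_structure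
    \<Rightarrow> ('f, 'r, 'g, 's) code \<Rightarrow> 'b list \<Rightarrow> ('a \<Rightarrow> 'b list set) \<Rightarrow> bool" where
  "interpretation_via L A L' B \<Delta> ps h \<longleftrightarrow>
     set ps \<subseteq> universe B \<and> is_code L L' (length ps) \<Delta> \<and> admissible L \<Delta> B ps \<and>
     structure_iso L A (interpreted \<Delta> B ps) h"


section \<open>Bi-interpretability\<close>

text \<open>Elements of the copy of \<open>A\<close> obtained by composing two interpretations are classes of tuples
  of classes of tuples over \<open>A\<close>. The concatenation of \<open>yss\<close> is a tuple over \<open>A\<close> that represents the
  element \<open>\<alpha> a\<close> if \<open>yss\<close> is obtained by choosing representatives in some \<open>Xs \<in> \<alpha> a\<close>.
  Definability of \<open>\<alpha>\<close> means that the relation between \<open>a\<close> and the tuples representing \<open>\<alpha> a\<close> is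
  definable.\<close>

definition rep_graph :: "'a set \<Rightarrow> ('a \<Rightarrow> 'a list set list set) \<Rightarrow> 'a list set" where
  "rep_graph A \<alpha> = {a # concat yss | a yss. a \<in> A \<and> (\<exists>Xs \<in> \<alpha> a. list_all2 (\<in>) yss Xs)}"

text \<open>The copy of \<open>A\<close> defined in \<open>A\<close> is obtained by interpreting with \<open>\<Delta>\<close> inside the copy of \<open>B\<close>
  that \<open>\<Gamma>\<close> interprets in \<open>A\<close>; the parameters \<open>ps\<close> of \<open>\<Delta>\<close>, which are elements of \<open>B\<close>, are carried
  over to that copy by \<open>g\<close>. The definable isomorphism \<open>\<alpha>\<close> need not be the one induced by
  \<open>f\<close> and \<open>g\<close>.\<close>

definition bi_interpretable ::
  "('f, 'r) signature \<Rightarrow> ('f, 'r, 'a) fo_structure \<Rightarrow> ('g, 's) signature \<Rightarrow> ('g, 's, 'b) fo_structure \<Rightarrow> bool" where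
  "bi_interpretable L A L' B \<longleftrightarrow>
     (\<exists>\<Delta> ps f \<Gamma> qs g.
        interpretation_via L A L' B \<Delta> ps f \<and>
        interpretation_via L' B L A \<Gamma> qs g \<and>
        (\<exists>\<alpha>. structure_iso L A (interpreted \<Delta> (interpreted \<Gamma> A qs) (map g ps)) \<alpha> \<and>
             definable L A (Suc (code_dim \<Delta> * code_dim \<Gamma>)) (rep_graph (universe A) \<alpha>)) \<and>
        (\<exists>\<beta>. structure_iso L' B (interpreted \<Gamma> (interpreted \<Delta> B ps) (map f qs)) \<beta> \<and>
             definable L' B (Suc (code_dim \<Gamma> * code_dim \<Delta>)) (rep_graph (universe B) \<beta>)))"


section \<open>Groups and unitary rings as first-order structures\<close>

datatype group_symbol = Group_One | Group_Inv | Group_Mult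

datatype ring_symbol = Ring_Zero | Ring_One | Ring_Minus | Ring_Plus | Ring_Times

text \<open>Both languages have no relation symbols; \<^typ>\<open>unit\<close> is a dummy type of relation names.\<close>

definition group_language :: "(group_symbol, unit) signature" where
  "group_language =
     \<lparr> fun_arity = (\<lambda>f. Some (case f of Group_One \<Rightarrow> 0 | Group_Inv \<Rightarrow> 1 | Group_Mult \<Rightarrow> 2)),
       rel_arity = (\<lambda>_. None) \<rparr>"

definition ring_language :: "(ring_symbol, unit) signature" where
  "ring_language =
     \<lparr> fun_arity = (\<lambda>f. Some (case f of Ring_Zero \<Rightarrow> 0 | Ring_One \<Rightarrow> 0 | Ring_Minus \<Rightarrow> 1
                                      | Ring_Plus \<Rightarrow> 2 | Ring_Times \<Rightarrow> 2)),
       rel_arity = (\<lambda>_. None) \<rparr>"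

definition group_structure :: "('a, 'm) monoid_scheme \<Rightarrow> (group_symbol, unit, 'a) fo_structure" where
  "group_structure G =
     \<lparr> universe = carrier G,
       fun_interp = (\<lambda>f xs. case f of
            Group_One \<Rightarrow> \<one>\<^bsub>G\<^esub>
          | Group_Inv \<Rightarrow> inv\<^bsub>G\<^esub> (xs ! 0)
          | Group_Mult \<Rightarrow> (xs ! 0) \<otimes>\<^bsub>G\<^esub> (xs ! 1)),
       rel_interp = (\<lambda>_ _. False) \<rparr>"

definition ring_structure :: "('a, 'm) ring_scheme \<Rightarrow> (ring_symbol, unit, 'a) fo_structure" where
  "ring_structure R =
     \<lparr> universe = carrier R,
       fun_interp = (\<lambda>f xs. case f of
            Ring_Zero \<Rightarrow> \<zero>\<^bsub>R\<^esub>
          | Ring_One \<Rightarrow> \<one>\<^bsub>R\<^esub>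
          | Ring_Minus \<Rightarrow> \<ominus>\<^bsub>R\<^esub> (xs ! 0)
          | Ring_Plus \<Rightarrow> (xs ! 0) \<oplus>\<^bsub>R\<^esub> (xs ! 1)
          | Ring_Times \<Rightarrow> (xs ! 0) \<otimes>\<^bsub>R\<^esub> (xs ! 1)),
       rel_interp = (\<lambda>_ _. False) \<rparr>"

lemma is_structure_group: "group G \<Longrightarrow> is_structure group_language (group_structure G)"
proof -
  assume "group G"
  then interpret group G .
  show ?thesis
    by (auto simp: is_structure_def group_language_def group_structure_def tuples_def
        length_Suc_conv numeral_2_eq_2 split: group_symbol.splits)
qed

lemma is_structure_ring: "ring R \<Longrightarrow> is_structure ring_language (ring_structure R)"
proof -
  assume "ring R"
  then interpret ring R .
  show ?thesis
    by (auto simp: is_structure_def ring_language_def ring_structure_def tuples_def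
        length_Suc_conv numeral_2_eq_2 split: ring_symbol.splits)
qed


section \<open>Number fields and general linear groups\<close>

text \<open>A number field is given as a subfield \<open>K\<close> of an arbitrary ambient field of characteristic
  zero (possibly \<open>K = UNIV\<close>) that is finite-dimensional over the rationals.\<close>

definition number_field :: "'a::field_char_0 set \<Rightarrow> bool" where
  "number_field K \<longleftrightarrow>
     0 \<in> K \<and> 1 \<in> K \<and>
     (\<forall>x \<in> K. \<forall>y \<in> K. x + y \<in> K \<and> x * y \<in> K) \<and>
     (\<forall>x \<in> K. - x \<in> K \<and> inverse x \<in> K) \<and>
     (\<exists>B. finite B \<and> K = module.span (\<lambda>(q::rat) x. of_rat q * x) B)"

definition ring_of_integers :: "'a::field_char_0 set \<Rightarrow> 'a set" where
  "ring_of_integers K = {x \<in> K. algebraic_int x}"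

definition units_in :: "'a::comm_ring_1 set \<Rightarrow> 'a set" where
  "units_in S = {u \<in> S. \<exists>v \<in> S. u * v = 1}"

definition mat_monoid :: "nat \<Rightarrow> 'a::comm_ring_1 set \<Rightarrow> 'a mat monoid" where
  "mat_monoid n S = \<lparr> carrier = {A \<in> carrier_mat n n. elements_mat A \<subseteq> S}, mult = (*), one = 1\<^sub>m n \<rparr>"

text \<open>For \<open>S\<close> a subring, the invertible matrices with entries in \<open>S\<close> whose inverse also has
  entries in \<open>S\<close>.\<close>

definition GL :: "nat \<Rightarrow> 'a::comm_ring_1 set \<Rightarrow> 'a mat monoid" where
  "GL n S = units_of (mat_monoid n S)"

end

theory Submission
  imports
    Defs
    "HOL-Algebra.Product_Groups"
    "Berlekamp_Zassenhaus.Factor_Bound"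
    "Jordan_Normal_Form.Char_Poly"
begin

text \<open>Let \<open>u\<close> be a unit of infinite order, \<open>z = u \<cdot> 1\<close> and \<open>a\<close> an elementary matrix. If \<open>GL\<^sub>n(\<O>)\<close>
  were bi-interpretable with the integers, every relation on the group that is arithmetical in the
  coordinates given by the interpretation would be definable with parameters in the group; by
  Goedel's coding of sequences this applies to \<open>P = {(a\<^sup>m, z\<^sup>m) | m > 0}\<close>.

  On the other hand, let \<open>G\<^sup>*\<close> be an ultrapower of the group with index set \<open>\<nat>\<close>. A homomorphism
  \<open>\<lambda>\<close> from the ultrapower of the unit group to the rationals gives the automorphism
  \<open>x \<mapsto> z\<^bsup>\<lambda>(det x) M\<^esup> x\<close> of \<open>G\<^sup>*\<close>, where \<open>M = (i!\<^sup>2)\<^sub>i\<close> is divisible by every standard integer, provided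
  that \<open>\<lambda>\<close> kills \<open>u\<^sup>M\<close>. If \<open>\<lambda>\<close> also kills the standard units, the automorphism fixes all
  parameters, and it fixes the matrices of determinant one, but with \<open>N = (i!)\<^sub>i\<close> and \<open>\<lambda>(u\<^bsup>nN\<^esup>) = 1\<close>
  it moves \<open>z\<^sup>N\<close> and so does not preserve \<open>P\<close>, which contains \<open>(a\<^sup>N, z\<^sup>N)\<close>.\<close>

text \<open>An automorphism of the group itself would not do: the parameters may contain
  \<open>z\<close>, and a twist that fixes \<open>z\<close> fixes all its powers. In the ultrapower
  \<lambda> can vanish on every standard unit and still not at a nonstandard power of
  \<open>u\<close>. The exponents are dictated as follows. \<lambda> is rational-valued because
  homomorphisms into a divisible group extend; so M has to absorb every standard denominator.
  Killing u^M makes the twist preserve \<lambda>(det x), hence invertible. Taking M as the square of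
  N keeps u^N independent of the standard units and of u^M: for k > 0 the value k i! - j (i!)^2
  cannot be constant along an ultrafilter. No formula over the group is written for P. Instead the
  automorphism is carried over to the ultrapower of the copy of the integers inside the group, and
  the definable isomorphism onto the doubly interpreted copy intertwines the two actions; so a
  formula over the integers can test P. It has to do without the order, which is no symbol of the
  ring language, and codes by divisibility. The unit of infinite order comes from the finiteness of
  the set of roots of unity in a number field.\<close>

hide_const (open) UnivPoly.coeff UnivPoly.monom Module.smult

section \<open>Nonprincipal ultrafilters on the natural numbers\<close>

locale nonprincipal_ultrafilter =
  fixes U :: "nat filter"
  assumes not_bot: "U \<noteq> bot"
    and le_sequentially: "U \<le> sequentially"
    and dichotomy: "eventually P U \<or> eventually (\<lambda>i. \<not> P i) U"
begin

lemma eventually_not: "eventually (\<lambda>i. \<not> P i) U \<longleftrightarrow> \<not> eventually P U"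
proof
  assume "eventually (\<lambda>i. \<not> P i) U"
  then show "\<not> eventually P U"
    using eventually_conj[of "\<lambda>i. \<not> P i" U P] not_bot by (auto simp: trivial_limit_def)
qed (use dichotomy in blast)

lemma eventually_of_sequentially: "eventually P sequentially \<Longrightarrow> eventually P U"
  using le_sequentially by (rule filter_leD)

lemma eventually_ex: "eventually P U \<Longrightarrow> \<exists>i. P i"
  using not_bot by (rule eventually_happens')

lemma eventually_ex_ge:
  assumes "eventually P U"
  shows "\<exists>i\<ge>k. P i"
  using eventually_ex[OF eventually_conj[OF eventually_of_sequentially[OF eventually_ge_at_top[of k]] assms]]
  by blast

end

text \<open>Zorn's lemma for the reversed order of filters: an ultrafilter is a minimal proper one.
  The infimum of a nonempty chain stays proper, since what holds eventually along it already does so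
  along some member.\<close>

lemma nonprincipal_ultrafilter_exists: "\<exists>U. nonprincipal_ultrafilter U"
proof -
  let ?A = "{F :: nat filter. F \<noteq> bot \<and> F \<le> sequentially}"
  let ?P = "\<lambda>F G :: nat filter. G \<le> F"
  have "\<exists>m\<in>?A. \<forall>a\<in>?A. ?P m a \<longrightarrow> a = m"
  proof (rule predicate_Zorn)
    show "partial_order_on ?A (relation_of ?P ?A)"
      by (auto simp: partial_order_on_def preorder_on_def refl_on_def trans_def antisym_def relation_of_def)
  next
    fix C assume C: "C \<in> Chains (relation_of ?P ?A)"
    show "\<exists>u\<in>?A. \<forall>a\<in>C. ?P a u"
    proof (cases "C = {}")
      case False
      have sub: "C \<subseteq> ?A" and lin: "\<And>F G. F \<in> C \<Longrightarrow> G \<in> C \<Longrightarrow> F \<le> G \<or> G \<le> F"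
        using C by (auto simp: Chains_def relation_of_def)
      have "eventually P (Inf C) \<longleftrightarrow> (\<exists>b\<in>C. eventually P b)" for P
      proof (rule eventually_Inf_base[OF False])
        fix F G assume "F \<in> C" "G \<in> C"
        with lin[OF this] show "\<exists>x\<in>C. x \<le> inf F G" by (metis inf.orderE inf_commute order_refl)
      qed
      then have "Inf C \<noteq> bot" using sub by (auto simp: trivial_limit_def)
      moreover obtain F where "F \<in> C" using False by blast
      then have "Inf C \<le> sequentially" using sub by (intro Inf_lower2[of F]) auto
      ultimately show ?thesis by (auto intro!: bexI[of _ "Inf C"] Inf_lower)
    qed (auto intro!: exI[of _ sequentially])
  qed
  then obtain m where m: "m \<noteq> bot" "m \<le> sequentially"
    and max: "\<And>F. F \<noteq> bot \<Longrightarrow> F \<le> sequentially \<Longrightarrow> F \<le> m \<Longrightarrow> F = m" by auto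
  have "eventually P m \<or> eventually (\<lambda>i. \<not> P i) m" for P
  \<comment> \<open>Restricting \<open>m\<close> to the event \<open>P\<close> gives either the
    improper filter, and then \<open>P\<close> fails eventually, or \<open>m\<close> itself by
    minimality, and then \<open>P\<close> holds eventually.\<close>
  proof (cases "inf m (principal {i. P i}) = bot")
    case True
    then show ?thesis by (auto simp: trivial_limit_def eventually_inf_principal)
  next
    case False
    then have "inf m (principal {i. P i}) = m"
      using m by (intro max) (auto intro: le_infI1)
    moreover have "eventually P (inf m (principal {i. P i}))"
      by (simp add: eventually_inf_principal)
    ultimately show ?thesis by simp
  qed
  with m show ?thesis by (auto simp: nonprincipal_ultrafilter_def intro!: exI[of _ m])
qed

section \<open>Satisfaction depends on free variables only and is invariant under
  isomorphisms\<close>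

lemma term_val_cong:
  "(\<And>v. v \<in> term_vars t \<Longrightarrow> e v = e' v) \<Longrightarrow> term_val M e t = term_val M e' t"
proof (induction t)
  case (Fn f ts)
  then have "map (term_val M e) ts = map (term_val M e') ts" by (auto intro!: Fn.IH)
  then show ?case by (simp only: term_val.simps)
qed simp

lemma sat_cong:
  "(\<And>v. v \<in> free_vars \<phi> \<Longrightarrow> e v = e' v) \<Longrightarrow> sat M e \<phi> \<longleftrightarrow> sat M e' \<phi>"
proof (induction \<phi> arbitrary: e e')
  case (Eq s t)
  then show ?case by (simp add: term_val_cong[of s e e'] term_val_cong[of t e e'])
next
  case (Rel r ts)
  then have "map (term_val M e) ts = map (term_val M e') ts" by (auto intro!: term_val_cong)
  then show ?case by (simp only: sat.simps)
next
  case (Conj \<phi> \<psi>)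
  from Conj.IH[of e e'] Conj.prems show ?case by simp
next
  case (Ex i \<phi>)
  have "sat M (e(i := a)) \<phi> \<longleftrightarrow> sat M (e'(i := a)) \<phi>" for a
    by (rule Ex.IH) (use Ex.prems in auto)
  then show ?case by simp
next
  case (Neg \<phi>)
  from Neg.IH[of e e'] Neg.prems show ?case by simp
qed

lemma term_val_in_universe:
  assumes "is_structure L M" "\<And>v. e v \<in> universe M" "term_of_sig L t"
  shows "term_val M e t \<in> universe M"
  using assms(3)
proof (induction t)
  case (Fn f ts)
  then have "map (term_val M e) ts \<in> tuples (length ts) (universe M)"
    by (auto simp: tuples_def list_all_iff)
  then show ?case using assms(1) Fn.prems by (auto simp: is_structure_def)
qed (simp add: assms)

lemma term_val_iso:
  assumes M: "is_structure L M" and h: "structure_iso L M N h"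
    and e: "\<And>v. e v \<in> universe M" and "term_of_sig L t"
  shows "term_val N (\<lambda>v. h (e v)) t = h (term_val M e t)"
  using assms(4)
proof (induction t)
  case (Fn f ts)
  then have "map (term_val M e) ts \<in> tuples (length ts) (universe M)"
    using term_val_in_universe[OF M e] by (auto simp: tuples_def list_all_iff)
  moreover have "map (term_val N (\<lambda>v. h (e v))) ts = map h (map (term_val M e) ts)"
    using Fn by (auto simp: list_all_iff)
  ultimately show ?case using h Fn.prems by (simp add: structure_iso_def del: map_map)
qed simp

lemma sat_iso:
  assumes M: "is_structure L M" and h: "structure_iso L M N h"
  shows "(\<And>v. e v \<in> universe M) \<Longrightarrow> formula_of_sig L \<phi> \<Longrightarrow> sat N (\<lambda>v. h (e v)) \<phi> \<longleftrightarrow> sat M e \<phi>"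
proof (induction \<phi> arbitrary: e)
  case (Eq s t)
  have "inj_on h (universe M)" using h by (auto simp: structure_iso_def bij_betw_def)
  with Eq show ?case
    by (auto simp: term_val_iso[OF M h] term_val_in_universe[OF M] inj_on_eq_iff)
next
  case (Rel r ts)
  have "map (term_val M e) ts \<in> tuples (length ts) (universe M)"
    using Rel term_val_in_universe[OF M] by (auto simp: tuples_def list_all_iff)
  moreover have "map (term_val N (\<lambda>v. h (e v))) ts = map h (map (term_val M e) ts)"
    using Rel by (auto simp: list_all_iff term_val_iso[OF M h])
  ultimately show ?case using h Rel.prems by (simp add: structure_iso_def del: map_map)
next
  case (Ex i \<phi>)
  have im: "universe N = h ` universe M" using h by (auto simp: structure_iso_def bij_betw_def)
  have "sat N ((\<lambda>v. h (e v))(i := h a)) \<phi> \<longleftrightarrow> sat M (e(i := a)) \<phi>" if "a \<in> universe M" for a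
  proof -
    have "(\<lambda>v. h (e v))(i := h a) = (\<lambda>v. h ((e(i := a)) v))" by auto
    then show ?thesis using Ex.IH[of "e(i := a)"] Ex.prems that by (simp del: fun_upd_apply add: fun_upd_def)
  qed
  then show ?case by (simp add: im)
qed auto

lemma holds_iso:
  assumes M: "is_structure L M" and h: "structure_iso L M N h"
    and "set xs \<subseteq> universe M" and \<phi>: "is_formula L (length xs) \<phi>"
  shows "holds N \<phi> (map h xs) \<longleftrightarrow> holds M \<phi> xs"
proof -
  obtain c where c: "c \<in> universe M" using M by (auto simp: is_structure_def)
  \<comment> \<open>Beyond its length \<open>xs ! v\<close> is unspecified and may lie outside the
    universe, whereas \<open>sat_iso\<close> wants all values inside; \<open>c\<close> fills the
    gap.\<close>
  define e where "e v = (if v < length xs then xs ! v else c)" for v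
  have fv: "v < length xs" if "v \<in> free_vars \<phi>" for v using \<phi> that by (auto simp: is_formula_def)
  have "holds N \<phi> (map h xs) \<longleftrightarrow> sat N (\<lambda>v. h (e v)) \<phi>"
    unfolding holds_def by (rule sat_cong) (auto simp: e_def fv)
  also have "\<dots> \<longleftrightarrow> sat M e \<phi>"
    using assms c by (intro sat_iso) (auto simp: e_def is_formula_def subset_iff)
  also have "\<dots> \<longleftrightarrow> holds M \<phi> xs"
    unfolding holds_def by (rule sat_cong) (auto simp: e_def fv)
  finally show ?thesis .
qed

section \<open>Automorphisms of an ultrapower\<close>

text \<open>Elements of the ultrapower of \<open>M\<close> are represented by sequences in \<open>M\<close>, and an automorphism by a
  relation \<open>T\<close> between sequences. This avoids forming the quotient.\<close>

definition tuple_rel ::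
  "((nat \<Rightarrow> 'a) \<Rightarrow> (nat \<Rightarrow> 'a) \<Rightarrow> bool) \<Rightarrow> nat \<Rightarrow> (nat \<Rightarrow> 'a list) \<Rightarrow> (nat \<Rightarrow> 'a list) \<Rightarrow> bool" where
  "tuple_rel T k x y \<longleftrightarrow> (\<forall>i. length (x i) = k \<and> length (y i) = k) \<and>
     (\<forall>j<k. T (\<lambda>i. x i ! j) (\<lambda>i. y i ! j))"

lemma tuple_relD:
  assumes "tuple_rel T k x y"
  shows "length (x i) = k" "length (y i) = k" "j < k \<Longrightarrow> T (\<lambda>i. x i ! j) (\<lambda>i. y i ! j)"
  using assms by (simp_all add: tuple_rel_def)

lemma tuple_relI:
  assumes "\<And>i. length (x i) = k" "\<And>i. length (y i) = k"
    "\<And>j. j < k \<Longrightarrow> T (\<lambda>i. x i ! j) (\<lambda>i. y i ! j)"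
  shows "tuple_rel T k x y"
  using assms by (simp add: tuple_rel_def)

lemma tuple_rel_append:
  assumes "tuple_rel T k x y" "tuple_rel T l x' y'"
  shows "tuple_rel T (k + l) (\<lambda>i. x i @ x' i) (\<lambda>i. y i @ y' i)"
proof (rule tuple_relI)
  fix j assume j: "j < k + l"
  show "T (\<lambda>i. (x i @ x' i) ! j) (\<lambda>i. (y i @ y' i) ! j)"
  proof (cases "j < k")
    case True
    then show ?thesis using tuple_relD[OF assms(1)] by (simp add: nth_append)
  next
    case False
    then have "j - k < l" using j by simp
    from tuple_relD(3)[OF assms(2) this] False show ?thesis
      by (simp add: nth_append tuple_relD[OF assms(1)])
  qed
qed (simp_all add: tuple_relD[OF assms(1)] tuple_relD[OF assms(2)])

lemma tuple_rel_Cons: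
  assumes "T a b" "tuple_rel T k x y"
  shows "tuple_rel T (Suc k) (\<lambda>i. a i # x i) (\<lambda>i. b i # y i)"
proof (rule tuple_relI)
  fix j assume "j < Suc k"
  then show "T (\<lambda>i. (a i # x i) ! j) (\<lambda>i. (b i # y i) ! j)"
    using assms(1) tuple_relD[OF assms(2)] by (cases j) simp_all
qed (simp_all add: tuple_relD[OF assms(2)])

lemma tuple_rel_concat:
  assumes "list_all2 (tuple_rel T d) xs ys"
  shows "tuple_rel T (length xs * d) (\<lambda>i. concat (map (\<lambda>x. x i) xs)) (\<lambda>i. concat (map (\<lambda>y. y i) ys))"
  using assms
proof (induction rule: list_all2_induct)
  case Nil
  show ?case by (simp add: tuple_rel_def)
next
  case (Cons x xs y ys)
  then show ?case using tuple_rel_append[of T d x y] by simp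
qed

text \<open>Modulo \<open>U\<close>, the axioms \<open>eq1\<close> and \<open>eq2\<close> say that
  \<open>T\<close> is single-valued and injective, \<open>total\<close> and \<open>surj\<close> that
  it is everywhere defined and onto. \<open>const\<close> says that the elements of \<open>M\<close>
  are fixed, so that formulas may carry parameters from \<open>M\<close>.\<close>

locale ultra_auto = nonprincipal_ultrafilter U for U +
  fixes L :: "('f, 'r) signature"
    and M :: "('f, 'r, 'a) fo_structure"
    and T :: "(nat \<Rightarrow> 'a) \<Rightarrow> (nat \<Rightarrow> 'a) \<Rightarrow> bool"
  assumes nonempty: "universe M \<noteq> {}"
    and in_universe1: "T x y \<Longrightarrow> x i \<in> universe M"
    and in_universe2: "T x y \<Longrightarrow> y i \<in> universe M"
    and const: "c \<in> universe M \<Longrightarrow> T (\<lambda>_. c) (\<lambda>_. c)"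
    and total: "(\<And>i. x i \<in> universe M) \<Longrightarrow> \<exists>y. T x y"
    and surj: "(\<And>i. y i \<in> universe M) \<Longrightarrow> \<exists>x. T x y"
    and eq1: "T x y \<Longrightarrow> T x' y' \<Longrightarrow> eventually (\<lambda>i. x i = x' i) U \<Longrightarrow> eventually (\<lambda>i. y i = y' i) U"
    and eq2: "T x y \<Longrightarrow> T x' y' \<Longrightarrow> eventually (\<lambda>i. y i = y' i) U \<Longrightarrow> eventually (\<lambda>i. x i = x' i) U"
    and func: "fun_arity L f = Some (length xs) \<Longrightarrow> list_all2 T xs ys \<Longrightarrow>
        T (\<lambda>i. fun_interp M f (map (\<lambda>x. x i) xs)) (\<lambda>i. fun_interp M f (map (\<lambda>y. y i) ys))"
    and rel1: "rel_arity L r = Some (length xs) \<Longrightarrow> list_all2 T xs ys \<Longrightarrow>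
        eventually (\<lambda>i. rel_interp M r (map (\<lambda>x. x i) xs)) U \<Longrightarrow>
         eventually (\<lambda>i. rel_interp M r (map (\<lambda>y. y i) ys)) U"
    and rel2: "rel_arity L r = Some (length xs) \<Longrightarrow> list_all2 T xs ys \<Longrightarrow>
        eventually (\<lambda>i. rel_interp M r (map (\<lambda>y. y i) ys)) U \<Longrightarrow>
         eventually (\<lambda>i. rel_interp M r (map (\<lambda>x. x i) xs)) U"
begin

lemma eq_iff: "T x y \<Longrightarrow> T x' y' \<Longrightarrow> eventually (\<lambda>i. x i = x' i) U \<longleftrightarrow> eventually (\<lambda>i. y i = y' i) U"
  using eq1[of x y x' y'] eq2[of x y x' y'] by blast

lemma rel_iff: "rel_arity L r = Some (length xs) \<Longrightarrow> list_all2 T xs ys \<Longrightarrow>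
    eventually (\<lambda>i. rel_interp M r (map (\<lambda>x. x i) xs)) U \<longleftrightarrow>
    eventually (\<lambda>i. rel_interp M r (map (\<lambda>y. y i) ys)) U"
  using rel1[of r xs ys] rel2[of r xs ys] by blast

lemma term_val_rel:
  assumes e: "\<And>v. T (e v) (e' v)" and "term_of_sig L t"
  shows "T (\<lambda>i. term_val M (\<lambda>v. e v i) t) (\<lambda>i. term_val M (\<lambda>v. e' v i) t)"
  using assms(2)
proof (induction t)
  case (Fn f ts)
  define xs where "xs = map (\<lambda>t i. term_val M (\<lambda>v. e v i) t) ts"
  define ys where "ys = map (\<lambda>t i. term_val M (\<lambda>v. e' v i) t) ts"
  have "list_all2 T xs ys"
    using Fn by (auto simp: xs_def ys_def list_all2_conv_all_nth list_all_iff)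
  then have "T (\<lambda>i. fun_interp M f (map (\<lambda>x. x i) xs)) (\<lambda>i. fun_interp M f (map (\<lambda>y. y i) ys))"
    using Fn.prems by (intro func) (simp_all add: xs_def)
  then show ?case by (simp add: xs_def ys_def o_def)
qed (simp add: e)

text \<open>The theorem of Los and the invariance under an automorphism in one induction: truth on a
  set in \<open>U\<close> plays the part of truth in the ultrapower. Negation uses that
  \<open>U\<close> is an ultrafilter.\<close>

lemma sat_iff:
  shows "(\<And>v. T (e v) (e' v)) \<Longrightarrow> formula_of_sig L \<phi> \<Longrightarrow>
    eventually (\<lambda>i. sat M (\<lambda>v. e v i) \<phi>) U \<longleftrightarrow> eventually (\<lambda>i. sat M (\<lambda>v. e' v i) \<phi>) U"
proof (induction \<phi> arbitrary: e e')
  case (Eq s t)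
  then show ?case
    using eq_iff[OF term_val_rel[of e e' s] term_val_rel[of e e' t]]
    by simp
next
  case (Rel r ts)
  define xs where "xs = map (\<lambda>t i. term_val M (\<lambda>v. e v i) t) ts"
  define ys where "ys = map (\<lambda>t i. term_val M (\<lambda>v. e' v i) t) ts"
  have "list_all2 T xs ys"
    using Rel by (auto simp: xs_def ys_def list_all2_conv_all_nth list_all_iff
        intro!: term_val_rel)
  then have "eventually (\<lambda>i. rel_interp M r (map (\<lambda>x. x i) xs)) U \<longleftrightarrow>
      eventually (\<lambda>i. rel_interp M r (map (\<lambda>y. y i) ys)) U"
    using Rel.prems by (intro rel_iff) (simp_all add: xs_def)
  then show ?case by (simp add: xs_def ys_def o_def)
next
  case (Neg \<phi>)
  have "eventually (\<lambda>i. sat M (\<lambda>v. e v i) \<phi>) U \<longleftrightarrow> eventually (\<lambda>i. sat M (\<lambda>v. e' v i) \<phi>) U"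
    by (rule Neg.IH) (use Neg.prems in auto)
  then show ?case by (simp add: eventually_not)
next
  case (Conj \<phi> \<psi>)
  from Conj.prems Conj.IH[of e e'] show ?case by (simp add: eventually_conj_iff)
next
  case (Ex j \<phi>)
  have upd: "(\<lambda>v. (e(j := a)) v i) = (\<lambda>v. e v i)(j := a i)" for e :: "nat \<Rightarrow> nat \<Rightarrow> 'a" and a i
    by auto
  \<comment> \<open>The existential step of Los: witnesses are chosen index by index, with
    \<open>e 0 i\<close> as a dummy where there is none.\<close>
  have witness: "eventually (\<lambda>i. sat M (\<lambda>v. e v i) (Ex j \<phi>)) U \<longleftrightarrow>
      (\<exists>a. (\<forall>i. a i \<in> universe M) \<and> eventually (\<lambda>i. sat M ((\<lambda>v. e v i)(j := a i)) \<phi>) U)"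
    (is "?l \<longleftrightarrow> ?r") if e: "\<And>v i. e v i \<in> universe M" for e
  proof
    assume l: ?l
    define a where "a i = (if \<exists>a\<in>universe M. sat M ((\<lambda>v. e v i)(j := a)) \<phi>
      then SOME a. a \<in> universe M \<and> sat M ((\<lambda>v. e v i)(j := a)) \<phi> else e 0 i)" for i
    have some: "a i \<in> universe M \<and> sat M ((\<lambda>v. e v i)(j := a i)) \<phi>"
      if "\<exists>a\<in>universe M. sat M ((\<lambda>v. e v i)(j := a)) \<phi>" for i
      using someI_ex[of "\<lambda>a. a \<in> universe M \<and> sat M ((\<lambda>v. e v i)(j := a)) \<phi>"] that
      by (auto simp: a_def)
    have "\<forall>i. a i \<in> universe M" using some e by (metis a_def)
    moreover have "eventually (\<lambda>i. sat M ((\<lambda>v. e v i)(j := a i)) \<phi>) U"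
      using l by eventually_elim (use some in auto)
    ultimately show ?r by blast
  next
    assume ?r
    then obtain a where a: "\<And>i. a i \<in> universe M" "eventually (\<lambda>i. sat M ((\<lambda>v. e v i)(j := a i)) \<phi>) U"
      by blast
    from a(2) show ?l by eventually_elim (use a(1) in auto)
  qed
  have ih: "eventually (\<lambda>i. sat M ((\<lambda>v. e v i)(j := a i)) \<phi>) U \<longleftrightarrow>
      eventually (\<lambda>i. sat M ((\<lambda>v. e' v i)(j := b i)) \<phi>) U" if "T a b" for a b
  proof -
    have "T ((e(j := a)) v) ((e'(j := b)) v)" for v using Ex.prems(1) that by simp
    from Ex.IH[of "e(j := a)" "e'(j := b)", OF this] Ex.prems(2) show ?thesis by (simp del: fun_upd_apply add: upd)
  qed
  have e: "e v i \<in> universe M" "e' v i \<in> universe M" for v i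
    using Ex.prems(1)[of v] in_universe1 in_universe2 by auto
  \<comment> \<open>\<open>total\<close> and \<open>surj\<close> supply, for a witness on either
    side, a related one on the other.\<close>
  show ?case
    unfolding witness[OF e(1)] witness[OF e(2)]
    using ih total surj in_universe1 in_universe2 by meson
qed

lemma tuple_rel_const:
  assumes "set c \<subseteq> universe M"
  shows "tuple_rel T (length c) (\<lambda>_. c) (\<lambda>_. c)"
  using assms by (auto simp: tuple_rel_def intro!: const)

lemma tuple_rel_tuples:
  assumes "tuple_rel T k x y"
  shows "x i \<in> tuples k (universe M)" "y i \<in> tuples k (universe M)"
  using tuple_relD[OF assms] in_universe1[OF tuple_relD(3)[OF assms]] in_universe2[OF tuple_relD(3)[OF assms]]
  by (auto simp: tuples_def in_set_conv_nth)

lemma tuple_rel_total: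
  assumes x: "\<And>i. x i \<in> tuples k (universe M)"
  shows "\<exists>y. tuple_rel T k x y"
proof -
  have "x i ! j \<in> universe M" if "j < k" for i j
    using x[of i] that by (auto simp: tuples_def)
  then have "\<forall>j<k. \<exists>y. T (\<lambda>i. x i ! j) y" by (auto intro!: total)
  then obtain y where "\<forall>j<k. T (\<lambda>i. x i ! j) (y j)" by metis
  then have "tuple_rel T k x (\<lambda>i. map (\<lambda>j. y j i) [0..<k])"
    using x by (auto simp: tuple_rel_def tuples_def)
  then show ?thesis by blast
qed

lemma holds_iff:
  assumes \<phi>: "is_formula L k \<phi>"
    and xy: "tuple_rel T k x y"
  shows "eventually (\<lambda>i. holds M \<phi> (x i)) U \<longleftrightarrow> eventually (\<lambda>i. holds M \<phi> (y i)) U"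
proof -
  obtain c where c: "c \<in> universe M" using nonempty by blast
  define e where "e x v i = (if v < k then x i ! v else c)" for x :: "nat \<Rightarrow> 'a list" and v i
  have "holds M \<phi> (x i) \<longleftrightarrow> sat M (\<lambda>v. e x v i) \<phi>" for x i
    unfolding holds_def using \<phi> by (intro sat_cong) (auto simp: e_def is_formula_def)
  moreover have "T (e x v) (e y v)" for v
    using tuple_relD(3)[OF xy] const[OF c] by (cases "v < k") (simp_all add: e_def [abs_def])
  then have "eventually (\<lambda>i. sat M (\<lambda>v. e x v i) \<phi>) U \<longleftrightarrow> eventually (\<lambda>i. sat M (\<lambda>v. e y v i) \<phi>) U"
    using \<phi> by (intro sat_iff) (auto simp: is_formula_def)
  ultimately show ?thesis by simp
qed

text \<open>The axioms are symmetric in the two sides. Hence, for the relation induced on an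
  interpreted structure, surjectivity, injectivity and the backward transfer of relations follow
  from the forward lemmas.\<close>

lemma converse: "ultra_auto U L M T\<inverse>\<inverse>"
proof (intro ultra_auto.intro ultra_auto_axioms.intro)
  show "nonprincipal_ultrafilter U" by unfold_locales
next
  fix f :: 'f and xs ys assume *: "fun_arity L f = Some (length xs)" "list_all2 T\<inverse>\<inverse> xs ys"
  then have "length xs = length ys" "list_all2 T ys xs" by (auto simp: list_all2_conv_all_nth)
  with * func[of f ys xs]
  show "T\<inverse>\<inverse> (\<lambda>i. fun_interp M f (map (\<lambda>x. x i) xs)) (\<lambda>i. fun_interp M f (map (\<lambda>y. y i) ys))"
    by simp
next
  fix r :: 'r and xs ys assume *: "rel_arity L r = Some (length xs)" "list_all2 T\<inverse>\<inverse> xs ys"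
  then have "length xs = length ys" "list_all2 T ys xs" by (auto simp: list_all2_conv_all_nth)
  note rel = * rel_iff[of r ys xs] this
  show "eventually (\<lambda>i. rel_interp M r (map (\<lambda>x. x i) xs)) U \<Longrightarrow>
         eventually (\<lambda>i. rel_interp M r (map (\<lambda>y. y i) ys)) U"
    and "eventually (\<lambda>i. rel_interp M r (map (\<lambda>y. y i) ys)) U \<Longrightarrow>
         eventually (\<lambda>i. rel_interp M r (map (\<lambda>x. x i) xs)) U"
    using rel by simp_all
qed (use nonempty in_universe1 in_universe2 const total surj eq1 eq2 in \<open>simp_all\<close>)

end

section \<open>The automorphism induced on an interpreted structure\<close>

lemma quotient_class:
  assumes "equiv D R" "X \<in> D // R" "x \<in> X"
  shows "x \<in> D" "y \<in> X \<longleftrightarrow> (x, y) \<in> R"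
proof -
  show "x \<in> D" using assms by (meson in_quotient_imp_subset subsetD)
  show "y \<in> X \<longleftrightarrow> (x, y) \<in> R"
    using assms by (metis in_quotient_imp_closed in_quotient_imp_in_rel insert_subset empty_subsetI)
qed

lemma quotient_class_eq:
  assumes "equiv D R" "X \<in> D // R" "Y \<in> D // R" "x \<in> X" "x \<in> Y"
  shows "X = Y"
  using quotient_disj[OF assms(1-3)] assms(4,5) by blast

text \<open>\<open>X\<close> and \<open>Y\<close> have to be classes at every index because
  \<open>ultra_auto\<close> asks for members of the universe everywhere; representatives are
  demanded only for \<open>U\<close>-almost all indices.\<close>

definition induced ::
  "nat filter \<Rightarrow> ((nat \<Rightarrow> 'b) \<Rightarrow> (nat \<Rightarrow> 'b) \<Rightarrow> bool) \<Rightarrow> ('f, 'r, 'g, 's) code \<Rightarrow> ('g, 's, 'b) fo_structure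
    \<Rightarrow> 'b list \<Rightarrow> (nat \<Rightarrow> 'b list set) \<Rightarrow> (nat \<Rightarrow> 'b list set) \<Rightarrow> bool" where
  "induced U T \<Gamma> M qs X Y \<longleftrightarrow>
     (\<forall>i. X i \<in> code_dom \<Gamma> M qs // code_rel \<Gamma> M qs) \<and>
     (\<forall>i. Y i \<in> code_dom \<Gamma> M qs // code_rel \<Gamma> M qs) \<and>
     (\<exists>x y. tuple_rel T (code_dim \<Gamma>) x y \<and>
        eventually (\<lambda>i. x i \<in> X i) U \<and> eventually (\<lambda>i. y i \<in> Y i) U)"

lemma tuple_rel_converse: "tuple_rel T\<inverse>\<inverse> k x y \<longleftrightarrow> tuple_rel T k y x"
  by (auto simp: tuple_rel_def)

lemma induced_converse: "induced U T\<inverse>\<inverse> \<Gamma> M qs = (induced U T \<Gamma> M qs)\<inverse>\<inverse>"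
  unfolding induced_def fun_eq_iff conversep_iff tuple_rel_converse by blast

locale interpreted_ultra_auto = ultra_auto U L M T for U L and M :: "('f, 'r, 'a) fo_structure" and T +
  fixes L' :: "('g, 's) signature" and \<Gamma> :: "('g, 's, 'f, 'r) code" and qs :: "'a list"
  assumes params: "set qs \<subseteq> universe M"
    and code: "is_code L' L (length qs) \<Gamma>"
    and admissible: "admissible L' \<Gamma> M qs"
begin

abbreviation "D \<equiv> code_dom \<Gamma> M qs"
abbreviation "R \<equiv> code_rel \<Gamma> M qs"
abbreviation "d \<equiv> code_dim \<Gamma>"
abbreviation "I \<equiv> interpreted \<Gamma> M qs"
abbreviation "T' \<equiv> induced U T \<Gamma> M qs"

lemma equiv: "equiv D R" using admissible by (simp add: admissible_def)

lemma I_structure: "is_structure L' I" using admissible by (simp add: admissible_def)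

lemma universe_I: "universe I = D // R" by (simp add: interpreted_def)

lemma class_ne: "X \<in> D // R \<Longrightarrow> \<exists>x. x \<in> X"
  using in_quotient_imp_non_empty[OF equiv] by blast

lemma class_tuples: "X \<in> D // R \<Longrightarrow> x \<in> X \<Longrightarrow> x \<in> tuples d (universe M)"
  using quotient_class(1)[OF equiv, of X x] by (simp add: code_dom_def)

text \<open>The parameters form constant sequences, which \<open>T\<close> relates to
  themselves.\<close>

lemma holds_params_iff:
  assumes "is_formula L (length qs + k) \<phi>" "tuple_rel T k x y"
  shows "eventually (\<lambda>i. holds M \<phi> (qs @ x i)) U \<longleftrightarrow> eventually (\<lambda>i. holds M \<phi> (qs @ y i)) U"
  by (rule holds_iff[OF assms(1) tuple_rel_append[OF tuple_rel_const[OF params] assms(2)]])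

lemma dom_iff:
  assumes "tuple_rel T d x y"
  shows "eventually (\<lambda>i. x i \<in> D) U \<longleftrightarrow> eventually (\<lambda>i. y i \<in> D) U"
  using holds_params_iff[OF _ assms, of "dom_fm \<Gamma>"] code tuple_rel_tuples[OF assms]
  by (simp add: code_dom_def is_code_def)

lemma code_rel_iff:
  assumes "tuple_rel T d x y" "tuple_rel T d x' y'"
  shows "eventually (\<lambda>i. (x i, x' i) \<in> R) U \<longleftrightarrow> eventually (\<lambda>i. (y i, y' i) \<in> R) U"
  using holds_params_iff[OF _ tuple_rel_append[OF assms], of "eq_fm \<Gamma>"] code dom_iff[OF assms(1)] dom_iff[OF assms(2)]
  by (simp add: code_rel_def is_code_def mult_2 eventually_conj_iff)

lemma induced_class: "T' X Y \<Longrightarrow> X i \<in> D // R" "T' X Y \<Longrightarrow> Y i \<in> D // R"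
  by (simp_all add: induced_def)

lemma induced_classes:
  assumes "list_all2 T' Xs Ys"
  shows "set (map (\<lambda>X. X i) Xs) \<subseteq> D // R" "set (map (\<lambda>Y. Y i) Ys) \<subseteq> D // R"
  using assms by (induction rule: list_all2_induct) (simp_all add: induced_class)

lemma induced_total:
  assumes X: "\<And>i. X i \<in> universe I"
  shows "\<exists>Y. T' X Y"
proof -
  have X': "X i \<in> D // R" for i using X universe_I by simp
  then have "\<forall>i. \<exists>x. x \<in> X i" using class_ne by blast
  then obtain x where x: "\<And>i. x i \<in> X i" by metis
  have "\<And>i. x i \<in> tuples d (universe M)" using class_tuples[OF X' x] .
  then obtain y where xy: "tuple_rel T d x y" using tuple_rel_total by blast
  have "\<And>i. x i \<in> D" using quotient_class(1)[OF equiv X' x] .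
  then have yD: "eventually (\<lambda>i. y i \<in> D) U" using dom_iff[OF xy] by simp
  \<comment> \<open>Outside an event in \<open>U\<close> the tuple \<open>y i\<close> may miss
    \<open>D\<close>; there \<open>X i\<close> serves as a dummy class.\<close>
  define Y where "Y i = (if y i \<in> D then R `` {y i} else X i)" for i
  have "Y i \<in> D // R" for i using X' by (simp add: Y_def quotientI)
  moreover from yD have "eventually (\<lambda>i. y i \<in> Y i) U"
    by eventually_elim (use equiv_class_self[OF equiv] in \<open>simp add: Y_def\<close>)
  ultimately show ?thesis
    unfolding induced_def using xy X' x by (intro exI[of _ Y] conjI allI exI[of _ x] exI[of _ y]) simp_all
qed

lemma induced_const:
  assumes "C \<in> universe I"
  shows "T' (\<lambda>_. C) (\<lambda>_. C)"
proof -
  have C: "C \<in> D // R" using assms universe_I by simp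
  then obtain c where c: "c \<in> C" using class_ne by blast
  have "c \<in> tuples d (universe M)" by (rule class_tuples[OF C c])
  then have "tuple_rel T d (\<lambda>_. c) (\<lambda>_. c)" using tuple_rel_const[of c] by (auto simp: tuples_def)
  then show ?thesis
    unfolding induced_def using C c by (intro conjI allI exI[of _ "\<lambda>_. c"]) auto
qed

lemma induced_eq:
  assumes XY: "T' X Y" and XY': "T' X' Y'" and eq: "eventually (\<lambda>i. X i = X' i) U"
  shows "eventually (\<lambda>i. Y i = Y' i) U"
proof -
  have Q: "Y i \<in> D // R" "Y' i \<in> D // R" "X i \<in> D // R" "X' i \<in> D // R" for i
    using XY XY' by (auto simp: induced_def)
  obtain x y x' y' where xy: "tuple_rel T d x y" "tuple_rel T d x' y'"
    and mem: "eventually (\<lambda>i. x i \<in> X i) U" "eventually (\<lambda>i. y i \<in> Y i) U"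
      "eventually (\<lambda>i. x' i \<in> X' i) U" "eventually (\<lambda>i. y' i \<in> Y' i) U"
    using XY XY' unfolding induced_def by blast
  have "eventually (\<lambda>i. (x i, x' i) \<in> R) U"
    using mem(1) mem(3) eq
  proof eventually_elim
    case (elim i)
    then show ?case using quotient_class(2)[OF equiv Q(3) elim(1)] by simp
  qed
  then have "eventually (\<lambda>i. (y i, y' i) \<in> R) U" using code_rel_iff[OF xy] by simp
  then show ?thesis using mem(2) mem(4)
  proof eventually_elim
    case (elim i)
    then have "y' i \<in> Y i" using quotient_class(2)[OF equiv Q(1) elim(2)] by simp
    then show ?case by (rule quotient_class_eq[OF equiv Q(1) Q(2) _ elim(3)])
  qed
qed

lemma induced_representatives:
  assumes "list_all2 T' Xs Ys"
  obtains xs ys where "list_all2 (tuple_rel T d) xs ys"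
    "eventually (\<lambda>i. list_all2 (\<in>) (map (\<lambda>x. x i) xs) (map (\<lambda>X. X i) Xs)) U"
    "eventually (\<lambda>i. list_all2 (\<in>) (map (\<lambda>y. y i) ys) (map (\<lambda>Y. Y i) Ys)) U"
proof -
  have "\<exists>xs ys. list_all2 (tuple_rel T d) xs ys \<and>
    eventually (\<lambda>i. list_all2 (\<in>) (map (\<lambda>x. x i) xs) (map (\<lambda>X. X i) Xs)) U \<and>
    eventually (\<lambda>i. list_all2 (\<in>) (map (\<lambda>y. y i) ys) (map (\<lambda>Y. Y i) Ys)) U"
    using assms
  proof (induction rule: list_all2_induct)
    case (Cons X Xs Y Ys)
    then obtain xs ys where IH: "list_all2 (tuple_rel T d) xs ys"
      "eventually (\<lambda>i. list_all2 (\<in>) (map (\<lambda>x. x i) xs) (map (\<lambda>X. X i) Xs)) U"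
      "eventually (\<lambda>i. list_all2 (\<in>) (map (\<lambda>y. y i) ys) (map (\<lambda>Y. Y i) Ys)) U"
      by blast
    obtain x y where "tuple_rel T d x y" "eventually (\<lambda>i. x i \<in> X i) U" "eventually (\<lambda>i. y i \<in> Y i) U"
      using Cons by (auto simp: induced_def)
    with IH show ?case
      by (intro exI[of _ "x # xs"] exI[of _ "y # ys"]) (simp add: eventually_conj_iff)
  qed (auto intro!: exI[of _ "[]"])
  then show ?thesis using that by blast
qed

lemma representatives_related:
  assumes "set Xs \<subseteq> D // R" "list_all2 (\<in>) xs Xs" "list_all2 (\<in>) ys Xs"
  shows "list_all2 (\<lambda>x y. (x, y) \<in> R) xs ys"
  unfolding list_all2_conv_all_nth
proof (intro conjI allI impI)
  show "length xs = length ys" using assms(2,3)[THEN list_all2_lengthD] by simp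
next
  fix j assume "j < length xs"
  then have j: "j < length Xs" using list_all2_lengthD[OF assms(2)] by simp
  have "Xs ! j \<in> D // R" using assms(1) j by (auto dest: nth_mem)
  moreover have "xs ! j \<in> Xs ! j" "ys ! j \<in> Xs ! j"
    by (rule list_all2_nthD2[OF assms(2) j] list_all2_nthD2[OF assms(3) j])+
  ultimately show "(xs ! j, ys ! j) \<in> R" using quotient_class(2)[OF equiv] by blast
qed

text \<open>A representative \<open>z\<close> of the value on the left and its image
  \<open>w\<close> under \<open>T\<close> satisfy the graph formula together with related
  representatives of the arguments; so \<open>w\<close> represents the value on the right.\<close>

lemma induced_func:
  assumes ar: "fun_arity L' f = Some (length Xs)" and XY: "list_all2 T' Xs Ys"
  shows "T' (\<lambda>i. fun_interp I f (map (\<lambda>X. X i) Xs)) (\<lambda>i. fun_interp I f (map (\<lambda>Y. Y i) Ys))" (is "T' ?Z ?W")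
proof -
  have len: "length Ys = length Xs" using XY by (simp add: list_all2_lengthD)
  have Q: "set (map (\<lambda>X. X i) Xs) \<subseteq> D // R" "set (map (\<lambda>Y. Y i) Ys) \<subseteq> D // R" for i
    by (rule induced_classes[OF XY])+
  have ZW: "?Z i \<in> D // R" "?W i \<in> D // R" for i
    using I_structure ar len Q[of i] unfolding is_structure_def universe_I by (auto simp: tuples_def)
  then have "\<forall>i. \<exists>z. z \<in> ?Z i" using class_ne by blast
  then obtain z where z: "\<And>i. z i \<in> ?Z i" by metis
  have "\<And>i. z i \<in> tuples d (universe M)" by (rule class_tuples[OF ZW(1) z])
  then obtain w where zw: "tuple_rel T d z w" using tuple_rel_total by blast
  have zD: "z i \<in> D" for i by (rule quotient_class(1)[OF equiv ZW(1) z])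
  obtain xs ys where xy: "list_all2 (tuple_rel T d) xs ys"
    and mem: "eventually (\<lambda>i. list_all2 (\<in>) (map (\<lambda>x. x i) xs) (map (\<lambda>X. X i) Xs)) U"
      "eventually (\<lambda>i. list_all2 (\<in>) (map (\<lambda>y. y i) ys) (map (\<lambda>Y. Y i) Ys)) U"
    by (rule induced_representatives[OF XY])
  have lxs: "length xs = length Xs"
    using eventually_ex[OF mem(1)] by (auto dest!: list_all2_lengthD)
  have resp: "respects_code \<Gamma> M qs (Suc (length Xs)) (fun_fm \<Gamma> f)"
    using admissible ar by (simp add: admissible_def)
  have "eventually (\<lambda>i. holds M (fun_fm \<Gamma> f) (qs @ concat (map (\<lambda>x. x i) xs) @ z i)) U"
    using mem(1)
  proof eventually_elim
    case (elim i)
    obtain xss where xss: "list_all2 (\<in>) xss (map (\<lambda>X. X i) Xs)"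
      and h: "holds M (fun_fm \<Gamma> f) (qs @ concat xss @ z i)"
      using z[of i] by (auto simp: interpreted_def)
    \<comment> \<open>Membership in the value class promises the formula for some representatives
      \<open>xss\<close> only; respecting the code moves it to the chosen \<open>xs\<close>.\<close>
    have "list_all2 (\<lambda>x y. (x, y) \<in> R) (xss @ [z i]) (map (\<lambda>x. x i) xs @ [z i])"
      using representatives_related[OF Q(1) xss elim] zD[of i] equiv
      by (intro list_all2_appendI) (simp_all add: equiv_def refl_on_def)
    moreover have "length (xss @ [z i]) = Suc (length Xs)" using xss by (auto dest: list_all2_lengthD)
    ultimately have "holds M (fun_fm \<Gamma> f) (qs @ concat (xss @ [z i])) \<longleftrightarrow>
        holds M (fun_fm \<Gamma> f) (qs @ concat (map (\<lambda>x. x i) xs @ [z i]))"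
      using resp unfolding respects_code_def by blast
    with h show ?case by simp
  qed
  moreover have "is_formula L (length qs + (length xs * d + d)) (fun_fm \<Gamma> f)"
    using code ar lxs by (simp add: is_code_def add.commute)
  ultimately have "eventually (\<lambda>i. holds M (fun_fm \<Gamma> f) (qs @ concat (map (\<lambda>y. y i) ys) @ w i)) U"
    using holds_params_iff[OF _ tuple_rel_append[OF tuple_rel_concat[OF xy] zw]] by simp
  moreover have "eventually (\<lambda>i. w i \<in> D) U" using dom_iff[OF zw] zD by simp
  ultimately have "eventually (\<lambda>i. w i \<in> ?W i) U"
    using mem(2) by eventually_elim (auto simp: interpreted_def)
  then show ?thesis
    unfolding induced_def using ZW zw z by (intro conjI allI exI[of _ z] exI[of _ w]) simp_all
qed

lemma induced_rel:
  assumes ar: "rel_arity L' r = Some (length Xs)" and XY: "list_all2 T' Xs Ys"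
    and r: "eventually (\<lambda>i. rel_interp I r (map (\<lambda>X. X i) Xs)) U"
  shows "eventually (\<lambda>i. rel_interp I r (map (\<lambda>Y. Y i) Ys)) U"
proof -
  have Q: "set (map (\<lambda>X. X i) Xs) \<subseteq> D // R" for i
    by (rule induced_classes[OF XY])+
  obtain xs ys where xy: "list_all2 (tuple_rel T d) xs ys"
    and mem: "eventually (\<lambda>i. list_all2 (\<in>) (map (\<lambda>x. x i) xs) (map (\<lambda>X. X i) Xs)) U"
      "eventually (\<lambda>i. list_all2 (\<in>) (map (\<lambda>y. y i) ys) (map (\<lambda>Y. Y i) Ys)) U"
    by (rule induced_representatives[OF XY])
  have lxs: "length xs = length Xs"
    using eventually_ex[OF mem(1)] by (auto dest!: list_all2_lengthD)
  have resp: "respects_code \<Gamma> M qs (length Xs) (rel_fm \<Gamma> r)"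
    using admissible ar by (simp add: admissible_def)
  have "eventually (\<lambda>i. holds M (rel_fm \<Gamma> r) (qs @ concat (map (\<lambda>x. x i) xs))) U"
    using mem(1) r
  proof eventually_elim
    case (elim i)
    obtain xss where xss: "list_all2 (\<in>) xss (map (\<lambda>X. X i) Xs)"
      and h: "holds M (rel_fm \<Gamma> r) (qs @ concat xss)"
      using elim(2) by (auto simp: interpreted_def)
    have "length xss = length Xs" using xss by (auto dest: list_all2_lengthD)
    with resp representatives_related[OF Q xss elim(1)] h show ?case
      unfolding respects_code_def by blast
  qed
  moreover have "is_formula L (length qs + length xs * d) (rel_fm \<Gamma> r)"
    using code ar lxs by (simp add: is_code_def)
  ultimately have "eventually (\<lambda>i. holds M (rel_fm \<Gamma> r) (qs @ concat (map (\<lambda>y. y i) ys))) U"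
    using holds_params_iff[OF _ tuple_rel_concat[OF xy]] by simp
  then show ?thesis
    using mem(2) by eventually_elim (auto simp: interpreted_def)
qed

lemma converse_interpreted: "interpreted_ultra_auto U L M T\<inverse>\<inverse> L' \<Gamma> qs"
  by (intro interpreted_ultra_auto.intro interpreted_ultra_auto_axioms.intro converse params code admissible)

lemma list_all2_converse: "list_all2 P\<inverse>\<inverse> ys xs \<longleftrightarrow> list_all2 P xs ys"
  by (simp add: list.rel_conversep)

lemma induced_ultra_auto: "ultra_auto U L' I T'"
proof -
  interpret c: interpreted_ultra_auto U L M "T\<inverse>\<inverse>" L' \<Gamma> qs by (rule converse_interpreted)
  have T'c: "c.T' = T'\<inverse>\<inverse>" by (rule induced_converse)
  show ?thesis
  proof (intro ultra_auto.intro ultra_auto_axioms.intro)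
    show "nonprincipal_ultrafilter U" by unfold_locales
    show "universe I \<noteq> {}" using I_structure by (auto simp: is_structure_def)
    show "X i \<in> universe I" "Y i \<in> universe I" if "T' X Y" for X Y i
      using that by (auto simp: induced_def universe_I)
    show "T' (\<lambda>_. C) (\<lambda>_. C)" if "C \<in> universe I" for C using that by (rule induced_const)
    show "\<exists>Y. T' X Y" if "\<And>i. X i \<in> universe I" for X using that by (rule induced_total)
    show "\<exists>X. T' X Y" if "\<And>i. Y i \<in> universe I" for Y
    proof -
      have "\<exists>X. c.T' Y X" by (rule c.induced_total[OF that])
      then show ?thesis unfolding T'c conversep_iff .
    qed
    show "eventually (\<lambda>i. Y i = Y' i) U" if "T' X Y" "T' X' Y'" "eventually (\<lambda>i. X i = X' i) U" for X Y X' Y'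
      using that by (rule induced_eq)
    show "eventually (\<lambda>i. X i = X' i) U" if "T' X Y" "T' X' Y'" "eventually (\<lambda>i. Y i = Y' i) U" for X Y X' Y'
    proof -
      have "c.T' Y X" "c.T' Y' X'" unfolding T'c conversep_iff by (fact that)+
      then show ?thesis using that(3) by (rule c.induced_eq)
    qed
  next
    fix f :: 'g and Xs Ys
    assume "fun_arity L' f = Some (length Xs)" "list_all2 T' Xs Ys"
    then show "T' (\<lambda>i. fun_interp I f (map (\<lambda>X. X i) Xs)) (\<lambda>i. fun_interp I f (map (\<lambda>Y. Y i) Ys))"
      by (rule induced_func)
  next
    fix r :: 's and Xs Ys
    assume a: "rel_arity L' r = Some (length Xs)" "list_all2 T' Xs Ys"
    show "eventually (\<lambda>i. rel_interp I r (map (\<lambda>X. X i) Xs)) U \<Longrightarrow>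
        eventually (\<lambda>i. rel_interp I r (map (\<lambda>Y. Y i) Ys)) U"
      by (rule induced_rel[OF a])
    show "eventually (\<lambda>i. rel_interp I r (map (\<lambda>Y. Y i) Ys)) U \<Longrightarrow>
        eventually (\<lambda>i. rel_interp I r (map (\<lambda>X. X i) Xs)) U"
    proof (rule c.induced_rel)
      show "rel_arity L' r = Some (length Ys)" using a by (simp add: list_all2_lengthD[OF a(2)])
      show "list_all2 c.T' Ys Xs" unfolding T'c list_all2_converse by (rule a(2))
    qed
  qed
qed

end

section \<open>Definable predicates\<close>

lemma finite_term_vars: "finite (term_vars t)"
  by (induction t) auto

lemma finite_free_vars: "finite (free_vars \<phi>)"
  by (induction \<phi>) (auto simp: finite_term_vars)

primrec subst_term :: "(nat \<Rightarrow> 'f fo_term) \<Rightarrow> 'f fo_term \<Rightarrow> 'f fo_term" where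
  "subst_term s (Var i) = s i"
| "subst_term s (Fn f ts) = Fn f (map (subst_term s) ts)"

text \<open>The bound variable is renamed to one that occurs in none of the inserted terms, which
  avoids capture.\<close>

primrec subst_formula :: "('f, 'r) formula \<Rightarrow> (nat \<Rightarrow> 'f fo_term) \<Rightarrow> ('f, 'r) formula" where
  "subst_formula (Eq t u) s = Eq (subst_term s t) (subst_term s u)"
| "subst_formula (Rel r ts) s = Rel r (map (subst_term s) ts)"
| "subst_formula (Neg \<phi>) s = Neg (subst_formula \<phi> s)"
| "subst_formula (Conj \<phi> \<psi>) s = Conj (subst_formula \<phi> s) (subst_formula \<psi> s)"
| "subst_formula (Ex i \<phi>) s =
    (let j = (LEAST j. j \<notin> (\<Union>v\<in>free_vars \<phi>. term_vars (s v))) in Ex j (subst_formula \<phi> (s(i := Var j))))"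

lemma subst_term_sig:
  assumes "\<And>v. term_of_sig L (s v)"
  shows "term_of_sig L t \<Longrightarrow> term_of_sig L (subst_term s t)"
  by (induction t) (auto simp: assms list_all_iff)

lemma subst_formula_sig:
  "(\<And>v. term_of_sig L (s v)) \<Longrightarrow> formula_of_sig L \<phi> \<Longrightarrow> formula_of_sig L (subst_formula \<phi> s)"
proof (induction \<phi> arbitrary: s)
  case (Ex i \<phi>)
  then show ?case by (simp add: Let_def)
qed (simp_all add: subst_term_sig list_all_iff)

lemma term_val_subst: "term_val M e (subst_term s t) = term_val M (\<lambda>v. term_val M e (s v)) t"
proof (induction t)
  case (Fn f ts)
  then have "map (term_val M e) (map (subst_term s) ts) = map (term_val M (\<lambda>v. term_val M e (s v))) ts"
    by simp
  then show ?case by (simp only: subst_term.simps term_val.simps)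
qed simp

lemma sat_subst: "sat M e (subst_formula \<phi> s) \<longleftrightarrow> sat M (\<lambda>v. term_val M e (s v)) \<phi>"
proof (induction \<phi> arbitrary: e s)
  case (Rel r ts)
  have "map (term_val M e) (map (subst_term s) ts) = map (term_val M (\<lambda>v. term_val M e (s v))) ts"
    by (simp add: term_val_subst)
  then show ?case by (simp only: subst_formula.simps sat.simps)
next
  case (Ex i \<phi>)
  let ?S = "\<Union>v\<in>free_vars \<phi>. term_vars (s v)"
  define j where "j = (LEAST j. j \<notin> ?S)"
  have "finite ?S" by (simp add: finite_free_vars finite_term_vars)
  then have j: "j \<notin> ?S"
    unfolding j_def using LeastI_ex[of "\<lambda>j. j \<notin> ?S"] ex_new_if_finite[OF infinite_UNIV_nat] by blast
  have "sat M (\<lambda>v. term_val M (e(j := a)) ((s(i := Var j)) v)) \<phi> \<longleftrightarrow>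
        sat M ((\<lambda>v. term_val M e (s v))(i := a)) \<phi>" for a
  proof (rule sat_cong)
    fix v assume "v \<in> free_vars \<phi>"
    then have "j \<notin> term_vars (s v)" using j by blast
    then show "term_val M (e(j := a)) ((s(i := Var j)) v) = ((\<lambda>v. term_val M e (s v))(i := a)) v"
      by (auto intro!: term_val_cong)
  qed
  moreover have "subst_formula (Ex i \<phi>) s = Ex j (subst_formula \<phi> (s(i := Var j)))"
    by (simp add: j_def Let_def)
  ultimately show ?case by (simp only: sat.simps Ex.IH)
qed (simp_all add: term_val_subst)

section \<open>Closure properties of predicates definable over the integers\<close>

definition Zs :: "(ring_symbol, unit, int) fo_structure" where
  "Zs = ring_structure \<Z>"

lemma int_minus: "\<ominus>\<^bsub>\<Z>\<^esub> x = - x"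
proof -
  have "ring \<Z>" using int_is_cring by (simp add: cring_def)
  then show ?thesis by (intro abelian_group.minus_equality) (auto simp: ring_def)
qed

lemma Zs_simps [simp]:
  "universe Zs = UNIV"
  "fun_interp Zs Ring_Zero [] = 0" "fun_interp Zs Ring_One [] = 1"
  "fun_interp Zs Ring_Minus [x] = - x"
  "fun_interp Zs Ring_Plus [x, y] = x + y" "fun_interp Zs Ring_Times [x, y] = x * y"
  by (simp_all add: Zs_def ring_structure_def int_minus)

definition polynomial_fun :: "((nat \<Rightarrow> int) \<Rightarrow> int) \<Rightarrow> bool" where
  "polynomial_fun p \<longleftrightarrow> (\<exists>t. term_of_sig ring_language t \<and> (\<forall>e. term_val Zs e t = p e))"

text \<open>A shallow embedding: formulas stay hidden, and definability is derived by the rules in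
  \<open>definable\<close>, which follow the shape of the HOL predicate.\<close>

definition definable_pred :: "((nat \<Rightarrow> int) \<Rightarrow> bool) \<Rightarrow> bool" where
  "definable_pred P \<longleftrightarrow> (\<exists>\<phi>. formula_of_sig ring_language \<phi> \<and> (\<forall>e. sat Zs e \<phi> \<longleftrightarrow> P e))"

named_theorems definable

lemma polynomial_var [definable]: "polynomial_fun (\<lambda>e. e i)"
  unfolding polynomial_fun_def by (intro exI[of _ "Var i"]) simp

lemma polynomial_add [definable]:
  assumes "polynomial_fun p" "polynomial_fun q"
  shows "polynomial_fun (\<lambda>e. p e + q e)"
proof -
  obtain t u where "term_of_sig ring_language t" "\<forall>e. term_val Zs e t = p e"
    "term_of_sig ring_language u" "\<forall>e. term_val Zs e u = q e"
    using assms by (auto simp: polynomial_fun_def)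
  then show ?thesis unfolding polynomial_fun_def
    by (intro exI[of _ "Fn Ring_Plus [t, u]"]) (simp add: ring_language_def)
qed

lemma polynomial_mult [definable]:
  assumes "polynomial_fun p" "polynomial_fun q"
  shows "polynomial_fun (\<lambda>e. p e * q e)"
proof -
  obtain t u where "term_of_sig ring_language t" "\<forall>e. term_val Zs e t = p e"
    "term_of_sig ring_language u" "\<forall>e. term_val Zs e u = q e"
    using assms by (auto simp: polynomial_fun_def)
  then show ?thesis unfolding polynomial_fun_def
    by (intro exI[of _ "Fn Ring_Times [t, u]"]) (simp add: ring_language_def)
qed

lemma polynomial_uminus:
  assumes "polynomial_fun p"
  shows "polynomial_fun (\<lambda>e. - p e)"
proof -
  obtain t where "term_of_sig ring_language t" "\<forall>e. term_val Zs e t = p e"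
    using assms by (auto simp: polynomial_fun_def)
  then show ?thesis unfolding polynomial_fun_def
    by (intro exI[of _ "Fn Ring_Minus [t]"]) (simp add: ring_language_def)
qed

text \<open>Every integer is the value of a closed term, so integer parameters can be written into
  the formula itself.\<close>

lemma polynomial_const [definable]: "polynomial_fun (\<lambda>e. c)"
proof -
  have 0: "polynomial_fun (\<lambda>e. 0)" unfolding polynomial_fun_def
    by (intro exI[of _ "Fn Ring_Zero []"]) (simp add: ring_language_def)
  have 1: "polynomial_fun (\<lambda>e. 1)" unfolding polynomial_fun_def
    by (intro exI[of _ "Fn Ring_One []"]) (simp add: ring_language_def)
  have nat: "polynomial_fun (\<lambda>e. int n)" for n
    by (induction n) (use polynomial_add[OF 1] 0 in auto)
  show ?thesis
    by (cases c rule: int_cases2) (use nat polynomial_uminus[OF nat] in auto)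
qed

text \<open>The test \<open>b\<close> is independent of the environment. The rule serves renamings
  of variables by cases on the index, as in \<open>definable_reachable\<close>.\<close>

lemma polynomial_if [definable]:
  assumes "polynomial_fun p" "polynomial_fun q"
  shows "polynomial_fun (\<lambda>e. if b then p e else q e)"
  using assms by (cases b) simp_all

lemma definable_eq [definable]:
  assumes "polynomial_fun p" "polynomial_fun q"
  shows "definable_pred (\<lambda>e. p e = q e)"
proof -
  obtain t u where "term_of_sig ring_language t" "\<forall>e. term_val Zs e t = p e"
    "term_of_sig ring_language u" "\<forall>e. term_val Zs e u = q e"
    using assms by (auto simp: polynomial_fun_def)
  then show ?thesis unfolding definable_pred_def by (intro exI[of _ "Eq t u"]) simp
qed

lemma definable_not [definable]:
  assumes "definable_pred P"
  shows "definable_pred (\<lambda>e. \<not> P e)"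
proof -
  obtain \<phi> where "formula_of_sig ring_language \<phi>" "\<forall>e. sat Zs e \<phi> \<longleftrightarrow> P e"
    using assms by (auto simp: definable_pred_def)
  then show ?thesis unfolding definable_pred_def by (intro exI[of _ "Neg \<phi>"]) simp
qed

lemma definable_conj [definable]:
  assumes "definable_pred P" "definable_pred Q"
  shows "definable_pred (\<lambda>e. P e \<and> Q e)"
proof -
  obtain \<phi> \<psi> where "formula_of_sig ring_language \<phi>" "\<forall>e. sat Zs e \<phi> \<longleftrightarrow> P e"
    "formula_of_sig ring_language \<psi>" "\<forall>e. sat Zs e \<psi> \<longleftrightarrow> Q e"
    using assms by (auto simp: definable_pred_def)
  then show ?thesis unfolding definable_pred_def by (intro exI[of _ "Conj \<phi> \<psi>"]) simp
qed

text \<open>The list is fixed outside the formula, so this is a finite conjunction and no quantifier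
  of the language.\<close>

lemma definable_ball [definable]:
  assumes "\<And>x. x \<in> set xs \<Longrightarrow> definable_pred (P x)"
  shows "definable_pred (\<lambda>e. \<forall>x\<in>set xs. P x e)"
  using assms
proof (induction xs)
  case Nil
  have "definable_pred (\<lambda>e. (0 :: int) = 0)" by (intro definable)
  then show ?case by simp
next
  case (Cons x xs)
  then have "definable_pred (\<lambda>e. P x e \<and> (\<forall>x\<in>set xs. P x e))" by (intro definable) auto
  then show ?case by simp
qed

lemma definable_subst:
  assumes "definable_pred P" "\<And>v. polynomial_fun (p v)"
  shows "definable_pred (\<lambda>e. P (\<lambda>v. p v e))"
proof -
  obtain \<phi> where \<phi>: "formula_of_sig ring_language \<phi>" "\<forall>e. sat Zs e \<phi> \<longleftrightarrow> P e"
    using assms by (auto simp: definable_pred_def)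
  from assms(2) have "\<forall>v. \<exists>t. term_of_sig ring_language t \<and> (\<forall>e. term_val Zs e t = p v e)"
    by (auto simp: polynomial_fun_def)
  then obtain s where "\<And>v. term_of_sig ring_language (s v)" "\<And>v e. term_val Zs e (s v) = p v e"
    by metis
  with \<phi> show ?thesis unfolding definable_pred_def
    by (intro exI[of _ "subst_formula \<phi> s"]) (simp add: subst_formula_sig sat_subst)
qed

lemma definable_holds:
  assumes "is_formula ring_language (length ps) \<phi>" "\<And>p. p \<in> set ps \<Longrightarrow> polynomial_fun p"
  shows "definable_pred (\<lambda>e. holds Zs \<phi> (map (\<lambda>p. p e) ps))"
proof -
  define p where "p v = (if v < length ps then ps ! v else (\<lambda>e. 0))" for v
  have "definable_pred (\<lambda>e. sat Zs e \<phi>)"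
    using assms(1) by (auto simp: definable_pred_def is_formula_def)
  moreover have "polynomial_fun (p v)" for v
    using assms(2) by (cases "v < length ps") (simp_all add: p_def definable)
  ultimately have "definable_pred (\<lambda>e. sat Zs (\<lambda>v. p v e) \<phi>)" by (rule definable_subst)
  moreover have "sat Zs (\<lambda>v. p v e) \<phi> \<longleftrightarrow> holds Zs \<phi> (map (\<lambda>p. p e) ps)" for e
    unfolding holds_def using assms(1) by (intro sat_cong) (auto simp: p_def is_formula_def)
  ultimately show ?thesis by simp
qed

lemma definable_ex:
  assumes "definable_pred P"
  shows "definable_pred (\<lambda>e. \<exists>a. P (e(i := a)))"
proof -
  obtain \<phi> where "formula_of_sig ring_language \<phi>" "\<forall>e. sat Zs e \<phi> \<longleftrightarrow> P e"
    using assms by (auto simp: definable_pred_def)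
  then show ?thesis unfolding definable_pred_def by (intro exI[of _ "Ex i \<phi>"]) simp
qed

lemma definable_ex_override:
  assumes "finite V"
  shows "definable_pred P \<Longrightarrow> definable_pred (\<lambda>e. \<exists>f. P (override_on e f V))"
  using assms
proof (induction V arbitrary: P rule: finite_induct)
  case (insert v V)
  have *: "(\<exists>f. P (override_on e f (insert v V))) \<longleftrightarrow> (\<exists>a. \<exists>f. P (override_on (e(v := a)) f V))" for e
  proof
    assume "\<exists>f. P (override_on e f (insert v V))"
    then obtain f where "P (override_on e f (insert v V))" by blast
    moreover have "override_on e f (insert v V) = override_on (e(v := f v)) f V"
      using insert by (auto simp: override_on_def)
    ultimately show "\<exists>a. \<exists>f. P (override_on (e(v := a)) f V)" by auto
  next
    assume "\<exists>a. \<exists>f. P (override_on (e(v := a)) f V)"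
    then obtain a f where "P (override_on (e(v := a)) f V)" by blast
    moreover have "override_on e (f(v := a)) (insert v V) = override_on (e(v := a)) f V"
      using insert by (auto simp: override_on_def)
    ultimately show "\<exists>f. P (override_on e f (insert v V))" by metis
  qed
  show ?case unfolding * by (rule definable_ex[OF insert.IH[OF insert.prems]])
qed simp

text \<open>The list is stored in the block of \<open>k\<close> variables from \<open>b\<close> on.
  The congruence says that \<open>P\<close> reads the environment below \<open>b\<close> only, so
  overwriting the block does no harm.\<close>

lemma definable_ex_list:
  assumes P: "definable_pred (\<lambda>e. P e (map e [b..<b + k]))"
    and cong: "\<And>e e' xs. (\<And>v. v < b \<Longrightarrow> e v = e' v) \<Longrightarrow> P e xs \<longleftrightarrow> P e' xs"
  shows "definable_pred (\<lambda>e. \<exists>xs. length xs = k \<and> P e xs)"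
proof -
  let ?o = "\<lambda>e f. override_on e f {b..<b + k}"
  have "P (?o e f) (map (?o e f) [b..<b + k]) \<longleftrightarrow> P e (map f [b..<b + k])" for e f
  proof -
    have "map (?o e f) [b..<b + k] = map f [b..<b + k]" by (auto simp: override_on_def)
    moreover have "P (?o e f) xs \<longleftrightarrow> P e xs" for xs by (rule cong) (simp add: override_on_def)
    ultimately show ?thesis by (simp only:)
  qed
  moreover have "(\<exists>f. P e (map f [b..<b + k])) \<longleftrightarrow> (\<exists>xs. length xs = k \<and> P e xs)" for e
  proof
    assume "\<exists>xs. length xs = k \<and> P e xs"
    then obtain xs where xs: "length xs = k" "P e xs" by blast
    then have "map (\<lambda>v. xs ! (v - b)) [b..<b + k] = xs" by (auto intro: nth_equalityI)
    with xs show "\<exists>f. P e (map f [b..<b + k])" by metis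
  qed (metis diff_add_inverse length_map length_upt)
  ultimately show ?thesis using definable_ex_override[OF _ P, of "{b..<b + k}"] by simp
qed

lemma definable_dvd [definable]:
  assumes "polynomial_fun p" "polynomial_fun q"
  shows "definable_pred (\<lambda>e. p e dvd q e)"
proof -
  obtain t u where t: "term_of_sig ring_language t" "\<And>e. term_val Zs e t = p e"
    "term_of_sig ring_language u" "\<And>e. term_val Zs e u = q e"
    using assms by (auto simp: polynomial_fun_def)
  obtain z where z: "z \<notin> term_vars t \<union> term_vars u"
    using ex_new_if_finite[OF infinite_UNIV_nat] finite_term_vars by (metis finite_UnI)
  have "p (e(z := a)) = p e" "q (e(z := a)) = q e" for e a
    unfolding t(2,4)[symmetric] by (rule term_val_cong; use z in auto)+
  moreover have "definable_pred (\<lambda>e. \<exists>a. q (e(z := a)) = p (e(z := a)) * (e(z := a)) z)"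
    by (rule definable_ex) (intro definable assms)
  ultimately show ?thesis by (simp add: dvd_def)
qed

lemma definable_list_eq [definable]:
  assumes "length vs = length ws"
  shows "definable_pred (\<lambda>e. map e vs = map e ws)"
proof -
  have "definable_pred (\<lambda>e. \<forall>x\<in>set (zip vs ws). e (fst x) = e (snd x))" by (intro definable)
  moreover have "(\<lambda>e. \<forall>x\<in>set (zip vs ws). e (fst x) = e (snd x)) = (\<lambda>e :: nat \<Rightarrow> int. map e vs = map e ws)"
    using assms by (induction rule: list_induct2) (auto simp: fun_eq_iff)
  ultimately show ?thesis by (simp only:)
qed

section \<open>Coding finite sets of tuples of integers without the order\<close>

text \<open>A finite set of tuples is coded by a list \<open>[E, S, D, W, C]\<close>: for \<open>E \<noteq> 0\<close> the divisibility of \<open>E\<close>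
  leaves finitely many tuples \<open>xs\<close>, the polynomial with coefficients \<open>xs\<close> separates them by its
  value \<open>v\<close> at \<open>W\<close>, and a suitable \<open>D\<close> makes the moduli \<open>1 + D v\<close> pairwise coprime, so that \<open>C\<close> can
  select any subset. The leading coefficient 1 is added to keep \<open>v\<close> different from 0.\<close>

definition in_code :: "int list \<Rightarrow> int list \<Rightarrow> bool" where
  "in_code cs xs \<longleftrightarrow> cs ! 0 \<noteq> 0 \<and> (\<forall>x\<in>set xs. x + cs ! 1 dvd cs ! 0) \<and>
     1 + cs ! 2 * poly (Poly (xs @ [1])) (cs ! 3) dvd cs ! 4"

lemma finite_in_code: "finite {xs. length xs = r \<and> in_code cs xs}"
proof (cases "cs ! 0 = 0")
  case False
  let ?A = "(\<lambda>d. d - cs ! 1) ` {d. d dvd cs ! 0}"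
  have "{xs. length xs = r \<and> in_code cs xs} \<subseteq> {xs. set xs \<subseteq> ?A \<and> length xs = r}"
    by (auto simp: in_code_def image_iff algebra_simps)
  then show ?thesis
    by (rule finite_subset) (intro finite_lists_length_eq finite_imageI finite_divisors_int False)
qed (simp add: in_code_def)

text \<open>As for Goedel's beta function: a common divisor is coprime to \<open>D\<close>, because
  it divides \<open>1 + D * a\<close>; it divides \<open>D * (a - b)\<close>, hence
  \<open>a - b\<close>, hence \<open>D\<close>.\<close>

lemma coprime_if_diff_dvd:
  fixes a b D :: int
  assumes "a - b dvd D"
  shows "Rings.coprime (1 + D * a) (1 + D * b)"
proof (rule Rings.coprimeI)
  fix d assume d: "d dvd 1 + D * a" "d dvd 1 + D * b"
  have "Rings.coprime d D"
  proof (rule Rings.coprimeI)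
    fix c assume "c dvd d" "c dvd D"
    then have "c dvd 1 + D * a" "c dvd D * a" using d(1) by (auto intro: dvd_trans)
    then show "is_unit c" by (simp add: dvd_add_left_iff)
  qed
  moreover have "d dvd D * (a - b)"
    using dvd_diff[OF d] by (simp add: algebra_simps)
  ultimately have "d dvd a - b" by (simp add: coprime_dvd_mult_right_iff)
  then have "d dvd D" using assms by (rule dvd_trans)
  with \<open>Rings.coprime d D\<close> show "is_unit d" by (intro Rings.coprime_common_divisor[of d D]) simp_all
qed

lemma code_exists:
  fixes F :: "int list set"
  assumes F: "finite F" "\<And>xs. xs \<in> F \<Longrightarrow> length xs = r"
  obtains cs where "length cs = 5" "\<And>xs. length xs = r \<Longrightarrow> in_code cs xs \<longleftrightarrow> xs \<in> F"
proof -
  let ?X = "\<Union>xs\<in>F. set xs"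
  have finX: "finite ?X" using F by blast
  \<comment> \<open>The shift by \<open>S\<close> keeps all entries away from 0, so that the product
    \<open>E\<close> of the shifted entries is a nonzero multiple of each of them.\<close>
  obtain S where S: "S \<notin> uminus ` ?X"
    using ex_new_if_finite[OF infinite_UNIV_int finite_imageI[OF finX]] by blast
  define E where "E = (\<Prod>x\<in>?X. x + S)"
  have S': "x + S \<noteq> 0" if "x \<in> ?X" for x
  proof
    assume "x + S = 0"
    then have "S = - x" by simp
    with S that show False by blast
  qed
  have E0: "E \<noteq> 0" unfolding E_def using finX S' by (simp add: prod_zero_iff)
  \<comment> \<open>These are all the tuples that pass the divisibility test; the choices below must
    separate the members of \<open>F\<close> from everything in \<open>T\<close>.\<close>
  define T where "T = {xs. length xs = r \<and> (\<forall>x\<in>set xs. x + S dvd E)}"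
  have "T \<subseteq> {xs. set xs \<subseteq> (\<lambda>d. d - S) ` {d. d dvd E} \<and> length xs = r}"
    by (auto simp: T_def image_iff) (metis add_diff_cancel_right')
  then have finT: "finite T"
    by (rule finite_subset) (intro finite_lists_length_eq finite_imageI finite_divisors_int E0)
  have FT: "F \<subseteq> T" using F finX by (auto simp: T_def E_def intro!: dvd_prodI)
  define q where "q xs = Poly (xs @ [1 :: int])" for xs
  have coeffs_q: "coeffs (q xs) = xs @ [1]" for xs by (simp add: q_def)
  have q0: "q xs \<noteq> 0" for xs using coeffs_q[of xs] by auto
  have q_inj: "xs = ys" if "q xs = q ys" for xs ys
    using arg_cong[OF that, of coeffs] unfolding coeffs_q by simp
  \<comment> \<open>The bad evaluation points: roots of one of the polynomials or of a difference of
    two. Outside of them the values are nonzero and pairwise distinct.\<close>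
  let ?B = "(\<Union>xs\<in>T. {w. poly (q xs) w = 0}) \<union>
    (\<Union>(xs, ys)\<in>{(xs, ys)\<in>T \<times> T. xs \<noteq> ys}. {w. poly (q xs - q ys) w = 0})"
  have finP: "finite {(xs, ys)\<in>T \<times> T. xs \<noteq> ys}"
    by (rule finite_subset[OF _ finite_cartesian_product[OF finT finT]]) auto
  have "finite ?B"
  proof (intro finite_UnI finite_UN_I finT finP)
    show "finite {w. poly (q xs) w = 0}" for xs using q0 by (rule poly_roots_finite)
    fix p assume "p \<in> {(xs, ys)\<in>T \<times> T. xs \<noteq> ys}"
    then obtain xs ys where p: "p = (xs, ys)" "xs \<noteq> ys" by auto
    then have "q xs - q ys \<noteq> 0" using q_inj by auto
    then have "finite {w. poly (q xs - q ys) w = 0}" by (rule poly_roots_finite)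
    then show "finite (case p of (xs, ys) \<Rightarrow> {w. poly (q xs - q ys) w = 0})" by (simp only: p prod.case)
  qed
  then obtain W where W: "W \<notin> ?B" using ex_new_if_finite[OF infinite_UNIV_int] by blast
  define v where "v xs = poly (q xs) W" for xs
  have v0: "v xs \<noteq> 0" if "xs \<in> T" for xs using W that by (auto simp: v_def)
  have v_inj: "v xs \<noteq> v ys" if "xs \<in> T" "ys \<in> T" "xs \<noteq> ys" for xs ys using W that by (auto simp: v_def)
  \<comment> \<open>The factor 3 keeps the moduli from being units: \<open>1 + D * v = -1\<close>
    would need \<open>D * v = -2\<close>, which 3 does not divide, and \<open>1 + D * v = 1\<close>
    would need \<open>D * v = 0\<close>.\<close>
  define D where "D = 3 * (\<Prod>(xs, ys)\<in>{(xs, ys)\<in>T \<times> T. xs \<noteq> ys}. v xs - v ys)"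
  have D0: "D \<noteq> 0" unfolding D_def using finP v_inj by (auto simp: prod_zero_iff)
  have D_dvd: "v xs - v ys dvd D" if "xs \<in> T" "ys \<in> T" "xs \<noteq> ys" for xs ys
    unfolding D_def using dvd_prodI[OF finP, of "(xs, ys)" "\<lambda>(xs, ys). v xs - v ys"] that
    by (auto intro: dvd_mult)
  define C where "C = (\<Prod>xs\<in>F. 1 + D * v xs)"
  have C: "1 + D * v xs dvd C \<longleftrightarrow> xs \<in> F" if xs: "xs \<in> T" for xs
  proof
    assume dvd: "1 + D * v xs dvd C"
    show "xs \<in> F"
    proof (rule ccontr)
      assume "xs \<notin> F"
      then have "Rings.coprime (1 + D * v xs) (1 + D * v ys)" if "ys \<in> F" for ys
        using that FT xs by (intro coprime_if_diff_dvd D_dvd) auto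
      then have "Rings.coprime (1 + D * v xs) C" unfolding C_def by (rule prod_coprime_right)
      with dvd have "is_unit (1 + D * v xs)"
        by (intro Rings.coprime_common_divisor[of "1 + D * v xs" C]) simp_all
      moreover have "y = 0 \<or> y = -2" if "\<bar>1 + y\<bar> = 1" for y :: int using that by arith
      ultimately have "D * v xs = 0 \<or> D * v xs = -2" by (simp only: zdvd1_eq)
      moreover have "3 dvd D * v xs" by (simp add: D_def)
      ultimately have "D * v xs = 0" by auto
      with D0 v0[OF xs] show False by simp
    qed
  next
    assume "xs \<in> F"
    then show "1 + D * v xs dvd C" unfolding C_def using F(1) by (intro dvd_prodI)
  qed
  have "in_code [E, S, D, W, C] xs \<longleftrightarrow> xs \<in> F" if "length xs = r" for xs
  proof -
    have "in_code [E, S, D, W, C] xs \<longleftrightarrow> xs \<in> T \<and> 1 + D * v xs dvd C"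
      using that E0 by (simp add: in_code_def T_def v_def q_def numeral_nat)
    also have "\<dots> \<longleftrightarrow> xs \<in> F" using C FT by blast
    finally show ?thesis .
  qed
  then show ?thesis using that[of "[E, S, D, W, C]"] by simp
qed

lemma definable_in_code:
  assumes "length cs = 5"
  shows "definable_pred (\<lambda>e. in_code (map e cs) (map e vs))"
proof -
  have horner: "polynomial_fun (\<lambda>e. poly (Poly (map e vs @ [1])) (e w))" for w
    by (induction vs) (simp_all add: definable)
  have "definable_pred (\<lambda>e. e (cs ! 0) \<noteq> 0 \<and> (\<forall>v\<in>set vs. e v + e (cs ! 1) dvd e (cs ! 0)) \<and>
      1 + e (cs ! 2) * poly (Poly (map e vs @ [1])) (e (cs ! 3)) dvd e (cs ! 4))"
    by (intro definable horner)
  then show ?thesis using assms by (simp add: in_code_def)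
qed

text \<open>A coded set is finite, so a chain of \<open>N\<close>-steps inside it that runs through the disjoint sets
  \<open>S m\<close> has to stop, which it can do only at \<open>zs\<close>.\<close>

lemma reachable_iff_code:
  fixes S :: "nat \<Rightarrow> int list set" and N :: "int list \<Rightarrow> int list \<Rightarrow> bool"
  assumes ne: "\<And>m. S m \<noteq> {}" and len: "\<And>m xs. xs \<in> S m \<Longrightarrow> length xs = r"
    and disj: "\<And>m m' xs. xs \<in> S m \<Longrightarrow> xs \<in> S m' \<Longrightarrow> m = m'"
    and N: "\<And>m xs ys. xs \<in> S m \<Longrightarrow> length ys = r \<Longrightarrow> N xs ys \<longleftrightarrow> ys \<in> S (Suc m)"
    and c: "c \<in> S 0" and zs: "length zs = r"
  shows "zs \<in> (\<Union>m. S (Suc m)) \<longleftrightarrow>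
    (\<exists>cs. length cs = 5 \<and> (\<exists>xs. length xs = r \<and> in_code cs xs \<and> N c xs) \<and>
      \<not> (\<exists>xs. length xs = r \<and> in_code cs xs \<and> xs \<noteq> zs \<and>
            \<not> (\<exists>ys. length ys = r \<and> in_code cs ys \<and> N xs ys)))"
    (is "_ \<longleftrightarrow> ?R")
proof
  assume "zs \<in> (\<Union>m. S (Suc m))"
  then obtain m where m: "zs \<in> S (Suc m)" by blast
  have "\<forall>i. \<exists>x. x \<in> S i" using ne by blast
  then obtain x0 where x0: "\<And>i. x0 i \<in> S i" by metis
  \<comment> \<open>A path through the sets \<open>S i\<close> with \<open>zs\<close> at stage
    \<open>Suc m\<close>. Its stages 1 to \<open>Suc m\<close> are coded; each but the last has its
    successor in the code.\<close>
  define x where "x = x0(Suc m := zs)"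
  have x: "x i \<in> S i" for i using x0 m by (simp add: x_def)
  have lx: "length (x i) = r" for i using len[OF x] .
  obtain cs where cs: "length cs = 5" "\<And>xs. length xs = r \<Longrightarrow> in_code cs xs \<longleftrightarrow> xs \<in> x ` {1..Suc m}"
    using code_exists[of "x ` {1..Suc m}" r] lx by blast
  have "length (x 1) = r \<and> in_code cs (x 1) \<and> N c (x 1)"
    using cs(2)[OF lx, of 1] N[OF c lx, of 1] x[of 1] lx by auto
  moreover have "\<exists>ys. length ys = r \<and> in_code cs ys \<and> N xs ys"
    if xs: "length xs = r" "in_code cs xs" "xs \<noteq> zs" for xs
  proof -
    obtain i where i: "i \<in> {1..Suc m}" "xs = x i" using xs cs(2) by blast
    with xs(3) have "i \<le> m" by (auto simp: x_def le_Suc_eq)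
    then have "in_code cs (x (Suc i))" using cs(2)[OF lx] i by auto
    moreover have "N xs (x (Suc i))" using N[OF x lx] x[of "Suc i"] i by auto
    ultimately show ?thesis using lx by blast
  qed
  ultimately show ?R using cs(1) by blast
next
  assume ?R
  then obtain cs where start: "\<exists>xs. length xs = r \<and> in_code cs xs \<and> N c xs"
    and step: "\<And>xs. length xs = r \<Longrightarrow> in_code cs xs \<Longrightarrow> xs \<noteq> zs \<Longrightarrow>
      \<exists>ys. length ys = r \<and> in_code cs ys \<and> N xs ys" by blast
  show "zs \<in> (\<Union>m. S (Suc m))"
  proof (rule ccontr)
    assume *: "zs \<notin> (\<Union>m. S (Suc m))"
    have ex: "\<exists>xs. xs \<in> S (Suc m) \<and> in_code cs xs" for m
    proof (induction m)
      case 0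
      then show ?case using start N[OF c] by blast
    next
      case (Suc m)
      then obtain xs where xs: "xs \<in> S (Suc m)" "in_code cs xs" by blast
      with * have "xs \<noteq> zs" by blast
      with step[OF len[OF xs(1)] xs(2)] N[OF xs(1)] show ?case by blast
    qed
    then obtain x where x: "\<And>m. x m \<in> S (Suc m)" "\<And>m. in_code cs (x m)" by metis
    have "inj x" by (rule injI) (metis disj x(1) nat.inject)
    then have "infinite (range x)" by (simp add: finite_image_iff)
    moreover have "range x \<subseteq> {xs. length xs = r \<and> in_code cs xs}" using x len by blast
    ultimately show False using finite_in_code finite_subset by blast
  qed
qed

text \<open>Layout of the variables: the tuple under test lies below \<open>r\<close>, the code in
  the next five, then one block for \<open>xs\<close> and one for \<open>ys\<close>. Each inner
  quantifier uses a block above everything it reads. The start \<open>c\<close> enters as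
  constants.\<close>

lemma definable_reachable:
  fixes S :: "nat \<Rightarrow> int list set" and N :: "int list \<Rightarrow> int list \<Rightarrow> bool"
  assumes ne: "\<And>m. S m \<noteq> {}" and len: "\<And>m xs. xs \<in> S m \<Longrightarrow> length xs = r"
    and disj: "\<And>m m' xs. xs \<in> S m \<Longrightarrow> xs \<in> S m' \<Longrightarrow> m = m'"
    and N: "\<And>m xs ys. xs \<in> S m \<Longrightarrow> length ys = r \<Longrightarrow> N xs ys \<longleftrightarrow> ys \<in> S (Suc m)"
    and def: "definable_pred (\<lambda>e. N (map e [0..<r]) (map e [r..<2 * r]))"
  shows "definable_pred (\<lambda>e. map e [0..<r] \<in> (\<Union>m. S (Suc m)))"
proof -
  obtain c where c: "c \<in> S 0" using ne by blast
  have lc: "length c = r" using len[OF c] .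
  have shift: "map (\<lambda>v. if v < r then f v else g (b + (v - r))) [0..<r] = map f [0..<r]"
    "map (\<lambda>v. if v < r then f v else g (b + (v - r))) [r..<2 * r] = map g [b..<b + r]"
    for b :: nat and f g :: "nat \<Rightarrow> int"
    by (auto intro!: nth_equalityI)
  have Nc: "definable_pred (\<lambda>e. N c (map e [b..<b + r]))" for b
  proof -
    have "definable_pred (\<lambda>e. N (map (\<lambda>v. if v < r then c ! v else e (b + (v - r))) [0..<r])
        (map (\<lambda>v. if v < r then c ! v else e (b + (v - r))) [r..<2 * r]))"
      by (rule definable_subst[OF def]) (intro definable)
    moreover have "map ((!) c) [0..<r] = c" using lc by (auto intro: nth_equalityI)
    ultimately show ?thesis by (simp only: shift)
  qed
  have Nxy: "definable_pred (\<lambda>e. N (map e [a..<a + r]) (map e [b..<b + r]))" for a b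
  proof -
    have "definable_pred (\<lambda>e. N (map (\<lambda>v. if v < r then e (a + v) else e (b + (v - r))) [0..<r])
        (map (\<lambda>v. if v < r then e (a + v) else e (b + (v - r))) [r..<2 * r]))"
      by (rule definable_subst[OF def]) (intro definable)
    moreover have "map (\<lambda>v. if v < r then e (a + v) else e (b + (v - r))) [0..<r] = map e [a..<a + r]"
      for e :: "nat \<Rightarrow> int"
      by (auto intro!: nth_equalityI)
    moreover have "map (\<lambda>v. if v < r then e (a + v) else e (b + (v - r))) [r..<2 * r] = map e [b..<b + r]"
      for e :: "nat \<Rightarrow> int"
      by (rule shift(2))
    ultimately show ?thesis by (simp only:)
  qed
  define A where "A e cs \<longleftrightarrow> (\<exists>xs. length xs = r \<and> in_code cs xs \<and> N c xs) \<and>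
    \<not> (\<exists>xs. length xs = r \<and> in_code cs xs \<and> xs \<noteq> map e [0..<r] \<and>
          \<not> (\<exists>ys. length ys = r \<and> in_code cs ys \<and> N xs ys))" for e :: "nat \<Rightarrow> int" and cs
  have cong: "map e [0..<r] = map e' [0..<r]" "map e [r..<r + 5] = map e' [r..<r + 5]"
    if "\<And>v. v < r + 5 \<Longrightarrow> e v = e' v" for e e' :: "nat \<Rightarrow> int"
    using that by auto
  have "definable_pred (\<lambda>e. A e (map e [r..<r + 5]))"
    unfolding A_def
  proof (intro definable_conj definable_not)
    show "definable_pred (\<lambda>e. \<exists>xs. length xs = r \<and> in_code (map e [r..<r + 5]) xs \<and> N c xs)"
      by (rule definable_ex_list[of _ "r + 5"])
        (intro definable_conj definable_in_code Nc, simp, metis cong(2))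
    have "definable_pred (\<lambda>e. \<exists>ys. length ys = r \<and> in_code (map e [r..<r + 5]) ys \<and>
        N (map e [r + 5..<r + 5 + r]) ys)"
    proof (rule definable_ex_list[of _ "r + 5 + r"])
      show "definable_pred (\<lambda>e. in_code (map e [r..<r + 5]) (map e [r + 5 + r..<r + 5 + r + r]) \<and>
          N (map e [r + 5..<r + 5 + r]) (map e [r + 5 + r..<r + 5 + r + r]))"
        by (intro definable_conj definable_in_code Nxy) simp
      fix e e' :: "nat \<Rightarrow> int" and ys
      assume "\<And>v. v < r + 5 + r \<Longrightarrow> e v = e' v"
      then have "map e [r..<r + 5] = map e' [r..<r + 5]"
        "map e [r + 5..<r + 5 + r] = map e' [r + 5..<r + 5 + r]" by auto
      then show "in_code (map e [r..<r + 5]) ys \<and> N (map e [r + 5..<r + 5 + r]) ys \<longleftrightarrow>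
          in_code (map e' [r..<r + 5]) ys \<and> N (map e' [r + 5..<r + 5 + r]) ys" by (simp only:)
    qed
    note inner = this
    show "definable_pred (\<lambda>e. \<exists>xs. length xs = r \<and> in_code (map e [r..<r + 5]) xs \<and>
        xs \<noteq> map e [0..<r] \<and>
        \<not> (\<exists>ys. length ys = r \<and> in_code (map e [r..<r + 5]) ys \<and> N xs ys))"
    proof (rule definable_ex_list[of _ "r + 5"])
      show "definable_pred (\<lambda>e. in_code (map e [r..<r + 5]) (map e [r + 5..<r + 5 + r]) \<and>
          map e [r + 5..<r + 5 + r] \<noteq> map e [0..<r] \<and>
          \<not> (\<exists>ys. length ys = r \<and> in_code (map e [r..<r + 5]) ys \<and>
               N (map e [r + 5..<r + 5 + r]) ys))"
        by (intro definable_conj definable_in_code definable_not definable_list_eq inner) simp_all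
      fix e e' :: "nat \<Rightarrow> int" and xs
      assume "\<And>v. v < r + 5 \<Longrightarrow> e v = e' v"
      from cong[OF this] show "in_code (map e [r..<r + 5]) xs \<and> xs \<noteq> map e [0..<r] \<and>
          \<not> (\<exists>ys. length ys = r \<and> in_code (map e [r..<r + 5]) ys \<and> N xs ys) \<longleftrightarrow>
          in_code (map e' [r..<r + 5]) xs \<and> xs \<noteq> map e' [0..<r] \<and>
          \<not> (\<exists>ys. length ys = r \<and> in_code (map e' [r..<r + 5]) ys \<and> N xs ys)"
        by (simp only:)
    qed
  qed
  then have "definable_pred (\<lambda>e. \<exists>cs. length cs = 5 \<and> A e cs)"
  proof (rule definable_ex_list)
    fix e e' :: "nat \<Rightarrow> int" and cs
    assume "\<And>v. v < r \<Longrightarrow> e v = e' v"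
    then have "map e [0..<r] = map e' [0..<r]" by auto
    then show "A e cs \<longleftrightarrow> A e' cs" by (simp only: A_def)
  qed
  then show ?thesis
    using reachable_iff_code[of S r N, OF ne len disj N c] by (simp add: A_def)
qed

section \<open>Homomorphisms to the rationals\<close>

context comm_group
begin

lemma subgroup_Union_chain:
  assumes "C \<noteq> {}" "\<And>A. A \<in> C \<Longrightarrow> subgroup A G" "\<And>A B. A \<in> C \<Longrightarrow> B \<in> C \<Longrightarrow> A \<subseteq> B \<or> B \<subseteq> A"
  shows "subgroup (\<Union>C) G"
proof (rule subgroupI)
  show "\<Union>C \<subseteq> carrier G" using subgroup.subset[OF assms(2)] by blast
  obtain A where "A \<in> C" using assms(1) by blast
  then show "\<Union>C \<noteq> {}" using subgroup.one_closed[OF assms(2)] by blast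
next
  fix a assume "a \<in> \<Union>C"
  then obtain A where A: "A \<in> C" "a \<in> A" by blast
  then have "inv a \<in> A" using subgroup.m_inv_closed[OF assms(2)[OF A(1)]] by simp
  then show "inv a \<in> \<Union>C" using A(1) by blast
next
  fix a b assume "a \<in> \<Union>C" "b \<in> \<Union>C"
  then obtain A B where AB: "A \<in> C" "a \<in> A" "B \<in> C" "b \<in> B" by blast
  show "a \<otimes> b \<in> \<Union>C"
  proof (cases "A \<subseteq> B")
    case True
    then have "a \<otimes> b \<in> B" using AB assms(2) by (intro subgroup.m_closed) auto
    then show ?thesis using AB by blast
  next
    case False
    then have "B \<subseteq> A" using assms(3) AB by blast
    then have "a \<otimes> b \<in> A" using AB assms(2) by (intro subgroup.m_closed) auto
    then show ?thesis using AB by blast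
  qed
qed

lemma subgroup_adjoin:
  assumes M: "subgroup M G" and y: "y \<in> carrier G"
  shows "subgroup {m \<otimes> y [^] i | m i. m \<in> M \<and> i \<in> (UNIV :: int set)} G" (is "subgroup ?M G")
proof (rule subgroupI)
  note Mc = subgroup.mem_carrier[OF M]
  show "?M \<subseteq> carrier G" using Mc y by auto
  show "?M \<noteq> {}" using subgroup.one_closed[OF M] by auto
next
  note Mc = subgroup.mem_carrier[OF M]
  fix a assume "a \<in> ?M"
  then obtain m and i :: int where a: "a = m \<otimes> y [^] i" "m \<in> M" by auto
  then have "inv a = inv m \<otimes> y [^] (- i)" using Mc y by (simp add: inv_mult int_pow_neg)
  then show "inv a \<in> ?M" using subgroup.m_inv_closed[OF M] a(2) by blast
next
  note Mc = subgroup.mem_carrier[OF M]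
  fix a b assume "a \<in> ?M" "b \<in> ?M"
  then obtain m m' and i i' :: int where ab: "a = m \<otimes> y [^] i" "m \<in> M" "b = m' \<otimes> y [^] i'" "m' \<in> M" by auto
  then have "a \<otimes> b = (m \<otimes> m') \<otimes> y [^] (i + i')" using Mc y by (simp add: int_pow_mult m_ac)
  then show "a \<otimes> b \<in> ?M" using subgroup.m_closed[OF M ab(2,4)] by blast
qed

lemma inv_cancel_left: "p \<in> carrier G \<Longrightarrow> b \<in> carrier G \<Longrightarrow> inv p \<otimes> (p \<otimes> b) = b"
  by (simp flip: m_assoc)

text \<open>A homomorphism to the divisible group of the rationals extends; here the extension is read off a
  subgroup that contains \<open>S\<close> and is maximal among those avoiding the nontrivial powers of \<open>x\<close>.\<close>

lemma hom_to_rat: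
  assumes S: "subgroup S G" and x: "x \<in> carrier G"
    and avoid: "\<And>k. k > 0 \<Longrightarrow> x [^] (k :: int) \<notin> S"
  obtains l :: "'a \<Rightarrow> rat" where
    "\<And>y z. y \<in> carrier G \<Longrightarrow> z \<in> carrier G \<Longrightarrow> l (y \<otimes> z) = l y + l z"
    "\<And>s. s \<in> S \<Longrightarrow> l s = 0" "l x = 1"
proof -
  let ?A = "{A. subgroup A G \<and> S \<subseteq> A \<and> (\<forall>k>0. x [^] (k :: int) \<notin> A)}"
  have "\<exists>M\<in>?A. \<forall>A\<in>?A. M \<subseteq> A \<longrightarrow> A = M"
  proof (rule subset_Zorn_nonempty)
    show "?A \<noteq> {}" using S avoid by blast
    fix C assume C: "C \<noteq> {}" "subset.chain ?A C"
    then have sub: "C \<subseteq> ?A" and lin: "\<And>A B. A \<in> C \<Longrightarrow> B \<in> C \<Longrightarrow> A \<subseteq> B \<or> B \<subseteq> A"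
      by (auto simp: subset_chain_def)
    have "subgroup (\<Union>C) G" by (rule subgroup_Union_chain[OF C(1) _ lin]) (use sub in auto)
    then show "\<Union>C \<in> ?A" using sub C(1) by blast
  qed
  then obtain M where M: "subgroup M G" "S \<subseteq> M" "\<And>k. k > 0 \<Longrightarrow> x [^] (k :: int) \<notin> M"
    and max: "\<And>A. subgroup A G \<Longrightarrow> S \<subseteq> A \<Longrightarrow> (\<And>k. k > 0 \<Longrightarrow> x [^] (k :: int) \<notin> A) \<Longrightarrow> M \<subseteq> A \<Longrightarrow> A = M"
    by auto
  note Mc = subgroup.mem_carrier[OF M(1)]
  have xM: "k = 0" if "x [^] (k :: int) \<in> M" for k
  proof (rule ccontr)
    assume "k \<noteq> 0"
    moreover have "x [^] (- k) \<in> M"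
      using subgroup.m_inv_closed[OF M(1) that] x by (simp add: int_pow_neg)
    ultimately show False using M(3)[of k] M(3)[of "- k"] that by (cases "k > 0") auto
  qed
  \<comment> \<open>Modulo \<open>M\<close>, the relation reads \<open>y\<close> as the power of
    \<open>x\<close> with exponent \<open>- k / j\<close>; this quotient becomes the value of the
    homomorphism.\<close>
  define P where "P y j k \<longleftrightarrow> j > 0 \<and> y [^] j \<otimes> x [^] k \<in> M" for y and j k :: int
  have P_ex: "\<exists>j k. P y j k" if y: "y \<in> carrier G" for y
  proof (cases "y \<in> M")
    case True
    then have "P y 1 0" using y by (simp add: P_def)
    then show ?thesis by blast
  next
    case False
    let ?M = "{m \<otimes> y [^] i | m i. m \<in> M \<and> i \<in> (UNIV :: int set)}"
    have in_adj: "m \<otimes> y [^] i \<in> ?M" if "m \<in> M" for m and i :: int using that by blast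
    have sub: "M \<subseteq> ?M"
    proof
      fix m assume "m \<in> M"
      then show "m \<in> ?M" using in_adj[of m 0] Mc by simp
    qed
    have "y \<in> ?M" using in_adj[OF subgroup.one_closed[OF M(1)], of 1] y by simp
    with False have "?M \<noteq> M" by blast
    \<comment> \<open>By maximality, adjoining \<open>y\<close> to \<open>M\<close> must let in a
      positive power of \<open>x\<close>; solving for it relates \<open>y\<close> to
      \<open>x\<close>.\<close>
    then have "\<not> (\<forall>k>0. x [^] (k :: int) \<notin> ?M)"
      using max[OF subgroup_adjoin[OF M(1) y]] M(2) sub by blast
    then obtain k m i where k: "k > 0" "x [^] (k :: int) = m \<otimes> y [^] (i :: int)" "m \<in> M" by auto
    have m: "m \<in> carrier G" using Mc k(3) .
    have m_eq: "y [^] (- i) \<otimes> x [^] k = m"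
      using m y by (simp add: k(2) int_pow_neg m_comm[of m] inv_cancel_left)
    have "i \<noteq> 0"
    proof
      assume "i = 0"
      then have "x [^] k \<in> M" using k m by simp
      with xM k(1) show False by blast
    qed
    then consider "i < 0" | "i > 0" by linarith
    then show ?thesis
    proof cases
      case 1
      then have "P y (- i) k" using m_eq k(3) by (simp add: P_def)
      then show ?thesis by blast
    next
      case 2
      have "y [^] i \<otimes> x [^] (- k) = inv (y [^] (- i) \<otimes> x [^] k)"
        using x y by (simp add: inv_mult int_pow_neg)
      then have "P y i (- k)" using 2 m_eq subgroup.m_inv_closed[OF M(1) k(3)] by (simp add: P_def)
      then show ?thesis by blast
    qed
  qed
  have P_scale: "P y (j * c) (k * c)" if "P y j k" "y \<in> carrier G" "c > 0" for y j k c
  proof -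
    have "(y [^] j \<otimes> x [^] k) [^] c \<in> M"
      using that subgroup_int_pow_closed[OF M(1)] by (simp add: P_def)
    then show ?thesis using that x by (simp add: P_def int_pow_distrib int_pow_pow)
  qed
  have P_unique: "k * j' = k' * j" if P: "P y j k" "P y j' k'" and y: "y \<in> carrier G" for y j k j' k'
  proof -
    have *: "y [^] (j * j') \<otimes> x [^] (k * j') \<in> M" "y [^] (j * j') \<otimes> x [^] (k' * j) \<in> M"
      using P_scale[OF P(1) y, of j'] P_scale[OF P(2) y, of j] P by (auto simp: P_def mult.commute)
    have "inv (y [^] (j * j') \<otimes> x [^] (k' * j)) \<otimes> (y [^] (j * j') \<otimes> x [^] (k * j')) \<in> M"
      by (rule subgroup.m_closed[OF M(1) subgroup.m_inv_closed[OF M(1) *(2)] *(1)])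
    also have "inv (y [^] (j * j') \<otimes> x [^] (k' * j)) \<otimes> (y [^] (j * j') \<otimes> x [^] (k * j')) =
        x [^] (k * j' - k' * j)"
      using x y by (simp add: inv_mult_group m_assoc inv_cancel_left int_pow_diff m_comm[of "inv (x [^] (k' * j))"])
    finally show ?thesis using xM by fastforce
  qed
  define l :: "'a \<Rightarrow> rat" where
    "l y = (THE q. \<exists>j k. P y j k \<and> q = - of_int k / of_int j)" for y
  have l: "l y = - of_int k / of_int j" if P: "P y j k" and y: "y \<in> carrier G" for y j k
    unfolding l_def
  proof (rule the_equality)
    show "\<exists>j' k'. P y j' k' \<and> (- of_int k / of_int j :: rat) = - of_int k' / of_int j'" using P by blast
    fix q :: rat assume "\<exists>j' k'. P y j' k' \<and> q = - of_int k' / of_int j'"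
    then obtain j' k' where q: "P y j' k'" "q = - of_int k' / of_int j'" by blast
    have "k * j' = k' * j" by (rule P_unique[OF P q(1) y])
    then have "(of_int k * of_int j' :: rat) = of_int k' * of_int j" by (metis of_int_mult)
    moreover have "j > 0" "j' > 0" using P q(1) by (auto simp: P_def)
    ultimately show "q = - of_int k / of_int j" by (simp add: q(2) field_simps)
  qed
  show ?thesis
  proof (rule that)
    fix y z assume yz: "y \<in> carrier G" "z \<in> carrier G"
    obtain j k where Py: "P y j k" using P_ex[OF yz(1)] by auto
    obtain j' k' where Pz: "P z j' k'" using P_ex[OF yz(2)] by auto
    note P = Py Pz
    have j: "j > 0" "j' > 0" using P by (simp_all add: P_def)
    have *: "y [^] (j * j') \<otimes> x [^] (k * j') \<in> M" "z [^] (j * j') \<otimes> x [^] (k' * j) \<in> M"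
      using P_scale[OF P(1) yz(1) j(2)] P_scale[OF P(2) yz(2) j(1)]
      unfolding P_def by (simp_all only: mult.commute[of j' j])
    have "(y [^] (j * j') \<otimes> x [^] (k * j')) \<otimes> (z [^] (j * j') \<otimes> x [^] (k' * j)) \<in> M"
      by (rule subgroup.m_closed[OF M(1) *])
    also have "(y [^] (j * j') \<otimes> x [^] (k * j')) \<otimes> (z [^] (j * j') \<otimes> x [^] (k' * j)) =
        (y \<otimes> z) [^] (j * j') \<otimes> x [^] (k * j' + k' * j)"
      using x yz by (simp add: int_pow_distrib int_pow_mult m_ac)
    finally have "P (y \<otimes> z) (j * j') (k * j' + k' * j)" using j by (simp add: P_def)
    then have "l (y \<otimes> z) = - of_int (k * j' + k' * j) / of_int (j * j')" by (rule l) (use yz in simp)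
    also have "\<dots> = - of_int k / of_int j + - of_int k' / of_int j'" using j by (simp add: field_simps)
    finally show "l (y \<otimes> z) = l y + l z" using l[OF P(1) yz(1)] l[OF P(2) yz(2)] by simp
  next
    fix s assume "s \<in> S"
    then have s: "s \<in> M" using M(2) by blast
    then have "P s 1 0" using Mc[OF s] by (simp add: P_def)
    then show "l s = 0" using l[of s 1 0] Mc[OF s] by simp
  next
    have "P x 1 (- 1)"
      using x subgroup.one_closed[OF M(1)] by (simp add: P_def int_pow_neg)
    then show "l x = 1" using l[of x 1 "- 1"] x by simp
  qed
qed

end

section \<open>Twisting an ultrapower of a group by a central element\<close>

text \<open>For a fixed rational \<open>q\<close>, the product \<open>q * sq_fact i\<close> is an integer for all but finitely many \<open>i\<close>,
  so that rounding does not matter in the ultrapower.\<close>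

definition sq_fact :: "nat \<Rightarrow> int" where "sq_fact i = (fact i)\<^sup>2"

definition expo :: "rat \<Rightarrow> nat \<Rightarrow> int" where "expo q i = \<lfloor>q * of_int (sq_fact i)\<rfloor>"

lemma expo_exact: "eventually (\<lambda>i. of_int (expo q i) = q * of_int (sq_fact i)) sequentially"
proof -
  obtain p d where q: "q = Rat.Fract p d" "d > 0" by (cases q) auto
  have "of_int (expo q i) = q * of_int (sq_fact i)" if "i \<ge> nat d" for i
  proof -
    have "nat d dvd fact i" using that q(2) by (intro dvd_fact) auto
    then have "int (nat d) dvd int (fact i)" by (simp only: int_dvd_int_iff)
    then have "d dvd fact i" using q(2) by simp
    then obtain m where m: "fact i = d * m" by blast
    have "q * of_int (sq_fact i) = of_int (p * m * fact i)"
      using q by (simp add: sq_fact_def power2_eq_square m Fract_of_int_quotient)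
    then show ?thesis by (simp only: expo_def floor_of_int)
  qed
  then show ?thesis by (auto simp: eventually_sequentially)
qed

lemma expo_0 [simp]: "expo 0 i = 0" and expo_1 [simp]: "expo 1 i = sq_fact i"
  by (simp_all add: expo_def)

lemma expo_add: "eventually (\<lambda>i. expo (q + r) i = expo q i + expo r i) sequentially"
  using expo_exact[of q] expo_exact[of r] expo_exact[of "q + r"]
proof eventually_elim
  case (elim i)
  then have "(of_int (expo (q + r) i) :: rat) = of_int (expo q i + expo r i)" by (simp add: algebra_simps)
  then show ?case by (simp only: of_int_eq_iff)
qed

lemma expo_uminus: "eventually (\<lambda>i. expo (- q) i = - expo q i) sequentially"
  using expo_add[of q "- q"] by eventually_elim simp

text \<open>In the application \<open>G\<close> is a general linear group, \<delta> the determinant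
  and \<open>z\<close> a scalar matrix. The order of \<open>z\<close> is measured in
  \<open>H\<close>, since the exponent of the twist depends on \<delta> x alone.\<close>

locale central_twist = nonprincipal_ultrafilter U + group_hom G H \<delta> + H: comm_group H
  for U and G :: "('a, 'm) monoid_scheme" (structure) and H :: "('b, 'n) monoid_scheme" (structure) and \<delta> +
  fixes z
  assumes z [simp]: "z \<in> carrier G"
    and central: "x \<in> carrier G \<Longrightarrow> z \<otimes> x = x \<otimes> z"
    and infinite_order: "k > 0 \<Longrightarrow> \<delta> z [^]\<^bsub>H\<^esub> (k :: int) \<noteq> \<one>\<^bsub>H\<^esub>"
begin

abbreviation "w \<equiv> \<delta> z"

lemma w_pow_inj:
  assumes "w [^]\<^bsub>H\<^esub> (i :: int) = w [^]\<^bsub>H\<^esub> (j :: int)"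
  shows "i = j"
proof -
  have "w [^]\<^bsub>H\<^esub> (i - j) = \<one>\<^bsub>H\<^esub>" "w [^]\<^bsub>H\<^esub> (j - i) = \<one>\<^bsub>H\<^esub>"
    using assms by (simp_all add: H.int_pow_diff)
  then show ?thesis using infinite_order[of "i - j"] infinite_order[of "j - i"] by linarith
qed

lemma central_pow_nat: "x \<in> carrier G \<Longrightarrow> z [^] (n :: nat) \<otimes> x = x \<otimes> z [^] n"
proof (induction n)
  case (Suc n)
  have "z [^] n \<otimes> z \<otimes> x = z [^] n \<otimes> (x \<otimes> z)" using Suc central by (simp add: G.m_assoc)
  also have "\<dots> = x \<otimes> (z [^] n \<otimes> z)" using Suc by (simp flip: G.m_assoc)
  finally show ?case by simp
qed simp

lemma central_pow:
  assumes x: "x \<in> carrier G"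
  shows "z [^] (k :: int) \<otimes> x = x \<otimes> z [^] k"
proof (cases "k \<ge> 0")
  case True
  then obtain n where "k = int n" by (metis nonneg_int_cases)
  then show ?thesis using central_pow_nat[OF x] by (simp add: int_pow_int)
next
  case False
  define n where "n = nat (- k)"
  have k: "k = - int n" using False by (simp add: n_def)
  have "x \<otimes> inv (z [^] n) = inv (z [^] n) \<otimes> (z [^] n \<otimes> x) \<otimes> inv (z [^] n)"
    using x by (simp flip: G.m_assoc)
  also have "\<dots> = inv (z [^] n) \<otimes> (x \<otimes> z [^] n) \<otimes> inv (z [^] n)" by (simp only: central_pow_nat[OF x])
  also have "\<dots> = inv (z [^] n) \<otimes> x" using x by (simp add: G.m_assoc)
  finally show ?thesis by (simp add: k G.int_pow_neg_int)
qed

text \<open>The homomorphism lives on the full product of copies of \<open>H\<close>, so that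
  additivity holds exactly. That it depends on classes modulo \<open>U\<close> only is a case of the
  second clause, applied to quotients.\<close>

lemma twist_hom:
  obtains l :: "(nat \<Rightarrow> 'b) \<Rightarrow> rat" where
    "\<And>x y. (\<And>i. x i \<in> carrier H) \<Longrightarrow> (\<And>i. y i \<in> carrier H) \<Longrightarrow>
        l (\<lambda>i. x i \<otimes>\<^bsub>H\<^esub> y i) = l x + l y"
    "\<And>x c j. (\<And>i. x i \<in> carrier H) \<Longrightarrow> c \<in> carrier H \<Longrightarrow>
        eventually (\<lambda>i. x i = c \<otimes>\<^bsub>H\<^esub> w [^]\<^bsub>H\<^esub> (j * sq_fact i)) U \<Longrightarrow> l x = 0"
    "l (\<lambda>i. w [^]\<^bsub>H\<^esub> (fact i :: int)) = 1"
proof -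
  define P where "P = product_group (UNIV :: nat set) (\<lambda>_. H)"
  have carrier_P: "x \<in> carrier P \<longleftrightarrow> (\<forall>i. x i \<in> carrier H)" for x by (auto simp: P_def)
  have mult_P: "x \<otimes>\<^bsub>P\<^esub> y = (\<lambda>i. x i \<otimes>\<^bsub>H\<^esub> y i)" for x y
    by (simp add: P_def restrict_def)
  have group_P: "group P" by (simp add: P_def H.is_group)
  interpret P: comm_group P
    by (rule group.group_comm_groupI[OF group_P]) (simp add: carrier_P mult_P H.m_comm)
  have inv_P: "inv\<^bsub>P\<^esub> x = (\<lambda>i. inv\<^bsub>H\<^esub> x i)" if "x \<in> carrier P" for x
    using that inv_product_group[of x UNIV "\<lambda>_. H"] by (simp add: P_def H.is_group restrict_def)
  have pow_P: "(x [^]\<^bsub>P\<^esub> k) i = x i [^]\<^bsub>H\<^esub> k" if "x \<in> carrier P" for x i and k :: int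
  proof -
    have "group_hom P H (\<lambda>x. x i)"
      by (intro group_hom.intro group_hom_axioms.intro group_P H.is_group homI)
        (simp_all add: carrier_P mult_P)
    from group_hom.hom_int_pow[OF this that] show ?thesis by simp
  qed
  \<comment> \<open>Three things to be killed at once: with \<open>c\<close> the standard elements,
    with \<open>j\<close> the powers of w^M, and with trivial \<open>c\<close> and \<open>j\<close>
    all sequences that are 1 almost everywhere.\<close>
  define S where "S = {x \<in> carrier P. \<exists>c\<in>carrier H. \<exists>j :: int.
    eventually (\<lambda>i. x i = c \<otimes>\<^bsub>H\<^esub> w [^]\<^bsub>H\<^esub> (j * sq_fact i)) U}"
  have S_I: "x \<in> S" if "x \<in> carrier P" "c \<in> carrier H"
    "eventually (\<lambda>i. x i = c \<otimes>\<^bsub>H\<^esub> w [^]\<^bsub>H\<^esub> (j * sq_fact i)) U" for x c and j :: int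
    using that by (auto simp: S_def)
  have S: "subgroup S P"
  proof (rule P.subgroupI)
    show "S \<subseteq> carrier P" by (auto simp: S_def)
    have "\<one>\<^bsub>P\<^esub> \<in> S" by (rule S_I[OF P.one_closed H.one_closed, of 0]) (simp add: P_def)
    then show "S \<noteq> {}" by blast
  next
    fix x assume "x \<in> S"
    then obtain c and j :: int where x: "x \<in> carrier P" "c \<in> carrier H"
      "eventually (\<lambda>i. x i = c \<otimes>\<^bsub>H\<^esub> w [^]\<^bsub>H\<^esub> (j * sq_fact i)) U" by (auto simp: S_def)
    show "inv\<^bsub>P\<^esub> x \<in> S"
    proof (rule S_I)
      show "inv\<^bsub>P\<^esub> x \<in> carrier P" using x(1) by simp
      show "inv\<^bsub>H\<^esub> c \<in> carrier H" using x(2) by simp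
      show "eventually (\<lambda>i. (inv\<^bsub>P\<^esub> x) i = inv\<^bsub>H\<^esub> c \<otimes>\<^bsub>H\<^esub> w [^]\<^bsub>H\<^esub> ((- j) * sq_fact i)) U"
        using x(3) by eventually_elim (use x(1,2) in \<open>simp add: inv_P H.inv_mult H.int_pow_neg\<close>)
    qed
  next
    fix x y assume "x \<in> S" "y \<in> S"
    then obtain c d and j k :: int where x: "x \<in> carrier P" "c \<in> carrier H"
        "eventually (\<lambda>i. x i = c \<otimes>\<^bsub>H\<^esub> w [^]\<^bsub>H\<^esub> (j * sq_fact i)) U"
      and y: "y \<in> carrier P" "d \<in> carrier H"
        "eventually (\<lambda>i. y i = d \<otimes>\<^bsub>H\<^esub> w [^]\<^bsub>H\<^esub> (k * sq_fact i)) U" unfolding S_def by blast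
    show "x \<otimes>\<^bsub>P\<^esub> y \<in> S"
    proof (rule S_I)
      show "x \<otimes>\<^bsub>P\<^esub> y \<in> carrier P" using x(1) y(1) by simp
      show "c \<otimes>\<^bsub>H\<^esub> d \<in> carrier H" using x(2) y(2) by simp
      show "eventually (\<lambda>i. (x \<otimes>\<^bsub>P\<^esub> y) i = (c \<otimes>\<^bsub>H\<^esub> d) \<otimes>\<^bsub>H\<^esub> w [^]\<^bsub>H\<^esub> ((j + k) * sq_fact i)) U"
        using x(3) y(3)
        by eventually_elim (use x(2) y(2) in \<open>simp add: mult_P distrib_right H.int_pow_mult H.m_ac\<close>)
    qed
  qed
  define x where "x = (\<lambda>i. w [^]\<^bsub>H\<^esub> (fact i :: int))"
  have x: "x \<in> carrier P" by (simp add: x_def carrier_P)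
  have avoid: "x [^]\<^bsub>P\<^esub> k \<notin> S" if k: "k > 0" for k :: int
  proof
    assume "x [^]\<^bsub>P\<^esub> k \<in> S"
    then obtain c and j :: int where c: "c \<in> carrier H"
      and ev: "eventually (\<lambda>i. (x [^]\<^bsub>P\<^esub> k) i = c \<otimes>\<^bsub>H\<^esub> w [^]\<^bsub>H\<^esub> (j * sq_fact i)) U"
      by (auto simp: S_def)
    have c_eq: "w [^]\<^bsub>H\<^esub> (fact i * k - j * sq_fact i) = c"
      if "(x [^]\<^bsub>P\<^esub> k) i = c \<otimes>\<^bsub>H\<^esub> w [^]\<^bsub>H\<^esub> (j * sq_fact i)" for i
      using that c unfolding pow_P[OF x] by (simp add: x_def H.int_pow_pow H.int_pow_diff H.m_assoc)
    \<comment> \<open>Two indices with the same \<open>c\<close> force \<open>k\<close> to be a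
      multiple of i'! + i!. The bound 1 avoids 0! = 1!, so that the factorials differ, and the bound
      on \<open>i'\<close> makes i'! exceed \<open>k\<close>.\<close>
    obtain i where i: "i \<ge> 1" "(x [^]\<^bsub>P\<^esub> k) i = c \<otimes>\<^bsub>H\<^esub> w [^]\<^bsub>H\<^esub> (j * sq_fact i)"
      using eventually_ex_ge[OF ev] by blast
    obtain i' where i': "i' \<ge> Suc i + nat k" "(x [^]\<^bsub>P\<^esub> k) i' = c \<otimes>\<^bsub>H\<^esub> w [^]\<^bsub>H\<^esub> (j * sq_fact i')"
      using eventually_ex_ge[OF ev] by blast
    have "fact i * k - j * sq_fact i = fact i' * k - j * sq_fact i'"
      by (rule w_pow_inj) (simp only: c_eq[OF i(2)] c_eq[OF i'(2)])
    then have "(fact i' - fact i) * (k - j * (fact i' + fact i)) = (0 :: int)"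
      by (simp add: sq_fact_def power2_eq_square algebra_simps)
    moreover have "(fact i :: int) < fact i'" using i(1) i'(1) by (intro fact_less_mono) auto
    ultimately have "k = j * (fact i' + fact i)" by simp
    then have "fact i' + fact i dvd k" by simp
    then have "fact i' + fact i \<le> k" using k by (rule zdvd_imp_le)
    moreover have "k < int i'" using i'(1) by linarith
    moreover have "int i' \<le> fact i'" using fact_ge_self[of i'] by (metis of_nat_fact of_nat_le_iff)
    moreover have "(0 :: int) < fact i" by simp
    ultimately show False by linarith
  qed
  obtain l :: "(nat \<Rightarrow> 'b) \<Rightarrow> rat" where
    l: "\<And>y z. y \<in> carrier P \<Longrightarrow> z \<in> carrier P \<Longrightarrow> l (y \<otimes>\<^bsub>P\<^esub> z) = l y + l z"
      "\<And>s. s \<in> S \<Longrightarrow> l s = 0" "l x = 1"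
    using P.hom_to_rat[OF S x avoid] by blast
  show ?thesis
  proof (rule that)
    show "l (\<lambda>i. x i \<otimes>\<^bsub>H\<^esub> y i) = l x + l y"
      if "\<And>i. x i \<in> carrier H" "\<And>i. y i \<in> carrier H" for x y
      using l(1)[of x y] that by (simp add: carrier_P mult_P)
    show "l x = 0" if "\<And>i. x i \<in> carrier H" "c \<in> carrier H"
        "eventually (\<lambda>i. x i = c \<otimes>\<^bsub>H\<^esub> w [^]\<^bsub>H\<^esub> (j * sq_fact i)) U" for x c and j :: int
      by (rule l(2)[OF S_I[OF _ that(2,3)]]) (simp add: carrier_P that(1))
    show "l (\<lambda>i. w [^]\<^bsub>H\<^esub> (fact i :: int)) = 1" using l(3) by (simp only: x_def)
  qed
qed

lemma twist_ultra_auto: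
  "\<exists>T. ultra_auto U group_language (group_structure G) T \<and>
    (\<forall>x. (\<forall>i. x i \<in> carrier G \<and> \<delta> (x i) = \<one>\<^bsub>H\<^esub>) \<longrightarrow> T x x) \<and>
    T (\<lambda>i. z [^] (fact i :: int)) (\<lambda>i. z [^] (fact i + sq_fact i))"
proof (rule twist_hom)
  fix l :: "(nat \<Rightarrow> 'b) \<Rightarrow> rat"
  assume add: "\<And>x y. (\<And>i. x i \<in> carrier H) \<Longrightarrow> (\<And>i. y i \<in> carrier H) \<Longrightarrow>
        l (\<lambda>i. x i \<otimes>\<^bsub>H\<^esub> y i) = l x + l y"
    and kill: "\<And>x c j. (\<And>i. x i \<in> carrier H) \<Longrightarrow> c \<in> carrier H \<Longrightarrow>
        eventually (\<lambda>i. x i = c \<otimes>\<^bsub>H\<^esub> w [^]\<^bsub>H\<^esub> (j * sq_fact i)) U \<Longrightarrow> l x = 0"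
    and one: "l (\<lambda>i. w [^]\<^bsub>H\<^esub> (fact i :: int)) = 1"
  have l_const: "l (\<lambda>_. c) = 0" if "c \<in> carrier H" for c
    by (rule kill[of _ c 0]) (simp_all add: that)
  have l_inv: "l (\<lambda>i. inv\<^bsub>H\<^esub> x i) = - l x" if "\<And>i. x i \<in> carrier H" for x
    using add[of x "\<lambda>i. inv\<^bsub>H\<^esub> x i"] l_const[of "\<one>\<^bsub>H\<^esub>"] that by simp
  have l_cong: "l x = l y" if "\<And>i. x i \<in> carrier H" "\<And>i. y i \<in> carrier H" "eventually (\<lambda>i. x i = y i) U" for x y
  proof -
    have "l (\<lambda>i. x i \<otimes>\<^bsub>H\<^esub> inv\<^bsub>H\<^esub> y i) = 0"
    proof (rule kill)
      show "eventually (\<lambda>i. x i \<otimes>\<^bsub>H\<^esub> inv\<^bsub>H\<^esub> y i = \<one>\<^bsub>H\<^esub> \<otimes>\<^bsub>H\<^esub> w [^]\<^bsub>H\<^esub> (0 * sq_fact i)) U"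
        using that(3) by eventually_elim (simp add: that(2))
    qed (simp_all add: that)
    then show ?thesis using add[of x "\<lambda>i. inv\<^bsub>H\<^esub> y i"] l_inv[of y] that by simp
  qed
  have l_pow: "l (\<lambda>i. x i [^]\<^bsub>H\<^esub> n) = of_nat n * l x" if "\<And>i. x i \<in> carrier H" for x and n :: nat
  proof (induction n)
    case (Suc n)
    then show ?case
      using add[of "\<lambda>i. x i [^]\<^bsub>H\<^esub> n" x] that by (simp add: algebra_simps)
  qed (simp add: l_const)
  have l_expo: "l (\<lambda>i. w [^]\<^bsub>H\<^esub> expo q i) = 0" for q
  proof -
    obtain p d where q: "q = Rat.Fract p d" "d > 0" by (cases q) auto
    \<comment> \<open>For \<open>q = p / d\<close> the \<open>d\<close>-th power is eventually a
      power of w^M with the standard exponent \<open>p\<close>, hence killed; the rationals have no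
      torsion.\<close>
    have "l (\<lambda>i. (w [^]\<^bsub>H\<^esub> expo q i) [^]\<^bsub>H\<^esub> nat d) = 0"
    proof (rule kill)
      show "eventually (\<lambda>i. (w [^]\<^bsub>H\<^esub> expo q i) [^]\<^bsub>H\<^esub> nat d = \<one>\<^bsub>H\<^esub> \<otimes>\<^bsub>H\<^esub> w [^]\<^bsub>H\<^esub> (p * sq_fact i)) U"
        using eventually_of_sequentially[OF expo_exact[of q]]
      proof eventually_elim
        case (elim i)
        then have "(of_int (expo q i * d) :: rat) = of_int (p * sq_fact i)"
          using q by (simp add: Rat.Fract_of_int_quotient)
        then have "expo q i * d = p * sq_fact i" by (simp only: of_int_eq_iff)
        then have "(w [^]\<^bsub>H\<^esub> expo q i) [^]\<^bsub>H\<^esub> int (nat d) = w [^]\<^bsub>H\<^esub> (p * sq_fact i)"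
          using q(2) by (simp add: H.int_pow_pow)
        then show ?case unfolding int_pow_int by simp
      qed
    qed simp_all
    then show ?thesis using l_pow[of "\<lambda>i. w [^]\<^bsub>H\<^esub> expo q i" "nat d"] q(2) by simp
  qed
  define L where "L x = l (\<lambda>i. \<delta> (x i))" for x
  have L_const: "L (\<lambda>_. c) = 0" if "c \<in> carrier G" for c
    using that by (simp add: L_def l_const)
  have L_mult: "L (\<lambda>i. x i \<otimes> y i) = L x + L y"
    if "\<And>i. x i \<in> carrier G" "\<And>i. y i \<in> carrier G" for x y
    using that by (simp add: L_def add)
  have L_inv: "L (\<lambda>i. inv (x i)) = - L x" if "\<And>i. x i \<in> carrier G" for x
    using that by (simp add: L_def l_inv)
  have L_cong: "L x = L y" if "\<And>i. x i \<in> carrier G" "\<And>i. y i \<in> carrier G" "eventually (\<lambda>i. x i = y i) U" for x y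
    unfolding L_def
  proof (rule l_cong)
    show "eventually (\<lambda>i. \<delta> (x i) = \<delta> (y i)) U" using that(3) by eventually_elim simp
  qed (simp_all add: that)
  \<comment> \<open>Twisting does not change \<open>L\<close>, since \<open>l\<close> kills the
    powers of \<open>w\<close> that are multiplied in. So the exponent can be computed from the
    image as well, which makes the twist injective and onto.\<close>
  have L_shift: "L y = L x" if xy: "\<And>i. x i \<in> carrier G" "\<And>i. y i \<in> carrier G"
    and ev: "eventually (\<lambda>i. y i = z [^] expo q i \<otimes> x i) U" for x y q
  proof -
    have "L y = L (\<lambda>i. z [^] expo q i \<otimes> x i)" by (rule L_cong[OF xy(2) _ ev]) (simp add: xy)
    also have "\<dots> = L (\<lambda>i. z [^] expo q i) + L x" by (rule L_mult) (simp_all add: xy)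
    also have "L (\<lambda>i. z [^] expo q i) = 0" by (simp add: L_def hom_int_pow l_expo)
    finally show ?thesis by simp
  qed
  have cancel: "x = z [^] (- k) \<otimes> y" if "y = z [^] k \<otimes> x" "x \<in> carrier G" for x y and k :: int
    using that by (simp add: G.int_pow_neg flip: G.m_assoc)
  define T where "T x y \<longleftrightarrow> (\<forall>i. x i \<in> carrier G) \<and> (\<forall>i. y i \<in> carrier G) \<and>
    eventually (\<lambda>i. y i = z [^] expo (L x) i \<otimes> x i) U" for x y
  have TI: "T x y" if "\<And>i. x i \<in> carrier G" "\<And>i. y i \<in> carrier G"
    "eventually (\<lambda>i. y i = z [^] expo (L x) i \<otimes> x i) U" for x y
    using that by (simp add: T_def)
  have TD: "x i \<in> carrier G" "y i \<in> carrier G" "eventually (\<lambda>i. y i = z [^] expo (L x) i \<otimes> x i) U"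
    if "T x y" for x y i
    using that by (simp_all add: T_def)
  have TL: "L y = L x" if "T x y" for x y by (rule L_shift[OF TD[OF that]])
  have T_const: "T (\<lambda>_. c) (\<lambda>_. c)" if "c \<in> carrier G" for c
    by (rule TI) (simp_all add: that L_const)
  have T_mult: "T (\<lambda>i. x i \<otimes> x' i) (\<lambda>i. y i \<otimes> y' i)" if T: "T x y" "T x' y'" for x x' y y'
  proof (rule TI)
    note c = TD(1,2)[OF T(1)] TD(1,2)[OF T(2)]
    have L: "L (\<lambda>i. x i \<otimes> x' i) = L x + L x'" by (rule L_mult) (simp_all add: c)
    show "eventually (\<lambda>i. y i \<otimes> y' i = z [^] expo (L (\<lambda>i. x i \<otimes> x' i)) i \<otimes> (x i \<otimes> x' i)) U"
      using TD(3)[OF T(1)] TD(3)[OF T(2)] eventually_of_sequentially[OF expo_add[of "L x" "L x'"]]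
    proof eventually_elim
      case (elim i)
      have "y i \<otimes> y' i = z [^] expo (L x) i \<otimes> (x i \<otimes> z [^] expo (L x') i) \<otimes> x' i"
        using c by (simp add: elim G.m_assoc)
      also have "x i \<otimes> z [^] expo (L x') i = z [^] expo (L x') i \<otimes> x i" using c by (simp add: central_pow)
      finally show ?case using c by (simp add: L elim G.int_pow_mult G.m_assoc)
    qed
  qed (simp_all add: TD(1,2)[OF T(1)] TD(1,2)[OF T(2)])
  have T_inv: "T (\<lambda>i. inv (x i)) (\<lambda>i. inv (y i))" if T: "T x y" for x y
  proof (rule TI)
    note c = TD(1,2)[OF T]
    have L: "L (\<lambda>i. inv (x i)) = - L x" by (rule L_inv) (simp add: c)
    show "eventually (\<lambda>i. inv (y i) = z [^] expo (L (\<lambda>i. inv (x i))) i \<otimes> inv (x i)) U"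
      using TD(3)[OF T] eventually_of_sequentially[OF expo_uminus[of "L x"]]
    proof eventually_elim
      case (elim i)
      have "inv (y i) = inv (x i) \<otimes> z [^] (- expo (L x) i)"
        using c by (simp add: elim(1) G.inv_mult_group G.int_pow_neg)
      then show ?case using c by (simp add: L elim(2) central_pow)
    qed
  qed (simp_all add: TD(1,2)[OF T])
  have struct [simp]: "universe (group_structure G) = carrier G"
    "fun_interp (group_structure G) Group_One xs = \<one>"
    "fun_interp (group_structure G) Group_Inv xs = inv (xs ! 0)"
    "fun_interp (group_structure G) Group_Mult xs = xs ! 0 \<otimes> xs ! 1" for xs
    by (simp_all add: group_structure_def)
  have "ultra_auto U group_language (group_structure G) T"
  proof (intro ultra_auto.intro ultra_auto_axioms.intro)
    show "nonprincipal_ultrafilter U" by unfold_locales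
    show "universe (group_structure G) \<noteq> {}" using z by auto
    show "x i \<in> universe (group_structure G)" "y i \<in> universe (group_structure G)" if "T x y" for x y i
      using TD(1,2)[OF that] by simp_all
    show "T (\<lambda>_. c) (\<lambda>_. c)" if "c \<in> universe (group_structure G)" for c
      using that by (simp add: T_const)
    show "\<exists>y. T x y" if "\<And>i. x i \<in> universe (group_structure G)" for x
    proof -
      have "T x (\<lambda>i. z [^] expo (L x) i \<otimes> x i)" by (rule TI) (use that in simp_all)
      then show ?thesis by blast
    qed
    show "\<exists>x. T x y" if "\<And>i. y i \<in> universe (group_structure G)" for y
    proof -
      have y: "\<And>i. y i \<in> carrier G" using that by simp
      \<comment> \<open>The inverse twist, with the exponent read off \<open>y\<close>.\<close>
      define x where "x i = z [^] (- expo (L y) i) \<otimes> y i" for i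
      have x: "\<And>i. x i \<in> carrier G" using y by (simp add: x_def)
      have "eventually (\<lambda>i. x i = z [^] expo (- L y) i \<otimes> y i) U"
        using eventually_of_sequentially[OF expo_uminus[of "L y"]] by eventually_elim (simp add: x_def)
      then have "L x = L y" by (rule L_shift[OF y x])
      then have "T x y"
        using y by (intro TI x) (simp_all add: x_def G.int_pow_neg flip: G.m_assoc)
      then show ?thesis by blast
    qed
    show "eventually (\<lambda>i. y i = y' i) U"
      if T: "T x y" "T x' y'" and ev: "eventually (\<lambda>i. x i = x' i) U" for x y x' y'
    proof -
      have L: "L x = L x'" by (rule L_cong[OF TD(1)[OF T(1)] TD(1)[OF T(2)] ev])
      from TD(3)[OF T(1)] TD(3)[OF T(2)] ev show ?thesis by eventually_elim (simp add: L)
    qed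
    show "eventually (\<lambda>i. x i = x' i) U"
      if T: "T x y" "T x' y'" and ev: "eventually (\<lambda>i. y i = y' i) U" for x y x' y'
    proof -
      have L: "L x = L x'"
        using L_cong[OF TD(2)[OF T(1)] TD(2)[OF T(2)] ev] TL[OF T(1)] TL[OF T(2)] by simp
      show ?thesis using TD(3)[OF T(1)] TD(3)[OF T(2)] ev
      proof eventually_elim
        case (elim i)
        have "z [^] expo (L x) i \<otimes> x i = z [^] expo (L x) i \<otimes> x' i" using elim L by simp
        then show ?case using TD(1)[OF T(1)] TD(1)[OF T(2)] by simp
      qed
    qed
  next
    fix f xs ys
    assume f: "fun_arity group_language f = Some (length xs)" and xy: "list_all2 T xs ys"
    show "T (\<lambda>i. fun_interp (group_structure G) f (map (\<lambda>x. x i) xs))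
        (\<lambda>i. fun_interp (group_structure G) f (map (\<lambda>y. y i) ys))"
    proof (cases f)
      case Group_One
      then show ?thesis by (simp add: T_const)
    next
      case Group_Inv
      then have "length xs = Suc 0" using f by (simp add: group_language_def)
      then obtain x where xs: "xs = [x]" by (auto simp: length_Suc_conv)
      with xy obtain y where "ys = [y]" "T x y" by (auto simp: list_all2_Cons1)
      then show ?thesis using T_inv by (simp add: xs Group_Inv)
    next
      case Group_Mult
      then have "length xs = Suc (Suc 0)" using f by (simp add: group_language_def)
      then obtain x x' where xs: "xs = [x, x']" by (auto simp: length_Suc_conv)
      with xy obtain y y' where "ys = [y, y']" "T x y" "T x' y'" by (auto simp: list_all2_Cons1)
      then show ?thesis using T_mult by (simp add: xs Group_Mult)
    qed
  qed (simp_all add: group_language_def)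
  moreover have "T x x" if "\<And>i. x i \<in> carrier G" "\<And>i. \<delta> (x i) = \<one>\<^bsub>H\<^esub>" for x
  proof (rule TI)
    have "L x = 0" by (simp add: L_def that(2) l_const)
    then show "eventually (\<lambda>i. x i = z [^] expo (L x) i \<otimes> x i) U" by (simp add: that(1))
  qed (simp_all add: that(1))
  \<comment> \<open>Here \<open>L\<close> is 1, so the exponent grows by exactly
    \<open>sq_fact i\<close>.\<close>
  moreover have "T (\<lambda>i. z [^] (fact i :: int)) (\<lambda>i. z [^] (fact i + sq_fact i))"
  proof (rule TI)
    have "L (\<lambda>i. z [^] (fact i :: int)) = 1" by (simp add: L_def hom_int_pow one)
    then show "eventually (\<lambda>i. z [^] (fact i + sq_fact i) =
        z [^] expo (L (\<lambda>i. z [^] (fact i :: int))) i \<otimes> z [^] (fact i :: int)) U"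
      by (simp add: G.int_pow_mult add.commute[of "fact _"])
  qed simp_all
  ultimately show ?thesis by (intro exI[of _ T] conjI allI impI) simp_all
qed

end

section \<open>Powers in a group interpreted in the integers are definable\<close>

lemma is_structure_Zs: "is_structure ring_language Zs"
  unfolding Zs_def by (intro is_structure_ring cring.axioms(1) int_is_cring)

text \<open>\<open>B\<close> stands for the copy of the integers inside the group. How it is
  interpreted there is irrelevant for coordinates, so only the isomorphism \<open>g\<close> is
  kept.\<close>

locale group_in_int_copy = group G for G :: "('a, 'm) monoid_scheme" (structure) +
  fixes \<Delta> :: "(group_symbol, unit, ring_symbol, unit) code" and ps :: "int list"
    and B :: "(ring_symbol, unit, 'b) fo_structure" and g :: "int \<Rightarrow> 'b" and \<alpha> :: "'a \<Rightarrow> 'b list set"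
  assumes code: "is_code group_language ring_language (length ps) \<Delta>"
    and admissible: "admissible group_language \<Delta> Zs ps"
    and g: "structure_iso ring_language Zs B g"
    and \<alpha>: "structure_iso group_language (group_structure G) (interpreted \<Delta> B (map g ps)) \<alpha>"
begin

abbreviation "k \<equiv> code_dim \<Delta>"
abbreviation "D \<equiv> code_dom \<Delta> B (map g ps)"
abbreviation "R \<equiv> code_rel \<Delta> B (map g ps)"
abbreviation "D0 \<equiv> code_dom \<Delta> Zs ps"
abbreviation "R0 \<equiv> code_rel \<Delta> Zs ps"
abbreviation "mult_fm \<equiv> fun_fm \<Delta> Group_Mult"

lemma bij_g: "bij_betw g UNIV (universe B)" using g by (simp add: structure_iso_def)

lemma holds_g:
  assumes "is_formula ring_language (length ps + length xs) \<phi>"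
  shows "holds B \<phi> (map g ps @ map g xs) \<longleftrightarrow> holds Zs \<phi> (ps @ xs)"
  using holds_iso[OF is_structure_Zs g, of "ps @ xs" \<phi>] assms by simp

lemma tuples_B: "ys \<in> tuples j (universe B) \<longleftrightarrow> (\<exists>xs. length xs = j \<and> ys = map g xs)"
proof
  assume "ys \<in> tuples j (universe B)"
  then have "length ys = j" "set ys \<subseteq> range g" using bij_g by (auto simp: tuples_def bij_betw_def)
  then show "\<exists>xs. length xs = j \<and> ys = map g xs"
    by (intro exI[of _ "map (inv_into UNIV g) ys"]) (auto simp: f_inv_into_f subset_iff intro!: map_idI[symmetric])
next
  assume "\<exists>xs. length xs = j \<and> ys = map g xs"
  then show "ys \<in> tuples j (universe B)" using bij_betwE[OF bij_g] by (auto simp: tuples_def)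
qed

lemma map_g_D: "map g xs \<in> D \<longleftrightarrow> xs \<in> D0"
proof (cases "length xs = k")
  case True
  moreover have "map g xs \<in> tuples k (universe B)" using True tuples_B by blast
  ultimately show ?thesis using holds_g[of xs "dom_fm \<Delta>"] code
    by (simp add: code_dom_def is_code_def tuples_def)
qed (simp add: code_dom_def tuples_def)

lemma in_D: "ys \<in> D \<Longrightarrow> \<exists>xs. ys = map g xs \<and> xs \<in> D0"
  using tuples_B[of ys k] map_g_D by (auto simp: code_dom_def)

lemma length_D0: "xs \<in> D0 \<Longrightarrow> length xs = k"
  by (simp add: code_dom_def tuples_def)

lemma map_g_R: "(map g xs, map g ys) \<in> R \<longleftrightarrow> (xs, ys) \<in> R0"
proof (cases "xs \<in> D0 \<and> ys \<in> D0")
  case True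
  then have "holds B (eq_fm \<Delta>) (map g ps @ map g (xs @ ys)) \<longleftrightarrow> holds Zs (eq_fm \<Delta>) (ps @ xs @ ys)"
    using code length_D0[of xs] length_D0[of ys] by (intro holds_g) (simp add: is_code_def mult_2)
  with True show ?thesis by (simp add: code_rel_def map_g_D)
next
  case False
  then show ?thesis by (auto simp: code_rel_def map_g_D)
qed

lemma equiv_R0: "equiv D0 R0" using admissible by (simp add: admissible_def)

lemma R_D: "(xs, ys) \<in> R \<Longrightarrow> xs \<in> D \<and> ys \<in> D"
  by (simp add: code_rel_def)

text \<open>Admissibility is given over \<open>Zs\<close> with parameters \<open>ps\<close>; it is
  carried to \<open>B\<close> along \<open>g\<close>.\<close>

lemma equiv_R: "equiv D R"
proof (rule equivI)
  show "R \<subseteq> D \<times> D" using R_D by auto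
  show "refl_on D R"
  proof (rule refl_onI)
    fix x assume "x \<in> D"
    then obtain xs where x: "x = map g xs" "xs \<in> D0" using in_D by blast
    then have "(xs, xs) \<in> R0" using equiv_R0 by (simp add: equiv_def refl_on_def)
    then show "(x, x) \<in> R" by (simp add: x(1) map_g_R)
  qed
  show "sym R"
  proof (rule symI)
    fix x y assume xy: "(x, y) \<in> R"
    obtain xs ys where "x = map g xs" "y = map g ys" using R_D[OF xy] in_D by blast
    then show "(y, x) \<in> R" using xy equiv_R0 by (auto simp: map_g_R equiv_def dest: symD)
  qed
  show "trans R"
  proof (rule transI)
    fix x y z assume xy: "(x, y) \<in> R" and yz: "(y, z) \<in> R"
    obtain xs ys zs where eqs: "x = map g xs" "y = map g ys" "z = map g zs"
      using R_D[OF xy] R_D[OF yz] in_D by metis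
    have "trans R0" using equiv_R0 by (simp add: equiv_def)
    with xy yz show "(x, z) \<in> R" unfolding eqs map_g_R by (rule transD[rotated])
  qed
qed

lemma \<alpha>_class: "x \<in> carrier G \<Longrightarrow> \<alpha> x \<in> D // R"
  using \<alpha> by (auto simp: structure_iso_def bij_betw_def interpreted_def group_structure_def)

lemma \<alpha>_inj:
  assumes "x \<in> carrier G" "y \<in> carrier G" "\<alpha> x = \<alpha> y"
  shows "x = y"
proof -
  have "inj_on \<alpha> (carrier G)"
    using \<alpha> by (simp add: structure_iso_def bij_betw_def group_structure_def)
  then show ?thesis using assms by (simp add: inj_on_eq_iff)
qed

lemma \<alpha>_disjoint: "x \<in> carrier G \<Longrightarrow> y \<in> carrier G \<Longrightarrow> u \<in> \<alpha> x \<Longrightarrow> u \<in> \<alpha> y \<Longrightarrow> x = y"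
  by (rule \<alpha>_inj[OF _ _ quotient_class_eq[OF equiv_R \<alpha>_class \<alpha>_class]])

lemma arity_mult: "fun_arity group_language Group_Mult = Some 2"
  by (simp add: group_language_def)

lemma formula_dom: "is_formula ring_language (length ps + k) (dom_fm \<Delta>)"
  using code by (simp add: is_code_def)

lemma formula_mult: "is_formula ring_language (length ps + (k + (k + k))) mult_fm"
proof -
  have "is_formula ring_language (length ps + Suc 2 * k) mult_fm"
    using code arity_mult unfolding is_code_def by blast
  moreover have "length ps + Suc 2 * k = length ps + (k + (k + k))" by simp
  ultimately show ?thesis by (simp only:)
qed

text \<open>Coordinates pulled back along \<open>g\<close>, so that definability can be treated over
  \<open>Zs\<close> instead of \<open>B\<close>.\<close>

definition reps :: "'a \<Rightarrow> int list set" where "reps x = {xs. map g xs \<in> \<alpha> x}"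

lemma reps_D0: "x \<in> carrier G \<Longrightarrow> xs \<in> reps x \<Longrightarrow> xs \<in> D0"
  using quotient_class(1)[OF equiv_R \<alpha>_class, of x "map g xs"] by (simp add: reps_def map_g_D)

lemma in_\<alpha>: "x \<in> carrier G \<Longrightarrow> u \<in> \<alpha> x \<Longrightarrow> \<exists>xs. u = map g xs \<and> xs \<in> reps x"
  using in_D[OF quotient_class(1)[OF equiv_R \<alpha>_class]] by (auto simp: reps_def)

lemma reps_nonempty: "x \<in> carrier G \<Longrightarrow> reps x \<noteq> {}"
  using in_quotient_imp_non_empty[OF equiv_R \<alpha>_class] in_\<alpha> by blast

lemma reps_related: "x \<in> carrier G \<Longrightarrow> xs \<in> reps x \<Longrightarrow> ys \<in> reps x \<Longrightarrow> (xs, ys) \<in> R0"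
  using quotient_class(2)[OF equiv_R \<alpha>_class, of x "map g xs" "map g ys"] by (simp add: reps_def map_g_R)

text \<open>As the formula respects the code, any fixed representatives of the factors will do.
  Right multiplication by a fixed element thus becomes a relation of coordinates with constants
  \<open>as\<close>.\<close>

lemma reps_mult:
  assumes x: "x \<in> carrier G" and a: "a \<in> carrier G" and xs: "xs \<in> reps x" and as: "as \<in> reps a"
  shows "zs \<in> reps (x \<otimes> a) \<longleftrightarrow> zs \<in> D0 \<and> holds Zs mult_fm (ps @ xs @ as @ zs)"
proof -
  have lx: "length xs = k" and la: "length as = k"
    using reps_D0[OF x xs] reps_D0[OF a as] by (simp_all add: length_D0)
  have transfer: "holds B mult_fm (map g ps @ map g us @ map g vs @ map g zs) \<longleftrightarrow>
      holds Zs mult_fm (ps @ us @ vs @ zs)"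
    if "length us = k" "length vs = k" "length zs = k" for us vs zs
    using holds_g[of "us @ vs @ zs" mult_fm] formula_mult that by simp
  have resp: "respects_code \<Delta> Zs ps (Suc 2) mult_fm"
    using admissible arity_mult unfolding admissible_def by blast
  have "\<forall>xs\<in>tuples 2 (universe (group_structure G)).
      \<alpha> (fun_interp (group_structure G) Group_Mult xs) =
      fun_interp (interpreted \<Delta> B (map g ps)) Group_Mult (map \<alpha> xs)"
    using \<alpha> arity_mult unfolding structure_iso_def by blast
  from bspec[OF this, of "[x, a]"] x a
  have "\<alpha> (x \<otimes> a) = fun_interp (interpreted \<Delta> B (map g ps)) Group_Mult [\<alpha> x, \<alpha> a]"
    by (simp add: group_structure_def tuples_def)
  also have "\<dots> = {ys \<in> D. \<exists>xss. list_all2 (\<in>) xss [\<alpha> x, \<alpha> a] \<and> holds B mult_fm (map g ps @ concat xss @ ys)}"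
    by (simp add: interpreted_def)
  finally have \<alpha>_mult: "\<alpha> (x \<otimes> a) = \<dots>" .
  have split: "(\<exists>xss. list_all2 (\<in>) xss [\<alpha> x, \<alpha> a] \<and> P (concat xss)) \<longleftrightarrow>
      (\<exists>us vs. us \<in> \<alpha> x \<and> vs \<in> \<alpha> a \<and> P (us @ vs))" for P :: "'b list \<Rightarrow> bool"
  proof
    assume "\<exists>xss. list_all2 (\<in>) xss [\<alpha> x, \<alpha> a] \<and> P (concat xss)"
    then obtain xss where xss: "list_all2 (\<in>) xss [\<alpha> x, \<alpha> a]" "P (concat xss)" by blast
    then obtain us vs where "xss = [us, vs]" "us \<in> \<alpha> x" "vs \<in> \<alpha> a"
      by (auto simp: list_all2_Cons2)
    then show "\<exists>us vs. us \<in> \<alpha> x \<and> vs \<in> \<alpha> a \<and> P (us @ vs)"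
      using xss(2) by (intro exI[of _ us] exI[of _ vs]) simp
  next
    assume "\<exists>us vs. us \<in> \<alpha> x \<and> vs \<in> \<alpha> a \<and> P (us @ vs)"
    then obtain us vs where "us \<in> \<alpha> x" "vs \<in> \<alpha> a" "P (us @ vs)" by blast
    then show "\<exists>xss. list_all2 (\<in>) xss [\<alpha> x, \<alpha> a] \<and> P (concat xss)"
      by (intro exI[of _ "[us, vs]"]) simp
  qed
  have "zs \<in> reps (x \<otimes> a) \<longleftrightarrow> zs \<in> D0 \<and>
      (\<exists>us vs. us \<in> \<alpha> x \<and> vs \<in> \<alpha> a \<and> holds B mult_fm (map g ps @ us @ vs @ map g zs))"
    using split[of "\<lambda>u. holds B mult_fm (map g ps @ u @ map g zs)"]
    by (simp add: reps_def map_g_D \<alpha>_mult)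
  also have "\<dots> \<longleftrightarrow> zs \<in> D0 \<and> holds Zs mult_fm (ps @ xs @ as @ zs)"
  proof (intro conj_cong refl iffI)
    assume zs: "zs \<in> D0" and "\<exists>us vs. us \<in> \<alpha> x \<and> vs \<in> \<alpha> a \<and> holds B mult_fm (map g ps @ us @ vs @ map g zs)"
    then obtain us vs where us: "us \<in> reps x" "vs \<in> reps a"
      and h: "holds B mult_fm (map g ps @ map g us @ map g vs @ map g zs)"
      using in_\<alpha> x a by metis
    have "(zs, zs) \<in> R0" using zs equiv_R0 by (simp add: equiv_def refl_on_def)
    then have "list_all2 (\<lambda>xs ys. (xs, ys) \<in> R0) [us, vs, zs] [xs, as, zs]"
      using reps_related[OF x us(1) xs] reps_related[OF a us(2) as] by simp
    moreover have "length [us, vs, zs] = Suc 2" by simp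
    ultimately have "holds Zs mult_fm (ps @ concat [us, vs, zs]) \<longleftrightarrow> holds Zs mult_fm (ps @ concat [xs, as, zs])"
      using resp unfolding respects_code_def by blast
    moreover have "length us = k" "length vs = k" "length zs = k"
      using length_D0 reps_D0[OF x us(1)] reps_D0[OF a us(2)] zs by simp_all
    ultimately show "holds Zs mult_fm (ps @ xs @ as @ zs)" using h transfer by simp
  next
    assume "zs \<in> D0" "holds Zs mult_fm (ps @ xs @ as @ zs)"
    then have "holds B mult_fm (map g ps @ map g xs @ map g as @ map g zs)"
      using transfer[OF lx la] by (simp add: length_D0)
    then show "\<exists>us vs. us \<in> \<alpha> x \<and> vs \<in> \<alpha> a \<and> holds B mult_fm (map g ps @ us @ vs @ map g zs)"
      using xs as by (auto simp: reps_def)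
  qed
  finally show ?thesis .
qed

text \<open>The pairs of coordinates of (a^m, b^m) are reached from those of (1, 1) by multiplying
  by \<open>a\<close> and \<open>b\<close> simultaneously. Distinct powers of \<open>a\<close> make
  the stages disjoint, and at least one step is taken, whence the exponents
  \<open>Suc m\<close>.\<close>

lemma powers_definable:
  assumes a: "a \<in> carrier G" and b: "b \<in> carrier G"
    and inj: "\<And>m m'. a [^] (m :: nat) = a [^] (m' :: nat) \<Longrightarrow> m = m'"
  shows "definable_pred (\<lambda>e. \<exists>m. map e [0..<k] \<in> reps (a [^] Suc m) \<and> map e [k..<k + k] \<in> reps (b [^] Suc m))"
proof -
  obtain as bs where as: "as \<in> reps a" and bs: "bs \<in> reps b" using reps_nonempty a b by blast
  define S where "S m = {xs @ ys | xs ys. xs \<in> reps (a [^] (m :: nat)) \<and> ys \<in> reps (b [^] m)}" for m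
  \<comment> \<open>A pair is one list of length \<open>k + k\<close>; its halves are multiplied by
    \<open>a\<close> and \<open>b\<close> through the fixed representatives \<open>as\<close> and
    \<open>bs\<close>.\<close>
  define N where "N p q \<longleftrightarrow> take k q \<in> D0 \<and> holds Zs mult_fm (ps @ take k p @ as @ take k q) \<and>
    drop k q \<in> D0 \<and> holds Zs mult_fm (ps @ drop k p @ bs @ drop k q)" for p q
  have len: "length xs = k" if "xs \<in> reps x" "x \<in> carrier G" for xs x
    using reps_D0[OF that(2,1)] by (rule length_D0)
  have S_iff: "q \<in> S m \<longleftrightarrow> take k q \<in> reps (a [^] m) \<and> drop k q \<in> reps (b [^] m)" if "length q = k + k" for q m
  proof
    assume "q \<in> S m"
    then obtain xs ys where "q = xs @ ys" "xs \<in> reps (a [^] m)" "ys \<in> reps (b [^] m)" by (auto simp: S_def)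
    then show "take k q \<in> reps (a [^] m) \<and> drop k q \<in> reps (b [^] m)" using len[of xs "a [^] m"] a by simp
  next
    assume "take k q \<in> reps (a [^] m) \<and> drop k q \<in> reps (b [^] m)"
    then show "q \<in> S m" unfolding S_def
      by (intro CollectI exI[of _ "take k q"] exI[of _ "drop k q"]) simp
  qed
  have S_len: "length p = k + k" if "p \<in> S m" for p m
    using that len a b by (auto simp: S_def)
  have "definable_pred (\<lambda>e. map e [0..<k + k] \<in> (\<Union>m. S (Suc m)))"
  proof (rule definable_reachable)
    show "S m \<noteq> {}" for m using reps_nonempty[of "a [^] m"] reps_nonempty[of "b [^] m"] a b by (auto simp: S_def)
    show "length p = k + k" if "p \<in> S m" for p m using S_len[OF that] .
    show "m = m'" if "p \<in> S m" "p \<in> S m'" for p m m'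
    proof -
      have "take k p \<in> reps (a [^] m)" "take k p \<in> reps (a [^] m')"
        using that S_iff[OF S_len[OF that(1)]] by simp_all
      then have "a [^] m = a [^] m'" using a by (intro \<alpha>_disjoint[of _ _ "map g (take k p)"]) (simp_all add: reps_def)
      then show ?thesis by (rule inj)
    qed
    show "N p q \<longleftrightarrow> q \<in> S (Suc m)" if p: "p \<in> S m" and q: "length q = k + k" for p q m
    proof -
      have "take k p \<in> reps (a [^] m)" "drop k p \<in> reps (b [^] m)"
        using p S_iff[OF S_len[OF p]] by simp_all
      then show ?thesis
        using reps_mult[OF _ a _ as, of "a [^] m" "take k p" "take k q"]
          reps_mult[OF _ b _ bs, of "b [^] m" "drop k p" "drop k q"] a b
        by (simp add: N_def S_iff[OF q])
    qed
    have dom: "definable_pred (\<lambda>e. map e [c..<c + k] \<in> D0)" for c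
    proof -
      have "definable_pred (\<lambda>e. holds Zs (dom_fm \<Delta>)
          (map (\<lambda>p. p e) (map (\<lambda>c e. c) ps @ map (\<lambda>v e. e v) [c..<c + k])))"
        by (rule definable_holds) (use formula_dom in \<open>auto intro: definable\<close>)
      then show ?thesis by (simp add: code_dom_def tuples_def o_def)
    qed
    have mult: "definable_pred (\<lambda>e. holds Zs mult_fm (ps @ map e [c..<c + k] @ cs @ map e [d..<d + k]))"
      if "length cs = k" for c d cs
    proof -
      have "definable_pred (\<lambda>e. holds Zs mult_fm (map (\<lambda>p. p e)
          (map (\<lambda>c e. c) ps @ map (\<lambda>v e. e v) [c..<c + k] @ map (\<lambda>c e. c) cs @ map (\<lambda>v e. e v) [d..<d + k])))"
        by (rule definable_holds) (use formula_mult that in \<open>auto intro: definable\<close>)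
      then show ?thesis by (simp add: o_def)
    qed
    have split: "take k (map e [c..<c + (k + k)]) = map e [c..<c + k]"
      "drop k (map e [c..<c + (k + k)]) = map e [c + k..<c + k + k]" for e :: "nat \<Rightarrow> int" and c
      by (simp_all add: take_map drop_map add.assoc)
    have "definable_pred (\<lambda>e. N (map e [0..<0 + (k + k)]) (map e [k + k..<k + k + (k + k)]))"
      unfolding N_def split
      by (intro definable_conj dom mult len[OF as a] len[OF bs b])
    then show "definable_pred (\<lambda>e. N (map e [0..<k + k]) (map e [k + k..<2 * (k + k)]))"
      by (simp add: mult_2)
  qed
  moreover have "map e [0..<k + k] \<in> (\<Union>m. S (Suc m)) \<longleftrightarrow>
      (\<exists>m. map e [0..<k] \<in> reps (a [^] Suc m) \<and> map e [k..<k + k] \<in> reps (b [^] Suc m))" for e :: "nat \<Rightarrow> int"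
    using S_iff[of "map e [0..<k + k]"] by (simp add: take_map drop_map)
  ultimately show ?thesis by simp
qed

end

section \<open>Compatibility of a definable copy with the automorphism\<close>

lemma concat_slice:
  "(\<And>xs. xs \<in> set xss \<Longrightarrow> length xs = d) \<Longrightarrow> j < length xss \<Longrightarrow> take d (drop (j * d) (concat xss)) = xss ! j"
proof (induction xss arbitrary: j)
  case (Cons xs xss)
  have l: "length xs = d" using Cons.prems(1) by simp
  show ?case
  proof (cases j)
    case (Suc i)
    then have "take d (drop (i * d) (concat xss)) = xss ! i" using Cons by simp
    then show ?thesis using l by (simp add: Suc)
  qed (simp add: l)
qed simp

lemma length_concat_uniform: "(\<And>xs. xs \<in> set xss \<Longrightarrow> length xs = d) \<Longrightarrow> length (concat xss) = length xss * d"
  by (induction xss) simp_all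

lemma tuple_rel_slice:
  assumes xy: "tuple_rel T n x y" and "b + d \<le> n"
  shows "tuple_rel T d (\<lambda>i. take d (drop b (x i))) (\<lambda>i. take d (drop b (y i)))"
proof (rule tuple_relI)
  fix j assume j: "j < d"
  then have "T (\<lambda>i. x i ! (b + j)) (\<lambda>i. y i ! (b + j))" using assms(2) by (intro tuple_relD(3)[OF xy]) simp
  moreover have "take d (drop b (x i)) ! j = x i ! (b + j)" "take d (drop b (y i)) ! j = y i ! (b + j)" for i
    using j assms(2) by (simp_all add: tuple_relD[OF xy])
  ultimately show "T (\<lambda>i. take d (drop b (x i)) ! j) (\<lambda>i. take d (drop b (y i)) ! j)" by simp
qed (use assms(2) in \<open>simp_all add: tuple_relD[OF xy]\<close>)

context interpreted_ultra_auto
begin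

lemma representatives_exist:
  assumes "Xs \<in> tuples k (universe I)"
  shows "\<exists>xss. list_all2 (\<in>) xss Xs"
proof -
  have "\<forall>X\<in>set Xs. \<exists>x. x \<in> X" using assms class_ne by (auto simp: tuples_def universe_I)
  then show ?thesis
    by (intro exI[of _ "map (\<lambda>X. SOME x. x \<in> X) Xs"]) (auto simp: list_all2_conv_all_nth intro: someI_ex)
qed

lemma representatives_tuples:
  assumes "list_all2 (\<in>) xss Xs" "Xs \<in> tuples k (universe I)" "xs \<in> set xss"
  shows "xs \<in> tuples d (universe M)"
proof -
  obtain j where j: "j < length xss" "xs = xss ! j" using assms(3) by (auto simp: in_set_conv_nth)
  have "j < length Xs" using j assms(1) by (simp add: list_all2_lengthD)
  then have "Xs ! j \<in> D // R" using assms(2) by (auto simp: tuples_def universe_I dest: nth_mem)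
  moreover have "xs \<in> Xs ! j" using assms(1) j by (simp add: list_all2_nthD)
  ultimately show ?thesis by (rule class_tuples)
qed

text \<open>The copy \<open>\<alpha>\<close> of \<open>M\<close> inside the structure interpreted in \<open>M\<close> is compatible with \<open>T\<close> and \<open>T'\<close>
  because its graph is definable.\<close>

lemma rep_graph_transfer:
  assumes graph: "definable L M (Suc (k * d)) (rep_graph (universe M) \<alpha>)"
    and classes: "\<forall>x\<in>universe M. \<alpha> x \<noteq> {} \<and> \<alpha> x \<subseteq> tuples k (universe I)"
    and uv: "T u v"
  shows "\<exists>Xs Ys. (\<forall>i. Xs i \<in> \<alpha> (u i)) \<and> eventually (\<lambda>i. Ys i \<in> \<alpha> (v i)) U \<and> tuple_rel T' k Xs Ys"
proof -
  have ne: "\<alpha> x \<noteq> {}" if "x \<in> universe M" for x using classes that by blast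
  have tup: "Xs \<in> tuples k (universe I)" if "x \<in> universe M" "Xs \<in> \<alpha> x" for x Xs using classes that by blast
  obtain \<phi> cs where cs: "set cs \<subseteq> universe M" and \<phi>: "is_formula L (length cs + Suc (k * d)) \<phi>"
    and graph_iff: "rep_graph (universe M) \<alpha> = {xs \<in> tuples (Suc (k * d)) (universe M). holds M \<phi> (cs @ xs)}"
    using graph by (auto simp: definable_def)
  note uM = in_universe1[OF uv] and vM = in_universe2[OF uv]
  have "\<forall>i. \<exists>Xs. Xs \<in> \<alpha> (u i)" using ne[OF uM] by blast
  then obtain Xs where Xs: "\<And>i. Xs i \<in> \<alpha> (u i)" by metis
  note Xs_tup = tup[OF uM Xs]
  have lXs: "length (Xs i) = k" for i using Xs_tup by (simp add: tuples_def)
  have "\<forall>i. \<exists>xss. list_all2 (\<in>) xss (Xs i)" using representatives_exist[OF Xs_tup] by blast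
  then obtain xss where xss: "\<And>i. list_all2 (\<in>) (xss i) (Xs i)" by metis
  have lxss: "length (xss i) = k" for i using list_all2_lengthD[OF xss] lXs by simp
  have xs_tup: "xs \<in> tuples d (universe M)" if "xs \<in> set (xss i)" for xs i
    by (rule representatives_tuples[OF xss Xs_tup that])
  have len_xs: "length xs = d" if "xs \<in> set (xss i)" for xs i
    using xs_tup[OF that] by (simp add: tuples_def)
  have "concat (xss i) \<in> tuples (k * d) (universe M)" for i
    using length_concat_uniform[of "xss i" d] len_xs[of _ i] lxss xs_tup[of _ i] by (auto simp: tuples_def)
  \<comment> \<open>Representatives of \<open>Xs i\<close> are flattened into one tuple over
    \<open>M\<close>, which is moved by \<open>T\<close> along with \<open>u\<close>; the graph
    formula then places the result over \<open>v\<close>.\<close>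
  from tuple_rel_total[of "\<lambda>i. concat (xss i)", OF this]
  obtain W where W: "tuple_rel T (k * d) (\<lambda>i. concat (xss i)) W" by blast
  have uW: "tuple_rel T (Suc (k * d)) (\<lambda>i. u i # concat (xss i)) (\<lambda>i. v i # W i)"
    by (rule tuple_rel_Cons[OF uv W])
  have "u i # concat (xss i) \<in> rep_graph (universe M) \<alpha>" for i
    unfolding rep_graph_def using uM Xs xss by blast
  then have "holds M \<phi> (cs @ (u i # concat (xss i)))" for i unfolding graph_iff by simp
  then have "eventually (\<lambda>i. holds M \<phi> (cs @ (v i # W i))) U"
    using holds_iff[OF \<phi> tuple_rel_append[OF tuple_rel_const[OF cs] uW]] by simp
  then have ev: "eventually (\<lambda>i. v i # W i \<in> rep_graph (universe M) \<alpha>) U"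
    by eventually_elim (use tuple_rel_tuples(2)[OF uW] in \<open>simp add: graph_iff\<close>)
  \<comment> \<open>\<open>W i\<close> has to be cut back into representatives of an element of the
    class of \<open>v i\<close>. This succeeds for \<open>U\<close>-almost all \<open>i\<close>;
    elsewhere \<open>Xs i\<close> is a dummy of the right length.\<close>
  define good where "good i Ys \<longleftrightarrow> Ys \<in> \<alpha> (v i) \<and> (\<exists>yss. W i = concat yss \<and> list_all2 (\<in>) yss Ys)" for i Ys
  define Ys where "Ys i = (if \<exists>Ys. good i Ys then SOME Ys. good i Ys else Xs i)" for i
  have good_Ys: "good i (Ys i)" if "\<exists>Ys. good i Ys" for i
    using that someI_ex[OF that] by (simp add: Ys_def)
  have good_ex: "\<exists>Ys. good i Ys" if "v i # W i \<in> rep_graph (universe M) \<alpha>" for i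
    using that by (auto simp: rep_graph_def good_def)
  have Ys_tup: "Ys i \<in> tuples k (universe I)" for i
  proof (cases "\<exists>Ys. good i Ys")
    case True
    then show ?thesis using good_Ys tup[OF vM] by (auto simp: good_def)
  next
    case False
    then show ?thesis using Xs_tup by (simp add: Ys_def)
  qed
  have "tuple_rel T' k Xs Ys"
  proof (rule tuple_relI)
    fix j assume j: "j < k"
    let ?x = "\<lambda>i. take d (drop (j * d) (concat (xss i)))" and ?y = "\<lambda>i. take d (drop (j * d) (W i))"
    have "j * d + d = Suc j * d" by simp
    also have "\<dots> \<le> k * d" using j by (intro mult_le_mono1) simp
    finally have "tuple_rel T d ?x ?y" by (rule tuple_rel_slice[OF W])
    moreover have "?x i \<in> Xs i ! j" for i
      using concat_slice[of "xss i" d j] len_xs[of _ i] j lxss list_all2_nthD[OF xss, of j] by simp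
    moreover have "eventually (\<lambda>i. ?y i \<in> Ys i ! j) U"
      using ev
    proof eventually_elim
      case (elim i)
      then obtain yss where yss: "W i = concat yss" "list_all2 (\<in>) yss (Ys i)"
        using good_Ys[OF good_ex] by (auto simp: good_def)
      have "length yss = k" using list_all2_lengthD[OF yss(2)] Ys_tup[of i] by (simp add: tuples_def)
      moreover have "length ys = d" if "ys \<in> set yss" for ys
        using representatives_tuples[OF yss(2) Ys_tup that] by (simp add: tuples_def)
      ultimately have "?y i = yss ! j" using concat_slice[of yss d j] j by (simp add: yss(1))
      then show ?case using list_all2_nthD[OF yss(2), of j] j \<open>length yss = k\<close> by simp
    qed
    moreover have "Xs i ! j \<in> D // R" "Ys i ! j \<in> D // R" for i
      using j Xs_tup[of i] Ys_tup[of i] by (auto simp: tuples_def universe_I dest: nth_mem)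
    ultimately show "T' (\<lambda>i. Xs i ! j) (\<lambda>i. Ys i ! j)"
      unfolding induced_def by (intro conjI allI exI[of _ ?x] exI[of _ ?y]) simp_all
  qed (use Xs_tup Ys_tup in \<open>simp_all add: tuples_def\<close>)
  moreover have "eventually (\<lambda>i. Ys i \<in> \<alpha> (v i)) U"
    using ev by eventually_elim (use good_Ys[OF good_ex] in \<open>simp add: good_def\<close>)
  ultimately show ?thesis using Xs by blast
qed

end

section \<open>Groups with a central element of infinite order modulo the kernel of a homomorphism\<close>

theorem not_bi_interpretable_int:
  fixes G :: "('a, 'm) monoid_scheme" and H :: "('b, 'n) monoid_scheme"
  assumes hom: "group_hom G H \<delta>" and comm: "comm_group H"
    and z: "z \<in> carrier G" and central: "\<And>x. x \<in> carrier G \<Longrightarrow> z \<otimes>\<^bsub>G\<^esub> x = x \<otimes>\<^bsub>G\<^esub> z"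
    and z_order: "\<And>k. k > 0 \<Longrightarrow> \<delta> z [^]\<^bsub>H\<^esub> (k :: int) \<noteq> \<one>\<^bsub>H\<^esub>"
    and a: "a \<in> carrier G" "\<delta> a = \<one>\<^bsub>H\<^esub>"
    and a_order: "\<And>m m'. a [^]\<^bsub>G\<^esub> (m :: nat) = a [^]\<^bsub>G\<^esub> (m' :: nat) \<Longrightarrow> m = m'"
  shows "\<not> bi_interpretable group_language (group_structure G) ring_language (ring_structure \<Z>)"
proof
  assume "bi_interpretable group_language (group_structure G) ring_language (ring_structure \<Z>)"
  then obtain \<Delta> ps \<Gamma> qs g \<alpha> where
    \<Delta>: "is_code group_language ring_language (length ps) \<Delta>" "admissible group_language \<Delta> Zs ps"
    and \<Gamma>: "set qs \<subseteq> universe (group_structure G)" "is_code ring_language group_language (length qs) \<Gamma>"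
      "admissible ring_language \<Gamma> (group_structure G) qs"
      "structure_iso ring_language Zs (interpreted \<Gamma> (group_structure G) qs) g"
    and \<alpha>: "structure_iso group_language (group_structure G)
        (interpreted \<Delta> (interpreted \<Gamma> (group_structure G) qs) (map g ps)) \<alpha>"
      "definable group_language (group_structure G) (Suc (code_dim \<Delta> * code_dim \<Gamma>))
        (rep_graph (universe (group_structure G)) \<alpha>)"
    unfolding bi_interpretable_def interpretation_via_def Zs_def by blast
  define B where "B = interpreted \<Gamma> (group_structure G) qs"
  obtain U where U: "nonprincipal_ultrafilter U" using nonprincipal_ultrafilter_exists by blast
  interpret group_hom G H \<delta> by (rule hom)
  interpret tw: central_twist U G H \<delta> z
    by (intro central_twist.intro central_twist_axioms.intro U hom comm z central z_order)
  obtain T where T: "ultra_auto U group_language (group_structure G) T"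
    and T_ker: "\<forall>x. (\<forall>i. x i \<in> carrier G \<and> \<delta> (x i) = \<one>\<^bsub>H\<^esub>) \<longrightarrow> T x x"
    and T_z: "T (\<lambda>i. z [^]\<^bsub>G\<^esub> (fact i :: int)) (\<lambda>i. z [^]\<^bsub>G\<^esub> (fact i + sq_fact i))"
    using tw.twist_ultra_auto by blast
  interpret GU: interpreted_ultra_auto U group_language "group_structure G" T ring_language \<Gamma> qs
    by (intro interpreted_ultra_auto.intro interpreted_ultra_auto_axioms.intro T \<Gamma>(1-3))
  interpret BU: ultra_auto U ring_language B GU.T' unfolding B_def by (rule GU.induced_ultra_auto)
  interpret C: group_in_int_copy G \<Delta> ps B g \<alpha>
    unfolding B_def
    by (intro group_in_int_copy.intro group_in_int_copy_axioms.intro G.is_group \<Delta> \<Gamma>(4) \<alpha>(1))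
  define k where "k = code_dim \<Delta>"
  have univ: "universe (group_structure G) = carrier G" by (simp add: group_structure_def)
  have "\<alpha> x \<noteq> {} \<and> \<alpha> x \<subseteq> tuples (code_dim \<Delta>) (universe GU.I)"
    if "x \<in> universe (group_structure G)" for x
  proof -
    have x: "x \<in> carrier G" using that by (simp add: univ)
    have "\<alpha> x \<noteq> {}" using C.reps_nonempty[OF x] by (auto simp: C.reps_def)
    moreover have "Xs \<in> tuples (code_dim \<Delta>) (universe GU.I)" if "Xs \<in> \<alpha> x" for Xs
      using quotient_class(1)[OF C.equiv_R C.\<alpha>_class[OF x] that] by (simp add: code_dom_def B_def)
    ultimately show ?thesis by blast
  qed
  then have "\<forall>x\<in>universe (group_structure G). \<alpha> x \<noteq> {} \<and> \<alpha> x \<subseteq> tuples (code_dim \<Delta>) (universe GU.I)"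
    by blast
  note transfer = GU.rep_graph_transfer[OF \<alpha>(2) this]
  \<comment> \<open>The definable relation has exponents \<open>Suc m\<close>, so i! is written as a
    successor.\<close>
  define m where "m i = (fact i - 1 :: nat)" for i
  have Suc_m: "Suc (m i) = fact i" for i by (simp add: m_def)
  have T_a: "T (\<lambda>i. a [^]\<^bsub>G\<^esub> Suc (m i)) (\<lambda>i. a [^]\<^bsub>G\<^esub> Suc (m i))"
    using T_ker by (simp add: a hom_nat_pow del: nat_pow_Suc)
  have T_b: "T (\<lambda>i. z [^]\<^bsub>G\<^esub> Suc (m i)) (\<lambda>i. z [^]\<^bsub>G\<^esub> (fact i + sq_fact i))"
    using T_z by (simp add: Suc_m flip: int_pow_int del: nat_pow_Suc)
  obtain Xs Xs' where X: "\<And>i. Xs i \<in> \<alpha> (a [^]\<^bsub>G\<^esub> Suc (m i))"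
    "eventually (\<lambda>i. Xs' i \<in> \<alpha> (a [^]\<^bsub>G\<^esub> Suc (m i))) U" "tuple_rel GU.T' k Xs Xs'"
    using transfer[OF T_a] unfolding k_def by blast
  obtain Ys Ys' where Y: "\<And>i. Ys i \<in> \<alpha> (z [^]\<^bsub>G\<^esub> Suc (m i))"
    "eventually (\<lambda>i. Ys' i \<in> \<alpha> (z [^]\<^bsub>G\<^esub> (fact i + sq_fact i))) U" "tuple_rel GU.T' k Ys Ys'"
    using transfer[OF T_b] unfolding k_def by blast
  obtain \<phi> where \<phi>: "formula_of_sig ring_language \<phi>"
    and sat_\<phi>: "\<And>e. sat Zs e \<phi> \<longleftrightarrow> (\<exists>m. map e [0..<k] \<in> C.reps (a [^]\<^bsub>G\<^esub> Suc m) \<and>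
      map e [k..<k + k] \<in> C.reps (z [^]\<^bsub>G\<^esub> Suc m))"
    using C.powers_definable[OF a(1) z a_order] unfolding definable_pred_def k_def by blast
  \<comment> \<open>\<open>BU.sat_iff\<close> wants related values for all variables; past
    \<open>k + k\<close> the constant \<open>g 0\<close> is related to itself.\<close>
  define E where "E P Q v i = (if v < k then P i ! v else if v < k + k then Q i ! (v - k) else g 0)"
    for P Q :: "nat \<Rightarrow> 'a list set list" and v i
  have E_T: "GU.T' (E Xs Ys v) (E Xs' Ys' v)" for v
  proof -
    consider "v < k" | "\<not> v < k" "v - k < k" "v < k + k" | "\<not> v < k" "\<not> v < k + k" by linarith
    then show ?thesis
    proof cases
      case 1
      then show ?thesis using tuple_relD(3)[OF X(3)] by (simp add: E_def[abs_def])
    next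
      case 2
      then show ?thesis using tuple_relD(3)[OF Y(3)] by (simp add: E_def[abs_def])
    next
      case 3
      then show ?thesis using BU.const bij_betwE[OF C.bij_g] by (simp add: E_def[abs_def])
    qed
  qed
  have E_sat: "sat B (\<lambda>v. E P Q v i) \<phi> \<longleftrightarrow>
      (\<exists>m. P i \<in> \<alpha> (a [^]\<^bsub>G\<^esub> Suc m) \<and> Q i \<in> \<alpha> (z [^]\<^bsub>G\<^esub> Suc m))"
    if E: "\<And>v. E P Q v i \<in> universe B" and len: "length (P i) = k" "length (Q i) = k" for P Q i
  proof -
    define e where "e v = inv_into UNIV g (E P Q v i)" for v
    have g_e: "g (e v) = E P Q v i" for v
      using E[of v] C.bij_g by (simp add: e_def bij_betw_def f_inv_into_f)
    have "map g (map e [0..<k]) = P i" "map g (map e [k..<k + k]) = Q i"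
      using len by (auto simp: g_e E_def intro!: nth_equalityI)
    then have "sat Zs e \<phi> \<longleftrightarrow> (\<exists>m. P i \<in> \<alpha> (a [^]\<^bsub>G\<^esub> Suc m) \<and> Q i \<in> \<alpha> (z [^]\<^bsub>G\<^esub> Suc m))"
      by (simp only: sat_\<phi> C.reps_def mem_Collect_eq)
    moreover have "sat B (\<lambda>v. g (e v)) \<phi> \<longleftrightarrow> sat Zs e \<phi>"
      by (rule sat_iso[OF is_structure_Zs C.g _ \<phi>]) simp
    ultimately show ?thesis by (simp only: g_e)
  qed
  have E_univ: "E Xs Ys v i \<in> universe B" "E Xs' Ys' v i \<in> universe B" for v i
    using BU.in_universe1[OF E_T] BU.in_universe2[OF E_T] by blast+
  have "sat B (\<lambda>v. E Xs Ys v i) \<phi>" for i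
    using E_sat[of Xs Ys i, OF E_univ(1) tuple_relD(1)[OF X(3)] tuple_relD(1)[OF Y(3)]] X(1) Y(1) by blast
  then have "eventually (\<lambda>i. sat B (\<lambda>v. E Xs' Ys' v i) \<phi>) U"
    using BU.sat_iff[of "E Xs Ys" "E Xs' Ys'" \<phi>, OF E_T \<phi>] by simp
  then have "eventually (\<lambda>i. False) U"
    using X(2) Y(2)
  proof eventually_elim
    case (elim i)
    then obtain n where n: "Xs' i \<in> \<alpha> (a [^]\<^bsub>G\<^esub> Suc n)" "Ys' i \<in> \<alpha> (z [^]\<^bsub>G\<^esub> Suc n)"
      using E_sat[of Xs' Ys' i, OF E_univ(2) tuple_relD(2)[OF X(3)] tuple_relD(2)[OF Y(3)]] by blast
    \<comment> \<open>The first component was fixed and pins the exponent down to i!, while the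
      second has become the power with exponent i! + (i!)^2.\<close>
    have "a [^]\<^bsub>G\<^esub> Suc n = a [^]\<^bsub>G\<^esub> Suc (m i)"
      by (rule C.\<alpha>_disjoint[OF _ _ n(1) elim(2)]) (simp_all add: a del: nat_pow_Suc)
    then have n_eq: "Suc n = fact i" using a_order Suc_m by metis
    have "z [^]\<^bsub>G\<^esub> Suc n = z [^]\<^bsub>G\<^esub> (fact i + sq_fact i)"
      by (rule C.\<alpha>_disjoint[OF _ _ n(2) elim(3)]) (simp_all add: z del: nat_pow_Suc)
    then have "z [^]\<^bsub>G\<^esub> (fact i :: int) = z [^]\<^bsub>G\<^esub> (fact i + sq_fact i)"
      by (simp add: n_eq flip: int_pow_int del: nat_pow_Suc)
    then have "\<delta> (z [^]\<^bsub>G\<^esub> (fact i :: int)) = \<delta> (z [^]\<^bsub>G\<^esub> (fact i + sq_fact i))" by simp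
    then have "fact i = fact i + sq_fact i" using z by (intro tw.w_pow_inj) (simp add: hom_int_pow)
    then show False by (simp add: sq_fact_def)
  qed
  then show False using tw.eventually_ex by blast
qed

section \<open>Algebraic integers form a ring\<close>

interpretation Z_module: Modules.module "\<lambda>(k :: int) (v :: 'a :: field_char_0). of_int k * v"
  by unfold_locales (simp_all add: algebra_simps)

text \<open>Multiplication by \<open>z\<close> is described by an integer matrix, of which the vector of all elements of
  \<open>B\<close> is an eigenvector with eigenvalue \<open>z\<close>.\<close>

lemma algebraic_int_if_stable:
  fixes z :: "'a :: field_char_0"
  assumes B: "finite B" "b0 \<in> B" "b0 \<noteq> 0"
    and stable: "\<And>b. b \<in> B \<Longrightarrow> z * b \<in> Z_module.span B"
  shows "algebraic_int z"
proof -
  have "\<forall>b\<in>B. \<exists>c. z * b = (\<Sum>b'\<in>B. of_int (c b') * b')"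
    using stable unfolding Z_module.span_finite[OF B(1)] by auto
  then obtain c where c: "\<And>b. b \<in> B \<Longrightarrow> z * b = (\<Sum>b'\<in>B. of_int (c b b') * b')" by metis
  obtain bs where bs: "set bs = B" "distinct bs" using finite_distinct_list[OF B(1)] by blast
  define N where "N = length bs"
  define M :: "int mat" where "M = mat N N (\<lambda>(i, j). c (bs ! i) (bs ! j))"
  define A :: "'a mat" where "A = map_mat of_int M"
  have M: "M \<in> carrier_mat N N" and A: "A \<in> carrier_mat N N" by (simp_all add: M_def A_def)
  have "bij_betw (\<lambda>j. bs ! j) {0..<N} B"
    using bij_betw_nth[OF bs(2), of "{..<N}" B] bs(1) by (simp add: N_def atLeast0LessThan)
  note reindex = sum.reindex_bij_betw[OF this]
  have "eigenvector A (vec N (\<lambda>i. bs ! i)) z"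
    unfolding eigenvector_def
  proof (intro conjI)
    obtain j where j: "j < N" "bs ! j = b0" using B(2) bs(1) by (auto simp: N_def in_set_conv_nth)
    show "vec N (\<lambda>i. bs ! i) \<noteq> 0\<^sub>v (dim_row A)"
    proof
      assume "vec N (\<lambda>i. bs ! i) = 0\<^sub>v (dim_row A)"
      then have "vec N (\<lambda>i. bs ! i) $ j = 0\<^sub>v (dim_row A) $ j" by simp
      then show False using j B(3) A by simp
    qed
    show "A *\<^sub>v vec N (\<lambda>i. bs ! i) = z \<cdot>\<^sub>v vec N (\<lambda>i. bs ! i)"
    proof (rule eq_vecI)
      fix i assume "i < dim_vec (z \<cdot>\<^sub>v vec N (\<lambda>i. bs ! i))"
      then have i: "i < N" by simp
      then have "(A *\<^sub>v vec N (\<lambda>i. bs ! i)) $ i = (\<Sum>j\<in>{0..<N}. of_int (c (bs ! i) (bs ! j)) * bs ! j)"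
        by (simp add: A_def M_def scalar_prod_def)
      also have "\<dots> = (\<Sum>b'\<in>B. of_int (c (bs ! i) b') * b')" by (rule reindex)
      also have "\<dots> = z * bs ! i" using i bs(1) by (intro c[symmetric]) (simp add: N_def nth_mem flip: bs(1))
      finally show "(A *\<^sub>v vec N (\<lambda>i. bs ! i)) $ i = (z \<cdot>\<^sub>v vec N (\<lambda>i. bs ! i)) $ i" using i by simp
    qed (use A in simp)
  qed (use A in simp)
  then have "eigenvalue A z" by (auto simp: eigenvalue_def)
  then have "poly (char_poly A) z = 0" by (simp add: eigenvalue_root_char_poly[OF A])
  moreover have "char_poly A = map_poly of_int (char_poly M)"
    unfolding A_def by (rule of_int_hom.char_poly_hom[OF M])
  moreover have "lead_coeff (char_poly M) = 1" using degree_monic_char_poly[OF M] by simp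
  ultimately show ?thesis unfolding algebraic_int_altdef_ipoly by auto
qed

lemma algebraic_int_power_relation:
  fixes x :: "'a :: field_char_0"
  assumes "algebraic_int x"
  obtains m c where "m > 0" "x ^ m = (\<Sum>i<m. of_int (c i) * x ^ i)"
proof -
  obtain p where p: "poly (map_poly of_int p) x = 0" "lead_coeff p = 1"
    using assms by (auto simp: algebraic_int_altdef_ipoly)
  define m where "m = degree p"
  have "(\<Sum>i\<le>m. of_int (coeff p i) * x ^ i) = 0"
    using p(1) by (simp add: poly_altdef m_def)
  then have "x ^ m = (\<Sum>i<m. of_int (- coeff p i) * x ^ i)"
    using p(2) by (simp add: m_def sum_negf add_eq_0_iff flip: lessThan_Suc_atMost)
  moreover have "m > 0"
  proof (rule ccontr)
    assume "\<not> m > 0"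
    then obtain a where "p = [:a:]" using degree_eq_zeroE[of p] by (auto simp: m_def)
    with p show False by simp
  qed
  ultimately show ?thesis by (intro that[of m "\<lambda>i. - coeff p i"]) simp_all
qed

text \<open>The integer span of the products x^i y^j with exponents below the degrees of the two
  relations is stable under multiplication by \<open>x\<close> and by \<open>y\<close>.\<close>

lemma algebraic_int_add_mult:
  fixes x y :: "'a :: field_char_0"
  assumes "algebraic_int x" "algebraic_int y"
  shows "algebraic_int (x + y)" "algebraic_int (x * y)"
proof -
  obtain m c where m: "m > 0" and x: "x ^ m = (\<Sum>i<m. of_int (c i) * x ^ i)"
    using assms(1) by (rule algebraic_int_power_relation)
  obtain n d where n: "n > 0" and y: "y ^ n = (\<Sum>j<n. of_int (d j) * y ^ j)"
    using assms(2) by (rule algebraic_int_power_relation)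
  define B where "B = (\<lambda>(i, j). x ^ i * y ^ j) ` ({..<m} \<times> {..<n})"
  have base: "x ^ i * y ^ j \<in> Z_module.span B" if "i < m" "j < n" for i j
    using that by (intro Z_module.span_base) (auto simp: B_def)
  have fin: "finite B" by (simp add: B_def)
  have one: "1 \<in> B" unfolding B_def by (rule image_eqI[of _ _ "(0, 0)"]) (use m n in simp_all)
  have xB: "x * b \<in> Z_module.span B" if b: "b \<in> B" for b
  proof -
    obtain i j where ij: "b = x ^ i * y ^ j" "i < m" "j < n" using b by (auto simp: B_def)
    show ?thesis
    proof (cases "Suc i < m")
      case True
      then show ?thesis using base[OF True ij(3)] by (simp add: ij(1) mult.assoc)
    next
      case False
      then have "m = Suc i" using ij(2) by simp
      then have "x * b = x ^ m * y ^ j" by (simp add: ij(1) mult.assoc)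
      also have "\<dots> = (\<Sum>i<m. of_int (c i) * (x ^ i * y ^ j))"
        unfolding x by (simp add: sum_distrib_right mult.assoc)
      also have "\<dots> \<in> Z_module.span B"
        by (intro Z_module.span_sum Z_module.span_scale base) (use ij in auto)
      finally show ?thesis .
    qed
  qed
  have yB: "y * b \<in> Z_module.span B" if b: "b \<in> B" for b
  proof -
    obtain i j where ij: "b = x ^ i * y ^ j" "i < m" "j < n" using b by (auto simp: B_def)
    show ?thesis
    proof (cases "Suc j < n")
      case True
      then show ?thesis using base[OF ij(2) True] by (simp add: ij(1) mult.left_commute)
    next
      case False
      then have "n = Suc j" using ij(3) by simp
      then have "y * b = x ^ i * y ^ n" by (simp add: ij(1) mult.left_commute)
      also have "\<dots> = (\<Sum>j<n. of_int (d j) * (x ^ i * y ^ j))"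
        unfolding y by (simp add: sum_distrib_left mult.left_commute)
      also have "\<dots> \<in> Z_module.span B"
        by (intro Z_module.span_sum Z_module.span_scale base) (use ij in auto)
      finally show ?thesis .
    qed
  qed
  \<comment> \<open>For the product, \<open>y * b\<close> is only in the span, so stability under
    \<open>x\<close> is extended from \<open>B\<close> to the span.\<close>
  have x_span: "x * s \<in> Z_module.span B" if "s \<in> Z_module.span B" for s
  proof -
    have "Z_module.span B \<subseteq> {s. x * s \<in> Z_module.span B}"
    proof (rule Z_module.span_minimal)
      show "Z_module.subspace {s. x * s \<in> Z_module.span B}"
      proof (rule Z_module.subspaceI)
        fix c s assume "s \<in> {s. x * s \<in> Z_module.span B}"
        then have "of_int c * (x * s) \<in> Z_module.span B" by (intro Z_module.span_scale) simp
        then show "of_int c * s \<in> {s. x * s \<in> Z_module.span B}" by (simp add: mult.left_commute[of x])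
      qed (simp_all add: distrib_left Z_module.span_add Z_module.span_zero)
    qed (use xB in blast)
    then show ?thesis using that by blast
  qed
  show "algebraic_int (x + y)"
    by (rule algebraic_int_if_stable[OF fin one])
      (auto simp: distrib_right intro: Z_module.span_add xB yB)
  show "algebraic_int (x * y)"
    by (rule algebraic_int_if_stable[OF fin one]) (auto simp: mult.assoc intro: x_span yB)
qed

section \<open>Roots of unity in a number field\<close>

lemma finite_bounded_int_polys: "finite {g :: int poly. degree g \<le> d \<and> (\<forall>k. \<bar>coeff g k\<bar> \<le> C)}"
proof (rule finite_subset)
  show "{g. degree g \<le> d \<and> (\<forall>k. \<bar>coeff g k\<bar> \<le> C)} \<subseteq> Poly ` {xs. set xs \<subseteq> {- C..C} \<and> length xs = Suc d}"
  proof
    fix g :: "int poly" assume g: "g \<in> {g. degree g \<le> d \<and> (\<forall>k. \<bar>coeff g k\<bar> \<le> C)}"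
    have "g = Poly (map (coeff g) [0..<Suc d])"
    proof (rule poly_eqI)
      fix k show "coeff g k = coeff (Poly (map (coeff g) [0..<Suc d])) k"
        using g coeff_eq_0[of g k] by (auto simp: nth_default_def simp del: upt_Suc)
    qed
    moreover have "coeff g k \<in> {- C..C}" for k using g by (simp add: abs_le_iff minus_le_iff)
    then have "map (coeff g) [0..<Suc d] \<in> {xs. set xs \<subseteq> {- C..C} \<and> length xs = Suc d}" by auto
    ultimately show "g \<in> Poly ` {xs. set xs \<subseteq> {- C..C} \<and> length xs = Suc d}" by (rule image_eqI)
  qed
  show "finite (Poly ` {xs. set xs \<subseteq> {- C..C} \<and> length xs = Suc d})"
    by (intro finite_imageI finite_lists_length_eq) simp
qed

text \<open>Landau's inequality bounds the measure by the Euclidean norm of the coefficients, of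
  which at most two are nonzero, each of modulus 1. The bound is uniform in
  \<open>m\<close>.\<close>

lemma mahler_measure_unity: "mahler_measure (monom 1 m - 1) \<le> sqrt 2"
proof -
  define f :: "complex poly" where "f = monom 1 m - 1"
  have "map_poly complex_of_int (monom 1 m - 1) = f"
    by (intro poly_eqI) (simp add: f_def coeff_map_poly)
  then have "mahler_measure (monom 1 m - 1) \<le> sqrt (\<Sum>a\<leftarrow>coeffs f. (cmod a)\<^sup>2)"
    unfolding mahler_measure_def using Landau_inequality[of f] by simp
  also have "(\<Sum>a\<leftarrow>coeffs f. (cmod a)\<^sup>2) \<le> 2"
  proof (cases "f = 0")
    case False
    have "(\<Sum>a\<leftarrow>coeffs f. (cmod a)\<^sup>2) = (\<Sum>i\<in>{0..<Suc (degree f)}. (cmod (coeff f i))\<^sup>2)"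
      using False by (simp add: coeffs_def o_def interv_sum_list_conv_sum_set_nat del: upt_Suc)
    also have "\<dots> \<le> (\<Sum>i\<in>{0..<Suc (degree f)}. if i \<in> {0, m} then 1 else 0)"
      by (intro sum_mono) (auto simp: f_def)
    also have "\<dots> = real (card ({0..<Suc (degree f)} \<inter> {0, m}))"
      by (subst sum.inter_restrict[symmetric]) (simp_all only: finite_atLeastLessThan sum_constant mult_1_right)
    also have "\<dots> \<le> real (card {0, m})" by (intro of_nat_mono card_mono) auto
    also have "\<dots> \<le> 2" by (simp add: card_insert_if)
    finally show ?thesis .
  qed simp
  finally show ?thesis by simp
qed

interpretation Q_vs: vector_space "\<lambda>(q :: rat) (x :: 'a :: field_char_0). of_rat q * x"
  by unfold_locales (simp_all add: algebra_simps of_rat_add of_rat_mult)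

lemma rat_poly_root_imp_int_poly_root:
  fixes x :: "'a :: field_char_0"
  assumes "f \<noteq> 0" "poly (map_poly of_rat f) x = 0"
  shows "\<exists>p :: int poly. p \<noteq> 0 \<and> degree p = degree f \<and> poly (map_poly of_int p) x = 0"
proof -
  obtain c p where "rat_to_int_poly f = (c, p)" by force
  from rat_to_int_poly[OF this] have c: "c > 0"
    and f: "f = Polynomial.smult (inverse (of_int c)) (map_poly of_int p)" by auto
  have "map_poly of_rat f = Polynomial.smult (inverse (of_int c)) (map_poly of_int p :: 'a poly)"
    by (intro poly_eqI) (simp add: f coeff_map_poly of_rat_mult of_rat_inverse)
  then have "poly (map_poly of_int p) x = 0" using assms(2) c by simp
  moreover have "p \<noteq> 0" "degree p = degree f" using assms(1) c by (auto simp: f)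
  ultimately show ?thesis by blast
qed

text \<open>The d + 1 powers of \<open>x\<close> up to exponent d lie in a rational space spanned by
  d elements; a linear relation between them is cleared of denominators.\<close>

lemma number_field_int_poly:
  fixes K :: "'a :: field_char_0 set"
  assumes K: "number_field K"
  obtains d where "\<And>x. x \<in> K \<Longrightarrow> \<exists>p :: int poly. p \<noteq> 0 \<and> degree p \<le> d \<and> poly (map_poly of_int p) x = 0"
proof -
  obtain B where B: "finite B" "K = Q_vs.span B" using K unfolding number_field_def by blast
  define d where "d = card B"
  have "\<exists>p :: int poly. p \<noteq> 0 \<and> degree p \<le> d \<and> poly (map_poly of_int p) x = 0" if x: "x \<in> K" for x
  \<comment> \<open>If two powers coincide, they form too small a set for the dimension argument;
    the difference of two monomials serves instead.\<close>
  proof (cases "inj_on (\<lambda>i. x ^ i) {..d}")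
    case False
    then obtain i j where ij: "i \<le> d" "j \<le> d" "i < j" "x ^ i = x ^ j"
      by (metis atMost_iff inj_onI linorder_neqE_nat)
    define p :: "int poly" where "p = monom 1 j - monom 1 i"
    have "coeff p j = 1" using ij by (simp add: p_def)
    then have "p \<noteq> 0" by auto
    moreover have "degree p \<le> d" unfolding p_def
      using ij by (intro degree_diff_le) (simp_all add: degree_monom_eq)
    moreover have "map_poly of_int p = monom 1 j - (monom 1 i :: 'a poly)"
      by (intro poly_eqI) (simp add: p_def coeff_map_poly)
    then have "poly (map_poly of_int p) x = 0" using ij by (simp add: poly_monom)
    ultimately show ?thesis by blast
  next
    case inj: True
    define S where "S = (\<lambda>i. x ^ i) ` {..d}"
    have "x ^ i \<in> K" for i using K x by (induction i) (auto simp: number_field_def)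
    then have "S \<subseteq> Q_vs.span B" by (auto simp: S_def B(2))
    moreover have "card S = Suc d" by (simp add: S_def card_image[OF inj])
    ultimately have "Q_vs.dependent S"
      using Q_vs.independent_span_bound[OF B(1), of S] by (auto simp: d_def)
    then obtain u where u: "\<exists>v\<in>S. u v \<noteq> 0" "(\<Sum>v\<in>S. of_rat (u v) * v) = 0"
      using Q_vs.dependent_finite[of S] by (auto simp: S_def)
    define f where "f = (\<Sum>i\<le>d. monom (u (x ^ i)) i)"
    have coeff_f: "coeff f i = (if i \<le> d then u (x ^ i) else 0)" for i
      by (simp add: f_def coeff_sum)
    have "f \<noteq> 0"
    proof
      assume "f = 0"
      obtain i where "i \<le> d" "u (x ^ i) \<noteq> 0" using u(1) by (auto simp: S_def)
      then show False using coeff_f[of i] \<open>f = 0\<close> by simp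
    qed
    moreover have deg: "degree f \<le> d" by (rule degree_le) (simp add: coeff_f)
    moreover have "map_poly of_rat f = (\<Sum>i\<le>d. monom (of_rat (u (x ^ i))) i :: 'a poly)"
      by (intro poly_eqI) (simp add: coeff_map_poly coeff_f coeff_sum)
    then have "poly (map_poly of_rat f) x = (\<Sum>v\<in>S. of_rat (u v) * v)"
      by (simp add: poly_sum poly_monom S_def sum.reindex[OF inj])
    ultimately show ?thesis using rat_poly_root_imp_int_poly_root[of f x] u(2) by auto
  qed
  then show ?thesis by (rule that)
qed

text \<open>A primitive integer polynomial of minimal degree with root \<open>x\<close> divides \<open>X\<^sup>m - 1\<close>. By Mignotte's bound
  its coefficients are bounded in terms of its degree, independently of \<open>m\<close>.\<close>

lemma finite_roots_of_unity:
  fixes K :: "'a :: field_char_0 set"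
  assumes K: "number_field K"
  shows "finite {x \<in> K. \<exists>m>0. x ^ m = 1}"
proof -
  obtain d where d: "\<And>x. x \<in> K \<Longrightarrow>
      \<exists>p :: int poly. p \<noteq> 0 \<and> degree p \<le> d \<and> poly (map_poly of_int p) x = 0"
    using number_field_int_poly[OF K] by blast
  \<comment> \<open>Mignotte's bound: a binomial coefficient, at most 2^d, times the Mahler measure,
    at most \<open>sqrt 2\<close>, which is rounded up to 2 to get an integer.\<close>
  define G where "G = {g :: int poly. degree g \<le> d \<and> (\<forall>k. \<bar>coeff g k\<bar> \<le> 2 ^ d * 2)}"
  have "{x \<in> K. \<exists>m>0. x ^ m = 1} \<subseteq> (\<Union>g\<in>G - {0}. {x. poly (map_poly of_int g) x = 0})"
  proof safe
    fix x and m :: nat assume x: "x \<in> K" "m > 0" "x ^ m = 1"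
    define P where "P p \<longleftrightarrow> p \<noteq> 0 \<and> poly (map_poly of_int p) x = 0" for p :: "int poly"
    obtain p0 where p0: "P p0" "degree p0 \<le> d" using d[OF x(1)] by (auto simp: P_def)
    obtain p where p: "P p" "\<And>q. P q \<Longrightarrow> degree p \<le> degree q"
      using ex_has_least_nat[of P p0 degree] p0(1) by blast
    have p_ne: "p \<noteq> 0" and p_root: "poly (map_poly of_int p) x = 0" using p(1) by (simp_all add: P_def)
    define F :: "int poly" where "F = monom 1 m - 1"
    have "coeff F m = 1" using x(2) by (simp add: F_def)
    then have F: "F \<noteq> 0" by auto
    have "map_poly of_int F = (monom 1 m - 1 :: 'a poly)"
      by (intro poly_eqI) (simp add: F_def coeff_map_poly)
    then have F_root: "poly (map_poly of_int F) x = 0" by (simp add: poly_monom x(3))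
    \<comment> \<open>Over the integers only a multiple of \<open>F\<close> can be divided by
      \<open>p\<close>. The remainder has the root \<open>x\<close>, so minimality of the degree
      makes it 0.\<close>
    define r where "r = pseudo_mod F p"
    obtain a q where a: "a \<noteq> 0" "Polynomial.smult a F = p * q + r" and r: "r = 0 \<or> degree r < degree p"
      using pseudo_mod[OF p_ne, of F] by (auto simp: r_def)
    have "r = Polynomial.smult a F - p * q" using a(2) by simp
    then have "poly (map_poly of_int r) x = 0"
      using F_root p_root by (simp add: hom_distribs)
    then have "r \<noteq> 0 \<Longrightarrow> degree p \<le> degree r" by (intro p(2)) (simp add: P_def)
    \<comment> \<open>Gauss's lemma: passing to the primitive part removes the factor
      \<open>a\<close>.\<close>
    then have "r = 0" using r by linarith
    then have dvd: "primitive_part p dvd F" using a by (intro dvd_smult_int[of a]) simp_all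
    let ?g = "primitive_part p"
    have g_ne: "?g \<noteq> 0" using p_ne by simp
    have deg: "degree ?g \<le> d" using p(2)[OF p0(1)] p0(2) by simp
    have "\<bar>coeff ?g k\<bar> \<le> 2 ^ d * 2" for k
    proof -
      have "real_of_int \<bar>coeff ?g k\<bar> \<le> real (degree ?g choose k) * mahler_measure ?g"
        by (rule Mignotte_bound)
      also have "\<dots> \<le> 2 ^ d * sqrt 2"
      proof (rule mult_mono)
        have "degree ?g choose k \<le> 2 ^ degree ?g" by (rule binomial_le_pow2)
        also have "\<dots> \<le> 2 ^ d" using deg by (intro power_increasing) simp_all
        finally have "real (degree ?g choose k) \<le> real (2 ^ d)" by (rule of_nat_mono)
        then show "real (degree ?g choose k) \<le> 2 ^ d" by simp
        show "mahler_measure ?g \<le> sqrt 2"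
          using mahler_measure_dvd[OF F dvd] mahler_measure_unity[of m] by (simp add: F_def)
      qed (simp_all add: mahler_measure_ge_0)
      also have "\<dots> \<le> 2 ^ d * 2" by (intro mult_left_mono real_le_lsqrt) simp_all
      finally have "real_of_int \<bar>coeff ?g k\<bar> \<le> real_of_int (2 ^ d * 2)" by simp
      then show ?thesis by (simp only: of_int_le_iff)
    qed
    then have "?g \<in> G - {0}" using deg g_ne by (simp add: G_def)
    moreover have "poly (map_poly of_int ?g) x = 0"
    proof -
      have "map_poly of_int p = Polynomial.smult (of_int (content p)) (map_poly of_int ?g :: 'a poly)"
        by (subst content_times_primitive_part[of p, symmetric]) (simp only: of_int_hom.map_poly_hom_smult)
      then show ?thesis using p_root p_ne by simp
    qed
    ultimately show "x \<in> (\<Union>g\<in>G - {0}. {x. poly (map_poly of_int g) x = 0})" by blast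
  qed
  moreover have "finite G" unfolding G_def by (rule finite_bounded_int_polys)
  then have "finite (\<Union>g\<in>G - {0}. {x :: 'a. poly (map_poly of_int g) x = 0})"
    by (intro finite_UN_I poly_roots_finite) simp_all
  ultimately show ?thesis by (rule finite_subset)
qed

text \<open>Units of finite order are roots of unity in \<open>K\<close>, of which there are
  finitely many.\<close>

lemma unit_of_infinite_order:
  fixes K :: "'a :: field_char_0 set"
  assumes K: "number_field K" and inf: "infinite (units_in (ring_of_integers K))"
  shows "\<exists>u\<in>units_in (ring_of_integers K). \<forall>k>0. u ^ k \<noteq> 1"
proof -
  have "\<not> units_in (ring_of_integers K) \<subseteq> {x \<in> K. \<exists>m>0. x ^ m = 1}"
    using finite_subset[OF _ finite_roots_of_unity[OF K]] inf by blast
  then show ?thesis by (auto simp: units_in_def ring_of_integers_def)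
qed

section \<open>General linear groups\<close>

text \<open>Taking all nonzero field elements as the target of the determinant spares the proof that
  determinants lie in the subring.\<close>

definition nonzero_monoid :: "'a :: field monoid" where
  "nonzero_monoid = \<lparr>carrier = {x. x \<noteq> 0}, mult = (*), one = 1\<rparr>"

lemma nonzero_simps [simp]:
  "x \<in> carrier nonzero_monoid \<longleftrightarrow> x \<noteq> 0"
  "x \<otimes>\<^bsub>nonzero_monoid\<^esub> y = x * y" "\<one>\<^bsub>nonzero_monoid\<^esub> = 1"
  by (simp_all add: nonzero_monoid_def)

lemma comm_group_nonzero: "comm_group (nonzero_monoid :: 'a :: field monoid)"
proof (rule comm_groupI)
  fix x :: 'a assume "x \<in> carrier nonzero_monoid"
  then show "\<exists>y\<in>carrier nonzero_monoid. y \<otimes>\<^bsub>nonzero_monoid\<^esub> x = \<one>\<^bsub>nonzero_monoid\<^esub>"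
    by (intro bexI[of _ "inverse x"]) simp_all
qed (simp_all add: mult_ac)

lemma nonzero_pow: "x [^]\<^bsub>nonzero_monoid\<^esub> (m :: nat) = x ^ m"
  by (induction m) simp_all

locale subring_set =
  fixes S :: "'a :: field set"
  assumes zero: "0 \<in> S" and one: "1 \<in> S"
    and add: "x \<in> S \<Longrightarrow> y \<in> S \<Longrightarrow> x + y \<in> S"
    and mult: "x \<in> S \<Longrightarrow> y \<in> S \<Longrightarrow> x * y \<in> S"
    and uminus: "x \<in> S \<Longrightarrow> - x \<in> S"
begin

lemma sum: "(\<And>i. i \<in> I \<Longrightarrow> f i \<in> S) \<Longrightarrow> sum f I \<in> S"
  by (induction I rule: infinite_finite_induct) (simp_all add: zero add)

lemma carrier_mat_monoid:
  "A \<in> carrier (mat_monoid n S) \<longleftrightarrow> A \<in> carrier_mat n n \<and> (\<forall>i<n. \<forall>j<n. A $$ (i, j) \<in> S)"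
  by (auto simp: mat_monoid_def)

lemma mat_monoid_simps [simp]: "A \<otimes>\<^bsub>mat_monoid n S\<^esub> B = A * B" "\<one>\<^bsub>mat_monoid n S\<^esub> = 1\<^sub>m n"
  by (simp_all add: mat_monoid_def)

lemma monoid_mat_monoid: "monoid (mat_monoid n S)"
proof (rule monoidI)
  fix A B assume AB: "A \<in> carrier (mat_monoid n S)" "B \<in> carrier (mat_monoid n S)"
  have "(A * B) $$ (i, j) \<in> S" if "i < n" "j < n" for i j
    using AB that by (auto simp: carrier_mat_monoid scalar_prod_def intro!: sum mult)
  then show "A \<otimes>\<^bsub>mat_monoid n S\<^esub> B \<in> carrier (mat_monoid n S)"
    using AB by (auto simp: carrier_mat_monoid intro: mult_carrier_mat)
next
  fix A B C assume "A \<in> carrier (mat_monoid n S)" "B \<in> carrier (mat_monoid n S)" "C \<in> carrier (mat_monoid n S)"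
  then show "A \<otimes>\<^bsub>mat_monoid n S\<^esub> B \<otimes>\<^bsub>mat_monoid n S\<^esub> C = A \<otimes>\<^bsub>mat_monoid n S\<^esub> (B \<otimes>\<^bsub>mat_monoid n S\<^esub> C)"
    by (simp add: carrier_mat_monoid assoc_mult_mat[of _ n n _ n _ n])
qed (auto simp: carrier_mat_monoid zero one)

lemma group_GL: "group (GL n S)"
  unfolding GL_def by (rule monoid.units_group[OF monoid_mat_monoid])

lemma GL_simps [simp]: "A \<otimes>\<^bsub>GL n S\<^esub> B = A * B" "\<one>\<^bsub>GL n S\<^esub> = 1\<^sub>m n"
  by (simp_all add: GL_def units_of_mult units_of_one)

lemma carrier_GL:
  "A \<in> carrier (GL n S) \<longleftrightarrow> A \<in> carrier (mat_monoid n S) \<and>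
     (\<exists>B\<in>carrier (mat_monoid n S). B * A = 1\<^sub>m n \<and> A * B = 1\<^sub>m n)"
  by (simp add: GL_def units_of_carrier Units_def)

lemma carrier_GL_mat: "A \<in> carrier (GL n S) \<Longrightarrow> A \<in> carrier_mat n n"
  by (simp add: carrier_GL carrier_mat_monoid)

lemma det_hom: "group_hom (GL n S) nonzero_monoid det"
proof (intro group_hom.intro group_hom_axioms.intro homI group_GL)
  show "group (nonzero_monoid :: 'a monoid)" by (rule comm_group.axioms(2)[OF comm_group_nonzero])
  fix A assume A: "A \<in> carrier (GL n S)"
  then obtain B where B: "B \<in> carrier_mat n n" "A * B = 1\<^sub>m n" by (auto simp: carrier_GL carrier_mat_monoid)
  have "det A * det B = 1" using det_mult[OF carrier_GL_mat[OF A] B(1)] B(2) by simp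
  then show "det A \<in> carrier nonzero_monoid" by auto
next
  fix A B assume "A \<in> carrier (GL n S)" "B \<in> carrier (GL n S)"
  then show "det (A \<otimes>\<^bsub>GL n S\<^esub> B) = det A \<otimes>\<^bsub>nonzero_monoid\<^esub> det B"
    by (simp add: det_mult[of _ n] carrier_GL_mat)
qed

lemma scalar_in_GL:
  assumes "u \<in> units_in S"
  shows "u \<cdot>\<^sub>m 1\<^sub>m n \<in> carrier (GL n S)"
proof -
  obtain v where v: "u \<in> S" "v \<in> S" "u * v = 1" using assms by (auto simp: units_in_def)
  have scalar: "c \<cdot>\<^sub>m 1\<^sub>m n \<in> carrier (mat_monoid n S)" if "c \<in> S" for c
    using that by (auto simp: carrier_mat_monoid zero)
  have prod: "(c \<cdot>\<^sub>m 1\<^sub>m n) * (d \<cdot>\<^sub>m 1\<^sub>m n) = (c * d) \<cdot>\<^sub>m 1\<^sub>m n" for c d :: 'a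
    by (rule eq_matI) (simp_all add: mult_smult_assoc_mat[of _ n n _ n])
  have one_smult: "(1 :: 'a) \<cdot>\<^sub>m 1\<^sub>m n = 1\<^sub>m n" by (rule eq_matI) auto
  show ?thesis
    using v by (auto simp: carrier_GL scalar prod one_smult mult.commute[of v] intro!: bexI[of _ "v \<cdot>\<^sub>m 1\<^sub>m n"])
qed

lemma addrow_mat_mult:
  fixes a b :: "'b :: comm_ring_1"
  assumes "1 < n"
  shows "addrow_mat n a 0 1 * addrow_mat n b 0 1 = addrow_mat n (a + b) 0 1"
proof -
  have "addrow_mat n a 0 1 * addrow_mat n b 0 1 = addrow a 0 1 (addrow_mat n b 0 1)"
    by (rule addrow_mat[of _ n n, symmetric]) (use assms in simp_all)
  also have "\<dots> = addrow_mat n (a + b) 0 1"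
    by (rule eq_matI) (use assms in \<open>auto simp: addrow_mat_def\<close>)
  finally show ?thesis .
qed

lemma addrow_mat_0: "addrow_mat n (0 :: 'b :: comm_ring_1) 0 1 = 1\<^sub>m n"
  by (rule eq_matI) (auto simp: addrow_mat_def)

lemma addrow_in_GL:
  assumes "1 < n"
  shows "addrow_mat n 1 0 1 \<in> carrier (GL n S)"
proof -
  have el: "addrow_mat n c 0 1 \<in> carrier (mat_monoid n S)" if "c \<in> S" for c
    using that by (auto simp: carrier_mat_monoid addrow_mat_def zero one)
  show ?thesis
    unfolding carrier_GL
    using el[OF one] el[OF uminus[OF one]] addrow_mat_mult[OF assms, of 1 "- 1"] addrow_mat_mult[OF assms, of "- 1" 1]
    by (intro conjI bexI[of _ "addrow_mat n (- 1) 0 1"]) (simp_all add: addrow_mat_0[simplified])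
qed

lemma addrow_pow:
  assumes "1 < n"
  shows "addrow_mat n 1 0 1 [^]\<^bsub>GL n S\<^esub> (m :: nat) = addrow_mat n (of_nat m) 0 1"
proof (induction m)
  case 0
  show ?case using addrow_mat_0[of n, where 'b = 'a] by simp
next
  case (Suc m)
  then show ?case using addrow_mat_mult[OF assms, of "of_nat m :: 'a" 1] by (simp add: add.commute)
qed

end

lemma subring_set_ring_of_integers:
  assumes "number_field K"
  shows "subring_set (ring_of_integers K)"
  using assms algebraic_int_add_mult
  by unfold_locales (auto simp: number_field_def ring_of_integers_def)

theorem theorem4p4:
  fixes K :: "'a::field_char_0 set" and n :: nat
  assumes "n \<ge> 3"
    and "number_field K"
    and "infinite (units_in (ring_of_integers K))"
  shows "\<not> bi_interpretable
            group_language (group_structure (GL n (ring_of_integers K)))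
            ring_language (ring_structure \<Z>)"
proof -
  have n: "1 < n" using assms(1) by simp
  interpret subring_set "ring_of_integers K" by (rule subring_set_ring_of_integers[OF assms(2)])
  obtain u where u: "u \<in> units_in (ring_of_integers K)" "\<And>k. k > 0 \<Longrightarrow> u ^ k \<noteq> 1"
    using unit_of_infinite_order[OF assms(2,3)] by blast
  show ?thesis
  proof (rule not_bi_interpretable_int[OF det_hom comm_group_nonzero scalar_in_GL[OF u(1)] _ _ addrow_in_GL[OF n]])
    fix A assume "A \<in> carrier (GL n (ring_of_integers K))"
    then have "A \<in> carrier_mat n n" by (rule carrier_GL_mat)
    then show "u \<cdot>\<^sub>m 1\<^sub>m n \<otimes>\<^bsub>GL n (ring_of_integers K)\<^esub> A = A \<otimes>\<^bsub>GL n (ring_of_integers K)\<^esub> (u \<cdot>\<^sub>m 1\<^sub>m n)"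
      by (simp add: mult_smult_assoc_mat[of _ n n _ n] mult_smult_distrib[of _ n n _ n])
  next
    fix k :: int assume k: "k > 0"
    \<comment> \<open>The determinant of the scalar matrix is u^n, of infinite order like
      \<open>u\<close>.\<close>
    have "det (u \<cdot>\<^sub>m 1\<^sub>m n) [^]\<^bsub>nonzero_monoid\<^esub> int (nat k) = u ^ (n * nat k)"
      unfolding int_pow_int nonzero_pow by (simp add: power_mult)
    then show "det (u \<cdot>\<^sub>m 1\<^sub>m n) [^]\<^bsub>nonzero_monoid\<^esub> k \<noteq> \<one>\<^bsub>nonzero_monoid\<^esub>"
      using u(2)[of "n * nat k"] k n by simp
  next
    show "det (addrow_mat n 1 0 1) = \<one>\<^bsub>nonzero_monoid\<^esub>" by (simp add: det_addrow_mat)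
  next
    fix m m' :: nat
    assume "addrow_mat n 1 0 1 [^]\<^bsub>GL n (ring_of_integers K)\<^esub> m =
      addrow_mat n 1 0 1 [^]\<^bsub>GL n (ring_of_integers K)\<^esub> m'"
    \<comment> \<open>The entry at (0, 1) records the exponent faithfully in characteristic
      zero.\<close>
    then have "addrow_mat n (of_nat m :: 'a) 0 1 $$ (0, 1) = addrow_mat n (of_nat m') 0 1 $$ (0, 1)"
      unfolding addrow_pow[OF n] by simp
    then show "m = m'" using n by (simp add: addrow_mat_def)
  qed
qed

end
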